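(* Let $A:\mathbb{R}^N\to\mathbb{R}^N$ be Lipschitz, let $u\in H^1_A(\mathbb{R}^N)$, and let $(\rho_n)$ be a sequence of radial mollifiers such that $$\sup_{t>1}\sup_n t^{-2}\rho_n(t)<+\infty.$$ Then $$\lim_{n\to+\infty}D_n(u,x)=2Q_N|\nabla u(x)-\mathrm{i}A(x)u(x)|^2\quad\text{for a.e. }x\in\mathbb{R}^N,$$ and $$\lim_{n\to+\infty}D_n(u,\cdot)=2Q_N|\nabla u(\cdot)-\mathrm{i}A(\cdot)u(\cdot)|^2\quad\text{in }L^1(\mathbb{R}^N).$$
   Context: $N\ge1$ is an integer, $\mathrm{i}$ is the imaginary unit, $|\cdot|$ is the Euclidean norm, and functions $u$ are complex-valued. $H^1_A(\mathbb{R}^N)$ is the space of complex-valued $u\in L^2(\mathbb{R}^N)$ such that $\int_{\mathbb{R}^N}|\nabla u-\mathrm{i}A(x)u|^2dx<\infty$ (weak gradient). For measurable $u:\mathbb{R}^N\to\mathbb{C}$, $\Psi_u(x,y):=e^{\mathrm{i}(x-y)\cdot A\left(\frac{x+y}{2}\right)}u(y)$ for $x,y\in\mathbb{R}^N$ (so $\Psi_u(x,x)=u(x)$). A sequence of nonnegative radial functions $\{\rho_n\}_{n\in\mathbb{N}}$ (regarded as functions of $r=|z|$) is called a sequence of mollifiers if $\int_0^\infty\rho_n(r)r^{N-1}dr=1$ for all $n$ and $\lim_{n\to+\infty}\int_\delta^\infty\rho_n(r)r^{N-1}dr=0$ for all $\delta>0$. For $u\in L^1_{\mathrm{loc}}(\mathbb{R}^N)$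 and $x\in\mathbb{R}^N$, $$D_n(u,x):=\int_{\mathbb{R}^N}\frac{|\Psi_u(x,y)-\Psi_u(x,x)|^2}{|x-y|^2}\rho_n(|x-y|)\,dy.$$ $Q_N:=\frac12\int_{\mathbb{S}^{N-1}}|\boldsymbol{\omega}\cdot\sigma|^2d\sigma$, where $\mathbb{S}^{N-1}$ is the unit sphere of $\mathbb{R}^N$ and $\boldsymbol{\omega}$ is an arbitrary unit vector of $\mathbb{R}^N$ (the value does not depend on $\boldsymbol{\omega}$). *)

theory Defs
  imports "HOL-Analysis.Analysis"
begin

text \<open>
  Functions on $\mathbb{R}^N$ are functions on \<open>real ^ 'n\<close> with $N$ = \<open>CARD('n)\<close>; measurability and
  integrals are with respect to complete Lebesgue measure.
\<close>

section \<open>Weak gradients\<close>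

definition partial_deriv :: "'n \<Rightarrow> (real ^ 'n \<Rightarrow> real) \<Rightarrow> real ^ 'n \<Rightarrow> real" where
  "partial_deriv j \<phi> x = frechet_derivative \<phi> (at x) (axis j 1)"

primrec C_k :: "nat \<Rightarrow> (real ^ 'n \<Rightarrow> real) \<Rightarrow> bool" where
  "C_k 0 \<phi> \<longleftrightarrow> continuous_on UNIV \<phi>"
| "C_k (Suc k) \<phi> \<longleftrightarrow> \<phi> differentiable_on UNIV \<and> (\<forall>j. C_k k (partial_deriv j \<phi>))"

definition test_function :: "(real ^ 'n \<Rightarrow> real) \<Rightarrow> bool" where
  "test_function \<phi> \<longleftrightarrow> (\<forall>k. C_k k \<phi>) \<and> compact (closure {x. \<phi> x \<noteq> 0})"

definition locally_integrable :: "('a::euclidean_space \<Rightarrow> 'b::euclidean_space) \<Rightarrow> bool" where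
  "locally_integrable f \<longleftrightarrow> (\<forall>K. compact K \<longrightarrow> f absolutely_integrable_on K)"

text \<open>\<open>G\<close> is a representative of the weak gradient of \<open>u\<close>, which is determined only almost
  everywhere.\<close>

definition has_weak_gradient ::
    "(real ^ 'n \<Rightarrow> complex) \<Rightarrow> (real ^ 'n \<Rightarrow> complex ^ 'n) \<Rightarrow> bool" where
  "has_weak_gradient u G \<longleftrightarrow>
     locally_integrable u \<and> locally_integrable G \<and>
     (\<forall>\<phi> j. test_function \<phi> \<longrightarrow>
        (LINT x|lebesgue. partial_deriv j \<phi> x *\<^sub>R u x) = - (LINT x|lebesgue. \<phi> x *\<^sub>R (G x $ j)))"

section \<open>The magnetic Sobolev space\<close>

definition square_integrable :: "('a::euclidean_space \<Rightarrow> 'b::euclidean_space) \<Rightarrow> bool" where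
  "square_integrable f \<longleftrightarrow>
     f \<in> borel_measurable lebesgue \<and> integrable lebesgue (\<lambda>x. (norm (f x))\<^sup>2)"

text \<open>$G - \mathrm{i} A u$, used with \<open>G\<close> a weak gradient of \<open>u\<close>.\<close>

definition magnetic_gradient ::
    "(real ^ 'n \<Rightarrow> real ^ 'n) \<Rightarrow> (real ^ 'n \<Rightarrow> complex) \<Rightarrow> (real ^ 'n \<Rightarrow> complex ^ 'n) \<Rightarrow>
     real ^ 'n \<Rightarrow> complex ^ 'n" where
  "magnetic_gradient A u G x = G x - (\<chi> j. \<i> * complex_of_real (A x $ j) * u x)"

definition H1_mag :: "(real ^ 'n \<Rightarrow> real ^ 'n) \<Rightarrow> (real ^ 'n \<Rightarrow> complex) set" where
  "H1_mag A = {u. square_integrable u \<and>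
     (\<exists>G. has_weak_gradient u G \<and> square_integrable (magnetic_gradient A u G))}"

section \<open>Mollifiers and the nonlocal functional\<close>

text \<open>A radial function on $\mathbb{R}^N$ is given by its profile on $[0,\infty)$; values at negative
  arguments are irrelevant. The dimension \<open>N\<close> is passed explicitly since it does not occur in the
  type of the profiles. The normalization also forces integrability, because the integral of a
  non-integrable function is 0.\<close>

definition radial_mollifiers :: "nat \<Rightarrow> (nat \<Rightarrow> real \<Rightarrow> real) \<Rightarrow> bool" where
  "radial_mollifiers N \<rho> \<longleftrightarrow>
     (\<forall>n. set_borel_measurable lebesgue {0..} (\<rho> n)) \<and>
     (\<forall>n. \<forall>r\<ge>0. 0 \<le> \<rho> n r) \<and>
     (\<forall>n. (LINT r:{0..}|lebesgue. \<rho> n r * r ^ (N - 1)) = 1) \<and>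
     (\<forall>\<delta>>0. (\<lambda>n. LINT r:{\<delta>..}|lebesgue. \<rho> n r * r ^ (N - 1)) \<longlonglongrightarrow> 0)"

definition Psi ::
    "(real ^ 'n \<Rightarrow> real ^ 'n) \<Rightarrow> (real ^ 'n \<Rightarrow> complex) \<Rightarrow> real ^ 'n \<Rightarrow> real ^ 'n \<Rightarrow> complex" where
  "Psi A u x y = exp (\<i> * complex_of_real ((x - y) \<bullet> A ((1 / 2) *\<^sub>R (x + y)))) * u y"

text \<open>Valued in \<open>ennreal\<close>, as the integral may be infinite. The integrand at the single point
  \<open>y = x\<close> is immaterial.\<close>

definition D_mag ::
    "(real ^ 'n \<Rightarrow> real ^ 'n) \<Rightarrow> (real \<Rightarrow> real) \<Rightarrow> (real ^ 'n \<Rightarrow> complex) \<Rightarrow> real ^ 'n \<Rightarrow> ennreal" where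
  "D_mag A \<rho> u x =
     (\<integral>\<^sup>+y. ennreal ((cmod (Psi A u x y - Psi A u x x))\<^sup>2 / (norm (x - y))\<^sup>2 * \<rho> (norm (x - y)))
       \<partial>lebesgue)"

section \<open>The constant $Q_N$\<close>

text \<open>Surface measure on the unit sphere:
  $\sigma(E) = N \cdot |\{x : 0 < |x| < 1,\ x/|x| \in E\}|$. For $N = 1$ it is counting measure on
  $\{-1, 1\}$.\<close>

definition sphere_measure :: "(real ^ 'n) measure" where
  "sphere_measure =
     scale_measure (of_nat CARD('n))
       (distr (restrict_space lborel (ball 0 1 - {0})) (restrict_space borel (sphere 0 1))
          (\<lambda>x. x /\<^sub>R norm x))"

lemma emeasure_sphere_measure:
  fixes E :: "(real ^ 'n) set"
  assumes "E \<in> sets borel" "E \<subseteq> sphere 0 1"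
  shows "emeasure sphere_measure E =
    of_nat CARD('n) * emeasure lborel {x \<in> ball 0 1 - {0}. x /\<^sub>R norm x \<in> E}"
proof -
  let ?R = "restrict_space lborel (ball 0 1 - {0}) :: (real ^ 'n) measure"
  let ?S = "restrict_space borel (sphere 0 1) :: (real ^ 'n) measure"
  let ?f = "\<lambda>x::real ^ 'n. x /\<^sub>R norm x"
  have f: "?f \<in> ?R \<rightarrow>\<^sub>M ?S"
    by (rule measurable_restrict_space2) (auto intro!: measurable_restrict_space1)
  have E: "E \<in> sets ?S"
    using assms by (auto simp: sets_restrict_space)
  have "emeasure (distr ?R ?S ?f) E = emeasure ?R (?f -` E \<inter> space ?R)"
    by (rule emeasure_distr[OF f E])
  also have "\<dots> = emeasure lborel (?f -` E \<inter> space ?R)"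
    by (rule emeasure_restrict_space) (auto simp: space_restrict_space)
  also have "?f -` E \<inter> space ?R = {x \<in> ball 0 1 - {0}. ?f x \<in> E}"
    by (auto simp: space_restrict_space)
  finally show ?thesis
    by (simp add: sphere_measure_def)
qed

text \<open>The value does not depend on the unit vector \<open>\<omega>\<close>.\<close>

definition Q_const :: "real ^ 'n \<Rightarrow> real" where
  "Q_const \<omega> = 1 / 2 * (LINT \<sigma>|sphere_measure. \<bar>\<omega> \<bullet> \<sigma>\<bar>\<^sup>2)"

section \<open>Convergence in $L^1$\<close>

definition tendsto_L1 ::
    "(nat \<Rightarrow> 'a::euclidean_space \<Rightarrow> ennreal) \<Rightarrow> ('a \<Rightarrow> real) \<Rightarrow> bool" where
  "tendsto_L1 f g \<longleftrightarrow>
     (\<forall>n. f n \<in> borel_measurable lebesgue \<and> (\<integral>\<^sup>+x. f n x \<partial>lebesgue) < \<infinity>) \<and>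
     integrable lebesgue g \<and>
     (\<lambda>n. LINT x|lebesgue. \<bar>enn2real (f n x) - g x\<bar>) \<longlonglongrightarrow> 0"

end

theory Submission
  imports Defs
begin

text \<open>
  Write \<open>M = \<nabla>u - iAu\<close> and \<open>\<Delta>(x, z) = Psi A u x (x + z) - u x\<close>, so that the functional is the
  integral of \<open>|\<Delta>(x, z)|\<^sup>2 / |z|\<^sup>2 \<rho>(|z|)\<close> over \<open>z\<close>. The phase of \<open>Psi\<close> is evaluated at the midpoint
  of the segment from \<open>x\<close> to \<open>x + z\<close> and is therefore a constant along that segment: with
  \<open>\<alpha> = z \<bullet> A(x + z/2)\<close>, the derivative of \<open>t \<mapsto> exp(-it\<alpha>) u(x + tz)\<close> gives
  \<open>\<Delta>(x, z)\<close> as the integral over \<open>[0, 1]\<close> of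
  \<open>exp(-it\<alpha>) (z \<cdot> M(x + tz) + i z \<bullet> (A(x + tz) - A(x + z/2)) u(x + tz))\<close>
  (\<open>Psi_eq_line_integral\<close>). Outside the phase, \<open>A\<close> survives only in a difference, which the
  Lipschitz bound makes \<open>O(|z|)\<close> uniformly in \<open>x\<close> although \<open>A\<close> itself may be unbounded. The formula
  holds for each \<open>z\<close> and almost every \<open>x\<close>. It rests on the corresponding formula for \<open>u\<close> and its
  weak gradient, proved by duality with smooth bumps (\<open>weak_gradient_line_integral\<close>).

  Two estimates follow. Squaring and integrating in \<open>x\<close>, where translation invariance removes the
  shift by \<open>tz\<close>, bounds the integral of the functional by \<open>2 Q\<^sub>N \<parallel>M\<parallel>\<^sup>2\<close> up to an error that
  vanishes in the limit (\<open>integral_nonlocal_energy_le\<close>, \<open>limsup_integral_nonlocal_energy\<close>). Pointwise,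
  \<open>\<Delta>(x, z)\<close> is compared with \<open>z \<cdot> M(x)\<close>. In polar coordinates the weighted integral of
  \<open>|z \<cdot> M(x)|\<^sup>2 / |z|\<^sup>2\<close> is \<open>2 Q\<^sub>N |M(x)|\<^sup>2\<close> times the mass of the profile. The error is an average
  along segments of \<open>|M(x + tz) - M(x)|\<^sup>2\<close>, and at an \<open>L\<^sup>2\<close> Lebesgue point of \<open>M\<close> the mean of that average
  over the sphere of radius \<open>r\<close> is small uniformly for small \<open>r\<close> (\<open>radial_segment_average_le\<close>). Hence
  the profile enters through its mass alone, whatever its shape. For \<open>|z| > 1\<close> the growth condition
  bounds \<open>\<rho>(|z|) / |z|\<^sup>2\<close>, and truncating \<open>|u|\<^sup>2\<close> at a high level shows that this part disappears
  (\<open>far_part_tendsto_0\<close>).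

  Almost everywhere convergence together with the bound on the upper limit of the integrals is
  exactly what Scheffe's lemma turns into convergence in \<open>L\<^sup>1\<close>.
\<close>

section \<open>Smooth bumps and the fundamental lemma of the calculus of variations\<close>

text \<open>The exponential series of \<open>c / W\<close> dominates its \<open>k\<close>-th term, so \<open>exp (- c / W)\<close> vanishes to every
  order at \<open>W = 0\<close>.\<close>

lemma power_times_exp_neg_le:
  fixes c W :: real
  assumes "c > 0" "W > 0"
  shows "exp (- c / W) \<le> fact k / c ^ k * W ^ k"
proof -
  have "(c / W) ^ k / fact k \<le> exp (c / W)"
  proof -
    have s: "(\<lambda>n. (c / W) ^ n /\<^sub>R fact n) sums exp (c / W)"
      by (rule exp_converges)
    have "(\<Sum>n\<in>{k}. (c / W) ^ n /\<^sub>R fact n) \<le> exp (c / W)"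
      using assms by (subst sums_unique[OF s], intro sum_le_suminf sums_summable[OF s]) auto
    then show ?thesis by (simp add: field_simps)
  qed
  moreover have "(c / W) ^ k / fact k > 0"
    using assms by simp
  ultimately have "inverse (exp (c / W)) \<le> inverse ((c / W) ^ k / fact k)"
    by (intro le_imp_inverse_le)
  then show ?thesis
    using assms by (simp add: exp_minus field_simps power_divide)
qed

text \<open>Besides the bump itself (\<open>p = 1\<close>, \<open>m = 0\<close>) the family contains all its derivatives, which are
  polynomials over powers of \<open>(t - a) (b - t)\<close> times the same exponential. As \<open>c\<close> tends to 0, the bump
  increases to the indicator of the open interval.\<close>

definition bump_profile :: "real \<Rightarrow> real \<Rightarrow> real \<Rightarrow> real poly \<Rightarrow> nat \<Rightarrow> real \<Rightarrow> real" where
  "bump_profile a b c p m t =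
     (if a < t \<and> t < b
      then poly p t / ((t - a) * (b - t)) ^ m * exp (- c / ((t - a) * (b - t))) else 0)"

lemma has_real_derivative_0_quadratic:
  fixes f :: "real \<Rightarrow> real"
  assumes "\<And>y. \<bar>f y\<bar> \<le> K * (y - x)\<^sup>2"
  shows "(f has_real_derivative 0) (at x)"
proof -
  have fx: "f x = 0" using assms[of x] by simp
  have "((\<lambda>y. (f y - f x) / (y - x)) \<longlongrightarrow> 0) (at x)"
  proof (rule Lim_null_comparison)
    show "\<forall>\<^sub>F y in at x. norm ((f y - f x) / (y - x)) \<le> K * \<bar>y - x\<bar>"
    proof (rule always_eventually, rule allI)
      fix y
      show "norm ((f y - f x) / (y - x)) \<le> K * \<bar>y - x\<bar>"
      proof (cases "y = x")
        case False
        then show ?thesis using assms[of y] fx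
          by (simp add: divide_le_eq power2_eq_square mult.assoc abs_mult_self_eq)
      qed simp
    qed
    have "((\<lambda>y. K * \<bar>y - x\<bar>) \<longlongrightarrow> K * \<bar>x - x\<bar>) (at x)"
      by (intro tendsto_intros)
    then show "((\<lambda>y. K * \<bar>y - x\<bar>) \<longlongrightarrow> 0) (at x)" by simp
  qed
  then show ?thesis by (simp add: has_field_derivative_iff)
qed

text \<open>The exponential absorbs the negative power with two powers of \<open>(t - a) (b - t)\<close> to spare. This gives
  derivative 0 at the end points.\<close>

lemma bump_profile_le_quadratic:
  assumes "c > 0"
  obtains K where "\<And>t. \<bar>bump_profile a b c p m t\<bar> \<le> K * (t - a)\<^sup>2"
    and "\<And>t. \<bar>bump_profile a b c p m t\<bar> \<le> K * (t - b)\<^sup>2"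
proof -
  have "bounded (poly p ` {a..b})"
    by (intro compact_imp_bounded compact_continuous_image continuous_intros) auto
  then obtain B where B: "\<And>t. t \<in> {a..b} \<Longrightarrow> \<bar>poly p t\<bar> \<le> B" "B > 0"
    by (metis bounded_pos image_eqI real_norm_def)
  define F where "F = B * (fact (m + 2) / c ^ (m + 2))"
  have F: "F \<ge> 0" unfolding F_def using B assms by simp
  have main: "\<bar>bump_profile a b c p m t\<bar> \<le> F * ((t - a) * (b - t))\<^sup>2" if t: "a < t" "t < b" for t
  proof -
    let ?W = "(t - a) * (b - t)"
    have W: "?W > 0" using t by simp
    have "\<bar>bump_profile a b c p m t\<bar> = \<bar>poly p t\<bar> / ?W ^ m * exp (- c / ?W)"
      using t W by (simp add: bump_profile_def abs_mult)
    also have "\<dots> \<le> B / ?W ^ m * (fact (m + 2) / c ^ (m + 2) * ?W ^ (m + 2))"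
      using t W B(2) by (intro mult_mono divide_right_mono B power_times_exp_neg_le assms) auto
    also have "\<dots> = F * ?W\<^sup>2"
    proof -
      have "B / V ^ m * (K * V ^ (m + 2)) = B * K * V\<^sup>2" if "V > 0" for V K :: real
        using that by (simp add: power_add power2_eq_square field_simps)
      from this[OF W] show ?thesis unfolding F_def .
    qed
    finally show ?thesis .
  qed
  show ?thesis
  proof (rule that[of "F * (b - a)\<^sup>2"])
    fix t
    show "\<bar>bump_profile a b c p m t\<bar> \<le> F * (b - a)\<^sup>2 * (t - a)\<^sup>2"
    proof (cases "a < t \<and> t < b")
      case True
      have "(b - t)\<^sup>2 \<le> (b - a)\<^sup>2" using True by (intro power_mono) auto
      then have "F * ((t - a)\<^sup>2 * (b - t)\<^sup>2) \<le> F * ((t - a)\<^sup>2 * (b - a)\<^sup>2)"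
        by (intro mult_left_mono F) auto
      then show ?thesis using main[of t] True by (simp add: power_mult_distrib mult_ac)
    qed (use F in \<open>auto simp: bump_profile_def\<close>)
    show "\<bar>bump_profile a b c p m t\<bar> \<le> F * (b - a)\<^sup>2 * (t - b)\<^sup>2"
    proof (cases "a < t \<and> t < b")
      case True
      have "(t - a)\<^sup>2 \<le> (b - a)\<^sup>2" using True by (intro power_mono) auto
      then have "F * ((t - a)\<^sup>2 * (b - t)\<^sup>2) \<le> F * ((b - a)\<^sup>2 * (t - b)\<^sup>2)"
        using F by (simp add: mult_left_mono mult_right_mono power2_commute[of b t])
      then show ?thesis using main[of t] True by (simp add: power_mult_distrib mult_ac)
    qed (use F in \<open>auto simp: bump_profile_def\<close>)
  qed
qed

lemma DERIV_bump_profile: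
  assumes "c > 0"
  shows "\<exists>q. \<forall>t. (bump_profile a b c p m has_real_derivative bump_profile a b c q (m + 2) t) (at t)"
proof -
  define W where "W = [:- a, 1:] * [:b, - 1:]"
  define q where "q = pderiv p * W\<^sup>2 - smult (of_nat m) (p * pderiv W * W) + smult c (p * pderiv W)"
  have Wt: "poly W t = (t - a) * (b - t)" for t by (simp add: W_def algebra_simps)
  have "(bump_profile a b c p m has_real_derivative bump_profile a b c q (m + 2) t) (at t)" for t
  proof -
    obtain K where K: "\<And>t. \<bar>bump_profile a b c p m t\<bar> \<le> K * (t - a)\<^sup>2"
        "\<And>t. \<bar>bump_profile a b c p m t\<bar> \<le> K * (t - b)\<^sup>2"
      using bump_profile_le_quadratic[OF assms] by metis
    consider "a < t \<and> t < b" | "t = a" | "t = b" | "t < a \<or> t > b" by linarith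
    then show ?thesis
    proof cases
      case 1
      have nz: "poly W t \<noteq> 0" using 1 by (simp add: Wt)
      have "((\<lambda>s. poly p s / poly W s ^ m * exp (- c / poly W s)) has_real_derivative
          (poly (pderiv p) t / poly W t ^ m - of_nat m * poly p t * poly (pderiv W) t / poly W t ^ (m + 1)
            + c * poly p t * poly (pderiv W) t / poly W t ^ (m + 2)) * exp (- c / poly W t)) (at t)"
      proof (cases m)
        case 0
        then show ?thesis using nz
          by (auto intro!: derivative_eq_intros poly_DERIV simp: divide_simps power2_eq_square)
             (simp_all add: algebra_simps)
      next
        case (Suc k)
        then show ?thesis using nz
          apply (auto intro!: derivative_eq_intros poly_DERIV)
          apply (cases k; simp add: field_simps power2_eq_square)
          done
      qed
      moreover have "(poly (pderiv p) t / poly W t ^ m - of_nat m * poly p t * poly (pderiv W) t / poly W t ^ (m + 1)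
            + c * poly p t * poly (pderiv W) t / poly W t ^ (m + 2)) * exp (- c / poly W t)
          = bump_profile a b c q (m + 2) t"
      proof -
        have "bump_profile a b c q (m + 2) t = poly q t / poly W t ^ (m + 2) * exp (- c / poly W t)"
          using 1 unfolding bump_profile_def Wt by simp
        moreover have "poly q t / poly W t ^ (m + 2) = poly (pderiv p) t / poly W t ^ m
            - of_nat m * poly p t * poly (pderiv W) t / poly W t ^ (m + 1)
            + c * poly p t * poly (pderiv W) t / poly W t ^ (m + 2)"
          using nz by (simp add: q_def power2_eq_square field_simps)
        ultimately show ?thesis by (simp only:)
      qed
      ultimately have "((\<lambda>s. poly p s / poly W s ^ m * exp (- c / poly W s)) has_real_derivative
          bump_profile a b c q (m + 2) t) (at t)" by simp
      then show ?thesis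
        by (rule has_field_derivative_transform_within_open[where S = "{a<..<b}"])
           (use 1 in \<open>auto simp: bump_profile_def Wt\<close>)
    next
      case 2
      then show ?thesis using has_real_derivative_0_quadratic[of "bump_profile a b c p m", OF K(1)] by (simp add: bump_profile_def[of _ _ _ q])
    next
      case 3
      then show ?thesis using has_real_derivative_0_quadratic[of "bump_profile a b c p m", OF K(2)] by (simp add: bump_profile_def[of _ _ _ q])
    next
      case 4
      have "((\<lambda>_. 0) has_real_derivative 0) (at t)" by simp
      then have "(bump_profile a b c p m has_real_derivative 0) (at t)"
        by (rule has_field_derivative_transform_within_open[where S = "- {a..b}"])
           (use 4 in \<open>auto simp: bump_profile_def\<close>)
      then show ?thesis using 4 by (auto simp: bump_profile_def)
    qed
  qed
  then show ?thesis by blast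
qed

text \<open>Only the \<open>i\<close>-th factor depends on the \<open>i\<close>-th coordinate. Products of one-variable functions from a
  family closed under differentiation are thus themselves closed under partial derivatives, and no
  sums arise.\<close>

lemma partial_deriv_prod:
  fixes F F' :: "'n::finite \<Rightarrow> real \<Rightarrow> real"
  assumes "\<And>j t. (F j has_real_derivative F' j t) (at t)"
  shows "(\<lambda>x. \<Prod>j\<in>UNIV. F j (x $ j)) differentiable_on UNIV"
    and "partial_deriv i (\<lambda>x. \<Prod>j\<in>UNIV. F j (x $ j)) = (\<lambda>x. \<Prod>j\<in>UNIV. (F(i := F' i)) j (x $ j))"
proof -
  have D: "((\<lambda>x. \<Prod>j\<in>UNIV. F j (x $ j)) has_derivative
      (\<lambda>y. \<Sum>k\<in>UNIV. (y $ k * F' k (x $ k)) * (\<Prod>j\<in>UNIV - {k}. F j (x $ j)))) (at x)" for x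
  proof (rule has_derivative_prod)
    fix j :: 'n
    have "(F j \<circ> (\<lambda>x. x $ j) has_derivative (*) (F' j (x $ j)) \<circ> (\<lambda>y. y $ j)) (at x)"
      by (rule diff_chain_at)
         (use assms[of j] in \<open>auto intro!: bounded_linear_imp_has_derivative bounded_linear_vec_nth
            simp: has_field_derivative_def\<close>)
    then show "((\<lambda>x. F j (x $ j)) has_derivative (\<lambda>y. y $ j * F' j (x $ j))) (at x)"
      by (simp add: o_def mult.commute)
  qed
  then show "(\<lambda>x. \<Prod>j\<in>UNIV. F j (x $ j)) differentiable_on UNIV"
    by (auto simp: differentiable_on_def differentiable_def)
  have "partial_deriv i (\<lambda>x. \<Prod>j\<in>UNIV. F j (x $ j)) x = (\<Prod>j\<in>UNIV. (F(i := F' i)) j (x $ j))" for x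
  proof -
    have "partial_deriv i (\<lambda>x. \<Prod>j\<in>UNIV. F j (x $ j)) x =
        (\<Sum>k\<in>UNIV. (axis i 1 $ k * F' k (x $ k)) * (\<Prod>j\<in>UNIV - {k}. F j (x $ j)))"
      unfolding partial_deriv_def frechet_derivative_at[OF D[of x], symmetric] ..
    also have "\<dots> = (\<Sum>k\<in>UNIV. if k = i then F' i (x $ i) * (\<Prod>j\<in>UNIV - {i}. F j (x $ j)) else 0)"
      by (rule sum.cong) (auto simp: axis_def)
    also have "\<dots> = F' i (x $ i) * (\<Prod>j\<in>UNIV - {i}. F j (x $ j))" by simp
    also have "\<dots> = (\<Prod>j\<in>UNIV. (F(i := F' i)) j (x $ j))"
      by (subst (2) prod.remove[of _ i]) (auto intro!: prod.cong)
    finally show ?thesis .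
  qed
  then show "partial_deriv i (\<lambda>x. \<Prod>j\<in>UNIV. F j (x $ j)) = (\<lambda>x. \<Prod>j\<in>UNIV. (F(i := F' i)) j (x $ j))"
    by blast
qed

lemma C_k_prod_bump_profile:
  fixes a b :: "real ^ 'n"
  assumes "c > 0"
  shows "C_k k (\<lambda>x. \<Prod>j\<in>UNIV. bump_profile (a $ j) (b $ j) c (p j) (m j) (x $ j))"
proof (induction k arbitrary: p m)
  case 0
  have "continuous_on UNIV (bump_profile (a $ j) (b $ j) c (p j) (m j))" for j
    by (metis DERIV_bump_profile DERIV_isCont assms continuous_at_imp_continuous_on)
  then have "continuous_on UNIV (\<lambda>x. bump_profile (a $ j) (b $ j) c (p j) (m j) (x $ j))" for j
    by (rule continuous_on_compose2) (auto intro!: continuous_intros)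
  then show ?case by (auto intro!: continuous_intros)
next
  case (Suc k)
  have "\<forall>j. \<exists>q. \<forall>t. (bump_profile (a $ j) (b $ j) c (p j) (m j) has_real_derivative
      bump_profile (a $ j) (b $ j) c q (m j + 2) t) (at t)"
    by (intro allI DERIV_bump_profile assms)
  then obtain q where q: "\<And>j t. (bump_profile (a $ j) (b $ j) c (p j) (m j) has_real_derivative
      bump_profile (a $ j) (b $ j) c (q j) (m j + 2) t) (at t)"
    by metis
  note P = partial_deriv_prod[of "\<lambda>j. bump_profile (a $ j) (b $ j) c (p j) (m j)", OF q]
  have "(\<lambda>x. \<Prod>j\<in>UNIV. ((\<lambda>j. bump_profile (a $ j) (b $ j) c (p j) (m j))
            (i := bump_profile (a $ i) (b $ i) c (q i) (m i + 2))) j (x $ j))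
      = (\<lambda>x. \<Prod>j\<in>UNIV. bump_profile (a $ j) (b $ j) c ((p(i := q i)) j) ((m(i := m i + 2)) j) (x $ j))" for i
    by (intro ext prod.cong) auto
  then show ?case using P Suc.IH by simp
qed

lemma test_function_prod_bump_profile:
  fixes a b :: "real ^ 'n"
  assumes "c > 0"
  shows "test_function (\<lambda>x. \<Prod>j\<in>UNIV. bump_profile (a $ j) (b $ j) c (p j) (m j) (x $ j))"
proof -
  let ?f = "\<lambda>x. \<Prod>j\<in>UNIV. bump_profile (a $ j) (b $ j) c (p j) (m j) (x $ j)"
  have "{x. ?f x \<noteq> 0} \<subseteq> cbox a b"
  proof safe
    fix x assume "?f x \<noteq> 0"
    then have "bump_profile (a $ j) (b $ j) c (p j) (m j) (x $ j) \<noteq> 0" for j by simp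
    then have "a $ j < x $ j \<and> x $ j < b $ j" for j
      unfolding bump_profile_def by metis
    then show "x \<in> cbox a b" by (auto simp: mem_box_cart less_imp_le)
  qed
  then have "compact (closure {x. ?f x \<noteq> 0})"
    by (meson bounded_cbox bounded_subset compact_closure)
  then show ?thesis using C_k_prod_bump_profile[OF assms, of _ a b p m] unfolding test_function_def by blast
qed

text \<open>The bumps on a box increase to its indicator as \<open>c\<close> tends to 0. By dominated convergence \<open>w\<close> has
  integral 0 over every box, hence vanishes wherever its averages over shrinking cubes converge to it.\<close>

lemma fundamental_lemma_variations:
  fixes w :: "real ^ 'n \<Rightarrow> 'b::euclidean_space"
  assumes w: "locally_integrable w"
    and orth: "\<And>\<phi>. test_function \<phi> \<Longrightarrow> (LINT x|lebesgue. \<phi> x *\<^sub>R w x) = 0"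
  shows "AE x in lebesgue. w x = 0"
proof -
  have abs: "w absolutely_integrable_on cbox a b" for a b
    using w by (simp add: locally_integrable_def)
  have zero: "integral (cbox a b) w = 0" for a b
  proof -
    define \<phi> where "\<phi> k x = (\<Prod>j\<in>UNIV. bump_profile (a $ j) (b $ j) (1 / Suc k) [:1:] 0 (x $ j))"
      for k :: nat and x :: "real ^ 'n"
    have test: "test_function (\<phi> k)" for k
      unfolding \<phi>_def by (rule test_function_prod_bump_profile) simp
    have cont: "continuous_on UNIV (\<phi> k)" for k
      using test[of k] unfolding test_function_def by (metis C_k.simps(1))
    have meas: "\<phi> k \<in> borel_measurable borel" for k
      using cont by (rule borel_measurable_continuous_onI)
    have int: "integrable lebesgue (\<lambda>x. indicator (cbox a b) x *\<^sub>R w x)"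
      using abs unfolding set_integrable_def .
    have bnd: "norm (\<phi> k x *\<^sub>R w x) \<le> norm (indicator (cbox a b) x *\<^sub>R w x)" for k x
    proof (cases "x \<in> cbox a b")
      case True
      have "\<bar>\<phi> k x\<bar> \<le> 1" unfolding \<phi>_def abs_prod
        by (rule prod_le_1) (auto simp: bump_profile_def)
      then show ?thesis using True by (simp add: mult_left_le_one_le)
    next
      case False
      then obtain j where "\<not> (a $ j < x $ j \<and> x $ j < b $ j)"
        by (auto simp: mem_box_cart) (meson less_imp_le)+
      then have "\<phi> k x = 0" unfolding \<phi>_def
        by (intro prod_zero) (auto simp: bump_profile_def)
      then show ?thesis by simp
    qed
    have lim: "(\<lambda>k. \<phi> k x *\<^sub>R w x) \<longlonglongrightarrow> indicator (box a b) x *\<^sub>R w x" for x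
    proof (cases "x \<in> box a b")
      case True
      have "(\<lambda>k. \<phi> k x) \<longlonglongrightarrow> (\<Prod>j\<in>(UNIV::'n set). exp (- 0 * (1 / ((x $ j - a $ j) * (b $ j - x $ j)))))"
        unfolding \<phi>_def
      proof (rule tendsto_prod)
        fix j :: 'n
        have j: "a $ j < x $ j \<and> x $ j < b $ j" using True by (simp add: mem_box_cart)
        have "(\<lambda>k. exp (- (1 / real (Suc k)) * (1 / ((x $ j - a $ j) * (b $ j - x $ j))))) \<longlonglongrightarrow>
            exp (- 0 * (1 / ((x $ j - a $ j) * (b $ j - x $ j))))"
          by (intro tendsto_intros LIMSEQ_Suc[OF lim_1_over_n])
        then show "(\<lambda>k. bump_profile (a $ j) (b $ j) (1 / real (Suc k)) [:1:] 0 (x $ j)) \<longlonglongrightarrow>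
            exp (- 0 * (1 / ((x $ j - a $ j) * (b $ j - x $ j))))"
          using j by (simp add: bump_profile_def)
      qed
      then show ?thesis using True by (auto intro!: tendsto_eq_intros)
    next
      case False
      then obtain j where "\<not> (a $ j < x $ j \<and> x $ j < b $ j)"
        by (auto simp: mem_box_cart)
      then have "\<phi> k x = 0" for k unfolding \<phi>_def
        by (intro prod_zero) (auto simp: bump_profile_def)
      then show ?thesis using False by simp
    qed
    have wm: "(\<lambda>x. indicator (cbox a b) x *\<^sub>R w x) \<in> borel_measurable lebesgue"
      using int by simp
    have eq1: "\<phi> k x *\<^sub>R w x = \<phi> k x *\<^sub>R (indicator (cbox a b) x *\<^sub>R w x)" for k x
      using bnd[of k x] by (cases "x \<in> cbox a b") (auto simp: indicator_def mult_le_0_iff)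
    have eq2: "indicator (box a b) x *\<^sub>R w x = indicator (box a b) x *\<^sub>R (indicator (cbox a b) x *\<^sub>R w x)" for x
      using box_subset_cbox[of a b] by (auto simp: indicator_def)
    have "(\<lambda>k. LINT x|lebesgue. \<phi> k x *\<^sub>R w x) \<longlonglongrightarrow> (LINT x|lebesgue. indicator (box a b) x *\<^sub>R w x)"
    proof (rule integral_dominated_convergence)
      show "(\<lambda>x. indicator (box a b) x *\<^sub>R w x) \<in> borel_measurable lebesgue"
        unfolding eq2 by (intro borel_measurable_scaleR wm borel_measurable_indicator) auto
      show "(\<lambda>x. \<phi> k x *\<^sub>R w x) \<in> borel_measurable lebesgue" for k
        unfolding eq1 using meas[of k]
        by (intro borel_measurable_scaleR wm) (simp add: measurable_completion)
      show "integrable lebesgue (\<lambda>x. norm (indicator (cbox a b) x *\<^sub>R w x))"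
        using int by (rule integrable_norm)
      show "AE x in lebesgue. (\<lambda>k. \<phi> k x *\<^sub>R w x) \<longlonglongrightarrow> indicator (box a b) x *\<^sub>R w x"
        using lim by simp
      show "AE x in lebesgue. norm (\<phi> k x *\<^sub>R w x) \<le> norm (indicator (cbox a b) x *\<^sub>R w x)" for k
        using bnd by simp
    qed
    then have "(LINT x|lebesgue. indicator (box a b) x *\<^sub>R w x) = 0"
      using orth[OF test] by (simp add: LIMSEQ_const_iff)
    moreover have "(LINT x:box a b|lebesgue. w x) = integral (box a b) w"
    proof (rule set_lebesgue_integral_eq_integral)
      show "w absolutely_integrable_on box a b"
        using abs[of a b] by (rule set_integrable_subset) (auto simp: box_subset_cbox)
    qed
    ultimately have "integral (box a b) w = 0" by (simp add: set_lebesgue_integral_def)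
    then show ?thesis by (simp add: integral_open_interval)
  qed
  have "w integrable_on cbox a b" for a b
    using abs[of a b] by (rule set_lebesgue_integral_eq_integral)
  then obtain N where N: "negligible N"
      "\<And>x e. \<lbrakk>x \<notin> N; 0 < e\<rbrakk> \<Longrightarrow> \<exists>d>0. \<forall>h. 0 < h \<and> h < d \<longrightarrow>
          norm (integral (cbox x (x + h *\<^sub>R One)) w /\<^sub>R h ^ DIM(real ^ 'n) - w x) < e"
    using integrable_ccontinuous_explicit[of w] by metis
  have "w x = 0" if xN: "x \<notin> N" for x
  proof (rule ccontr)
    assume "w x \<noteq> 0"
    then obtain d where d: "d > 0" "\<forall>h. 0 < h \<and> h < d \<longrightarrow>
          norm (integral (cbox x (x + h *\<^sub>R One)) w /\<^sub>R h ^ DIM(real ^ 'n) - w x) < norm (w x)"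
      using N(2)[OF xN, of "norm (w x)"] by auto
    from d(2)[rule_format, of "d / 2"] d(1) zero show False by simp
  qed
  then show ?thesis
    using N(1) unfolding negligible_iff_null_sets by (intro AE_I'[of N]) auto
qed

section \<open>Pairing real directions with complex vectors\<close>

text \<open>The pairing is bilinear, without complex conjugation: for a complex gradient \<open>m\<close> it is the derivative
  in the direction \<open>v\<close>.\<close>

definition real_dot :: "real ^ 'n \<Rightarrow> complex ^ 'n \<Rightarrow> complex" where
  "real_dot v m = (\<Sum>j\<in>UNIV. v $ j *\<^sub>R m $ j)"

definition Re_vec :: "complex ^ 'n \<Rightarrow> real ^ 'n" where "Re_vec m = (\<chi> j. Re (m $ j))"
definition Im_vec :: "complex ^ 'n \<Rightarrow> real ^ 'n" where "Im_vec m = (\<chi> j. Im (m $ j))"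

lemma cmod_real_dot_sq: "(cmod (real_dot v m))\<^sup>2 = (v \<bullet> Re_vec m)\<^sup>2 + (v \<bullet> Im_vec m)\<^sup>2"
  by (simp add: cmod_def real_dot_def Re_vec_def Im_vec_def inner_vec_def sum_nonneg add_nonneg_nonneg)

lemma norm_complex_vec_sq: "(norm m)\<^sup>2 = (norm (Re_vec m))\<^sup>2 + (norm (Im_vec m))\<^sup>2"
  by (simp add: power2_norm_eq_inner inner_vec_def Re_vec_def Im_vec_def inner_complex_def sum.distrib)

lemma cmod_real_dot_le: "cmod (real_dot v m) \<le> norm v * norm m"
proof (rule power2_le_imp_le)
  have "(v \<bullet> w)\<^sup>2 \<le> (norm v)\<^sup>2 * (norm w)\<^sup>2" for w
    using Cauchy_Schwarz_ineq[of v w] by (simp add: power2_norm_eq_inner)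
  then show "(cmod (real_dot v m))\<^sup>2 \<le> (norm v * norm m)\<^sup>2"
    unfolding cmod_real_dot_sq power_mult_distrib norm_complex_vec_sq[of m]
    by (simp add: distrib_left add_mono)
qed simp

lemma real_dot_diff: "real_dot v (m - m') = real_dot v m - real_dot v m'"
  by (simp add: real_dot_def scaleR_diff_right sum_subtractf)

lemma real_dot_scaleR: "real_dot (c *\<^sub>R v) m = c *\<^sub>R real_dot v m"
  by (simp add: real_dot_def scaleR_sum_right)

lemma real_dot_measurable[measurable]:
  assumes [measurable]: "f \<in> borel_measurable M" "g \<in> borel_measurable M"
  shows "(\<lambda>x. real_dot (f x) (g x)) \<in> borel_measurable M"
proof -
  have c: "continuous_on UNIV (\<lambda>p::(real ^ 'n) \<times> (complex ^ 'n). real_dot (fst p) (snd p))"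
    unfolding real_dot_def by (intro continuous_intros)
  show ?thesis by (rule borel_measurable_continuous_Pair[OF assms c])
qed

section \<open>Test functions\<close>

lemma partial_deriv_translate:
  fixes \<phi> :: "real ^ 'n \<Rightarrow> real"
  assumes "\<phi> differentiable_on UNIV"
  shows "(\<lambda>x. \<phi> (x - c)) differentiable_on UNIV"
    and "partial_deriv j (\<lambda>x. \<phi> (x - c)) = (\<lambda>x. partial_deriv j \<phi> (x - c))"
proof -
  have d: "((\<lambda>x. \<phi> (x - c)) has_derivative frechet_derivative \<phi> (at (x - c))) (at x)" for x
  proof -
    have "(\<phi> has_derivative frechet_derivative \<phi> (at (x - c))) (at (x - c))"
      using assms by (simp add: differentiable_on_def frechet_derivative_works)
    then have "(\<phi> \<circ> (\<lambda>x. x - c) has_derivative frechet_derivative \<phi> (at (x - c)) \<circ> (\<lambda>h. h)) (at x)"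
      by (intro diff_chain_at) (auto intro!: derivative_eq_intros)
    then show ?thesis by (simp add: o_def)
  qed
  then show "(\<lambda>x. \<phi> (x - c)) differentiable_on UNIV"
    by (auto simp: differentiable_on_def differentiable_def)
  show "partial_deriv j (\<lambda>x. \<phi> (x - c)) = (\<lambda>x. partial_deriv j \<phi> (x - c))"
    unfolding partial_deriv_def using frechet_derivative_at[OF d] by metis
qed

lemma C_k_translate: "C_k k \<phi> \<Longrightarrow> C_k k (\<lambda>x. \<phi> (x - c))"
proof (induction k arbitrary: \<phi>)
  case 0
  then show ?case
    by (auto intro!: continuous_on_compose2[of UNIV \<phi>] continuous_intros)
next
  case (Suc k)
  then show ?case by (auto simp: partial_deriv_translate)
qed

text \<open>The complement of a closed ball is open, so a function that vanishes there has vanishing partial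
  derivatives there.\<close>

lemma test_function_vanishes:
  assumes "test_function \<phi>"
  obtains R where "\<And>x. norm x > R \<Longrightarrow> \<phi> x = 0" "\<And>j x. norm x > R \<Longrightarrow> partial_deriv j \<phi> x = 0"
proof -
  have "bounded {x. \<phi> x \<noteq> 0}"
    using assms unfolding test_function_def by (meson bounded_closure_image bounded_subset closure_subset compact_imp_bounded)
  then obtain R where R: "\<And>x. \<phi> x \<noteq> 0 \<Longrightarrow> norm x \<le> R" by (auto simp: bounded_iff)
  have "partial_deriv j \<phi> x = 0" if "norm x > R" for j x
  proof -
    have "((\<lambda>_. 0) has_derivative (\<lambda>_. 0)) (at x)" by simp
    then have "(\<phi> has_derivative (\<lambda>_. 0)) (at x)"
    proof (rule has_derivative_transform_within_open[where s = "- cball 0 R"])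
      show "0 = \<phi> y" if "y \<in> - cball 0 R" for y
        using R[of y] that by auto
    qed (use that in auto)
    then have "frechet_derivative \<phi> (at x) = (\<lambda>_. 0)" by (rule frechet_derivative_at[symmetric])
    then show ?thesis by (simp add: partial_deriv_def)
  qed
  then show ?thesis using R that by (meson not_less)
qed

lemma test_function_translate:
  assumes "test_function \<phi>"
  shows "test_function (\<lambda>x. \<phi> (x - c))"
proof -
  obtain R where R: "\<And>x. norm x > R \<Longrightarrow> \<phi> x = 0" using test_function_vanishes[OF assms] by metis
  have "{x. \<phi> (x - c) \<noteq> 0} \<subseteq> cball c R"
    using R by (auto simp: dist_norm norm_minus_commute not_less[symmetric])
  then have "compact (closure {x. \<phi> (x - c) \<noteq> 0})"
    by (meson bounded_cball bounded_subset compact_closure)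
  then show ?thesis using assms C_k_translate unfolding test_function_def by blast
qed

lemma test_function_continuous:
  assumes "test_function \<phi>"
  shows "continuous_on UNIV \<phi>" "continuous_on UNIV (partial_deriv j \<phi>)"
proof -
  have "C_k 0 \<phi>" "C_k (Suc 0) \<phi>" using assms unfolding test_function_def by blast+
  then show "continuous_on UNIV \<phi>" "continuous_on UNIV (partial_deriv j \<phi>)" by auto
qed

lemma test_function_has_derivative:
  assumes "test_function \<phi>"
  shows "(\<phi> has_derivative (\<lambda>v. \<Sum>j\<in>UNIV. v $ j * partial_deriv j \<phi> x)) (at x)"
proof -
  have "C_k (Suc 0) \<phi>" using assms unfolding test_function_def by blast
  then have d: "(\<phi> has_derivative frechet_derivative \<phi> (at x)) (at x)"
    by (simp add: differentiable_on_def frechet_derivative_works)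
  have lin: "linear (frechet_derivative \<phi> (at x))"
    using d by (rule has_derivative_linear)
  have "frechet_derivative \<phi> (at x) v = (\<Sum>j\<in>UNIV. v $ j * partial_deriv j \<phi> x)" for v
  proof -
    have "frechet_derivative \<phi> (at x) v = frechet_derivative \<phi> (at x) (\<Sum>j\<in>UNIV. v $ j *\<^sub>R axis j 1)"
      by (simp add: basis_expansion scalar_mult_eq_scaleR[symmetric])
    also have "\<dots> = (\<Sum>j\<in>UNIV. v $ j * partial_deriv j \<phi> x)"
      by (simp add: linear_sum[OF lin] linear_scale[OF lin] partial_deriv_def)
    finally show ?thesis .
  qed
  then show ?thesis using d by presburger
qed

lemma bounded_vanishing:
  fixes f :: "'a::euclidean_space \<Rightarrow> real"
  assumes "continuous_on UNIV f" "\<And>x. norm x > R \<Longrightarrow> f x = 0"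
  obtains B where "B > 0" "\<And>x. \<bar>f x\<bar> \<le> B"
proof -
  have "bounded (f ` cball 0 R)"
    by (intro compact_imp_bounded compact_continuous_image continuous_on_subset[OF assms(1)]) auto
  then obtain B where B: "B > 0" "\<And>x. x \<in> cball 0 R \<Longrightarrow> \<bar>f x\<bar> \<le> B"
    by (metis bounded_pos image_eqI real_norm_def)
  have "\<bar>f x\<bar> \<le> B" for x
    using B assms(2)[of x] by (cases "norm x > R") auto
  then show ?thesis using that B by blast
qed

section \<open>Integrals over bundles of segments\<close>

text \<open>This and the next lemma provide the integrability needed to exchange a Bochner integral over \<open>x\<close> with
  one over the parameter \<open>t\<close> of a segment.\<close>

lemma integrable_pair_dominated:
  fixes F :: "'a::euclidean_space \<times> real \<Rightarrow> 'b::{banach, second_countable_topology}"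
  assumes [measurable]: "F \<in> borel_measurable (lborel \<Otimes>\<^sub>M lborel)"
    and h: "integrable lborel h" and F: "\<And>x t. norm (F (x, t)) \<le> indicator {0..1} t * h x"
  shows "integrable (lborel \<Otimes>\<^sub>M lborel) F"
proof (rule integrableI_bounded)
  have [measurable]: "h \<in> borel_measurable lborel" using h by simp
  have h0: "h x \<ge> 0" for x using order_trans[OF norm_ge_zero F[of x 0]] by simp
  have "(\<integral>\<^sup>+p. ennreal (norm (F p)) \<partial>(lborel \<Otimes>\<^sub>M lborel)) = (\<integral>\<^sup>+x. \<integral>\<^sup>+t. ennreal (norm (F (x, t))) \<partial>lborel \<partial>lborel)"
    by (rule lborel.nn_integral_fst[symmetric]) measurable
  also have "\<dots> \<le> (\<integral>\<^sup>+x. \<integral>\<^sup>+t. ennreal (h x) * indicator {0..1::real} t \<partial>lborel \<partial>lborel)"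
  proof -
    have "ennreal (norm (F (x, t))) \<le> ennreal (h x) * indicator {0..1} t" for x t
      using F[of x t] h0[of x] by (auto simp: indicator_def intro!: ennreal_leI split: if_splits)
    then show ?thesis by (intro nn_integral_mono)
  qed
  also have "\<dots> = (\<integral>\<^sup>+x. ennreal (h x) \<partial>lborel)"
    by (intro nn_integral_cong) (simp add: nn_integral_cmult)
  also have "\<dots> < \<infinity>"
    using h h0 by (simp add: integrable_iff_bounded)
  finally show "(\<integral>\<^sup>+p. ennreal (norm (F p)) \<partial>(lborel \<Otimes>\<^sub>M lborel)) < \<infinity>" .
qed measurable

lemma integrable_pair_shifted:
  fixes h :: "'a::euclidean_space \<Rightarrow> 'b::{banach, second_countable_topology}"
  assumes h: "integrable lborel h"
  shows "integrable (lborel \<Otimes>\<^sub>M lborel) (\<lambda>(x, t). indicator {0..1::real} t *\<^sub>R h (x + t *\<^sub>R z))"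
proof (rule integrableI_bounded)
  have [measurable]: "h \<in> borel_measurable borel" using h by simp
  have "(\<integral>\<^sup>+p. ennreal (norm (case p of (x, t) \<Rightarrow> indicator {0..1::real} t *\<^sub>R h (x + t *\<^sub>R z))) \<partial>(lborel \<Otimes>\<^sub>M lborel))
     = (\<integral>\<^sup>+t. \<integral>\<^sup>+x. ennreal (norm (indicator {0..1::real} t *\<^sub>R h (x + t *\<^sub>R z))) \<partial>lborel \<partial>lborel)"
    by (subst lborel_pair.nn_integral_snd[symmetric]) auto
  also have "\<dots> = (\<integral>\<^sup>+t. (\<integral>\<^sup>+x. ennreal (norm (h x)) \<partial>lborel) * indicator {0..1::real} t \<partial>lborel)"
  proof (rule nn_integral_cong)
    fix t :: real
    have "(\<integral>\<^sup>+x. ennreal (norm (h (x + t *\<^sub>R z))) \<partial>lborel) = (\<integral>\<^sup>+x. ennreal (norm (h x)) \<partial>lborel)"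
    proof -
      have "(\<integral>\<^sup>+x. ennreal (norm (h x)) \<partial>lborel) = (\<integral>\<^sup>+x. ennreal (norm (h x)) \<partial>distr lborel borel ((+) (t *\<^sub>R z)))"
        by (simp add: lborel_distr_plus)
      also have "\<dots> = (\<integral>\<^sup>+x. ennreal (norm (h (t *\<^sub>R z + x))) \<partial>lborel)"
        by (rule nn_integral_distr) auto
      finally show ?thesis by (simp add: add.commute)
    qed
    then show "(\<integral>\<^sup>+x. ennreal (norm (indicator {0..1::real} t *\<^sub>R h (x + t *\<^sub>R z))) \<partial>lborel)
        = (\<integral>\<^sup>+x. ennreal (norm (h x)) \<partial>lborel) * indicator {0..1::real} t"
      by (auto simp: indicator_def)
  qed
  also have "\<dots> = (\<integral>\<^sup>+x. ennreal (norm (h x)) \<partial>lborel)"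
    by (simp add: nn_integral_cmult)
  also have "\<dots> < \<infinity>" using h by (simp add: integrable_iff_bounded)
  finally show "(\<integral>\<^sup>+p. ennreal (norm (case p of (x, t) \<Rightarrow> indicator {0..1::real} t *\<^sub>R h (x + t *\<^sub>R z))) \<partial>(lborel \<Otimes>\<^sub>M lborel)) < \<infinity>" .
qed (use h in simp)

lemma integral_lborel_translate:
  fixes f :: "'a::euclidean_space \<Rightarrow> 'b::{banach, second_countable_topology}"
  assumes [measurable]: "f \<in> borel_measurable borel"
  shows "(LINT x|lborel. f (x + c)) = (LINT x|lborel. f x)"
    and "integrable lborel (\<lambda>x. f (x + c)) \<longleftrightarrow> integrable lborel f"
proof -
  have "(LINT x|lborel. f x) = (LINT x|distr lborel borel ((+) c). f x)"
    by (simp add: lborel_distr_plus)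
  also have "\<dots> = (LINT x|lborel. f (c + x))"
    by (rule integral_distr) auto
  finally show "(LINT x|lborel. f (x + c)) = (LINT x|lborel. f x)" by (simp add: add.commute)
  have "integrable (distr lborel borel ((+) c)) f \<longleftrightarrow> integrable lborel (\<lambda>x. f (c + x))"
    by (rule integrable_distr_eq) auto
  then show "integrable lborel (\<lambda>x. f (x + c)) \<longleftrightarrow> integrable lborel f"
    by (simp add: lborel_distr_plus add.commute)
qed

text \<open>For Borel functions it suffices to look at balls and at \<open>lborel\<close>, which unlike its completion is
  compatible with product measures.\<close>

lemma locally_integrable_borel_iff:
  fixes f :: "'a::euclidean_space \<Rightarrow> 'b::euclidean_space"
  assumes [measurable]: "f \<in> borel_measurable borel"
  shows "locally_integrable f \<longleftrightarrow> (\<forall>R. integrable lborel (\<lambda>x. indicator (cball 0 R) x *\<^sub>R f x))"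
proof -
  have m: "(\<lambda>x. indicator (cball 0 R) x *\<^sub>R f x) \<in> borel_measurable lborel" for R
    by (intro borel_measurable_scaleR borel_measurable_indicator) auto
  show ?thesis
  proof
  assume "locally_integrable f"
  then have "integrable lebesgue (\<lambda>x. indicator (cball 0 R) x *\<^sub>R f x)" for R
    by (simp add: locally_integrable_def set_integrable_def)
  then show "\<forall>R. integrable lborel (\<lambda>x. indicator (cball 0 R) x *\<^sub>R f x)"
    using m by (simp add: integrable_completion)
next
  assume R: "\<forall>R. integrable lborel (\<lambda>x. indicator (cball 0 R) x *\<^sub>R f x)"
  show "locally_integrable f"
    unfolding locally_integrable_def
  proof (intro allI impI)
    fix K :: "'a set" assume K: "compact K"
    then have "bounded K" by (rule compact_imp_bounded)
    then obtain R where "\<forall>x\<in>K. norm x \<le> R" by (auto simp: bounded_iff)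
    then have KR: "K \<subseteq> cball 0 R" by auto
    have "set_integrable lebesgue (cball 0 R) f"
      unfolding set_integrable_def using R m by (simp add: integrable_completion)
    then show "f absolutely_integrable_on K"
      by (rule set_integrable_subset) (use K KR in \<open>auto intro: lmeasurable_compact fmeasurableD\<close>)
  qed
qed
qed

lemma vec_nth_measurable[measurable]:
  assumes [measurable]: "f \<in> borel_measurable M"
  shows "(\<lambda>x. f x $ j) \<in> borel_measurable M"
  by (rule borel_measurable_continuous_on[OF _ assms]) (intro continuous_intros)

lemma weak_gradient_directional:
  fixes u :: "real ^ 'n \<Rightarrow> complex" and G :: "real ^ 'n \<Rightarrow> complex ^ 'n"
  assumes wg: "has_weak_gradient u G" and [measurable]: "u \<in> borel_measurable borel" "G \<in> borel_measurable borel"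
    and \<phi>: "test_function \<phi>"
  shows "(LINT x|lborel. (\<Sum>j\<in>UNIV. z $ j * partial_deriv j \<phi> x) *\<^sub>R u x)
    = - (LINT x|lborel. \<phi> x *\<^sub>R real_dot z (G x))"
proof -
  have lu: "\<And>R. integrable lborel (\<lambda>x. indicator (cball 0 R) x *\<^sub>R u x)"
    and lG: "\<And>R. integrable lborel (\<lambda>x. indicator (cball 0 R) x *\<^sub>R G x)"
    using wg by (auto simp: has_weak_gradient_def locally_integrable_borel_iff)
  obtain R where R: "\<And>x. norm x > R \<Longrightarrow> \<phi> x = 0" "\<And>j x. norm x > R \<Longrightarrow> partial_deriv j \<phi> x = 0"
    using test_function_vanishes[OF \<phi>] by metis
  note c = test_function_continuous[OF \<phi>]
  have [measurable]: "\<phi> \<in> borel_measurable borel" "partial_deriv j \<phi> \<in> borel_measurable borel" for j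
    using c by (auto intro: borel_measurable_continuous_onI)
  have int: "integrable lborel (\<lambda>x. f x *\<^sub>R h x)"
    if f: "continuous_on UNIV f" "\<And>x. norm x > R \<Longrightarrow> f x = (0::real)"
      and h: "integrable lborel (\<lambda>x. indicator (cball 0 R) x *\<^sub>R h x)"
    for f and h :: "real ^ 'n \<Rightarrow> complex"
  proof -
    obtain B where B: "B > 0" "\<And>x. \<bar>f x\<bar> \<le> B" using bounded_vanishing[OF f] by metis
    have eq: "f x *\<^sub>R h x = f x *\<^sub>R (indicator (cball 0 R) x *\<^sub>R h x)" for x
      using f(2)[of x] by (cases "norm x > R") (auto simp: indicator_def)
    have [measurable]: "f \<in> borel_measurable borel" using f(1) by (rule borel_measurable_continuous_onI)
    have "integrable lborel (\<lambda>x. B *\<^sub>R (indicator (cball 0 R) x *\<^sub>R h x))" using h by (rule integrable_scaleR_right)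
    then show ?thesis unfolding eq
    proof (rule Bochner_Integration.integrable_bound)
      show "(\<lambda>x. f x *\<^sub>R (indicator (cball 0 R) x *\<^sub>R h x)) \<in> borel_measurable lborel"
        by (rule borel_measurable_scaleR) (simp, rule borel_measurable_integrable[OF h])
      show "AE x in lborel. norm (f x *\<^sub>R (indicator (cball 0 R) x *\<^sub>R h x)) \<le> norm (B *\<^sub>R (indicator (cball 0 R) x *\<^sub>R h x))"
      proof (rule AE_I2)
        fix x
        have "norm (f x) \<le> norm B" using B(2)[of x] B(1) by simp
        then show "norm (f x *\<^sub>R (indicator (cball 0 R) x *\<^sub>R h x)) \<le> norm (B *\<^sub>R (indicator (cball 0 R) x *\<^sub>R h x))"
          unfolding norm_scaleR[of "f x"] norm_scaleR[of B] real_norm_def by (rule mult_right_mono) simp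
      qed
    qed
  qed
  have lGj: "integrable lborel (\<lambda>x. indicator (cball 0 R) x *\<^sub>R (G x $ j))" for j
    using integrable_bounded_linear[OF bounded_linear_vec_nth[of j] lG[of R]] by simp
  have w: "(LINT x|lborel. partial_deriv j \<phi> x *\<^sub>R u x) = - (LINT x|lborel. \<phi> x *\<^sub>R (G x $ j))" for j
  proof -
    have "(LINT x|lebesgue. partial_deriv j \<phi> x *\<^sub>R u x) = - (LINT x|lebesgue. \<phi> x *\<^sub>R (G x $ j))"
      using wg \<phi> by (simp add: has_weak_gradient_def)
    then show ?thesis by (simp add: integral_completion)
  qed
  have sum: "(LINT x|lborel. (\<Sum>j\<in>UNIV. z $ j *\<^sub>R f j x)) = (\<Sum>j\<in>UNIV. z $ j *\<^sub>R (LINT x|lborel. f j x))"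
    if f: "\<And>j. integrable lborel (f j)" for f :: "'n \<Rightarrow> real ^ 'n \<Rightarrow> complex"
  proof -
    have "(LINT x|lborel. (\<Sum>j\<in>UNIV. z $ j *\<^sub>R f j x)) = (\<Sum>j\<in>UNIV. LINT x|lborel. z $ j *\<^sub>R f j x)"
      by (rule Bochner_Integration.integral_sum) (rule integrable_scaleR_right, rule f)
    then show ?thesis by (simp only: Bochner_Integration.integral_scaleR_right)
  qed
  have "(LINT x|lborel. (\<Sum>j\<in>UNIV. z $ j * partial_deriv j \<phi> x) *\<^sub>R u x)
      = (LINT x|lborel. (\<Sum>j\<in>UNIV. z $ j *\<^sub>R (partial_deriv j \<phi> x *\<^sub>R u x)))"
    by (simp add: scaleR_sum_left)
  also have "\<dots> = (\<Sum>j\<in>UNIV. z $ j *\<^sub>R (LINT x|lborel. partial_deriv j \<phi> x *\<^sub>R u x))"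
    by (rule sum) (rule int[OF c(2) R(2) lu])
  also have "\<dots> = - (\<Sum>j\<in>UNIV. z $ j *\<^sub>R (LINT x|lborel. \<phi> x *\<^sub>R (G x $ j)))"
    by (simp add: w sum_negf)
  also have "(\<Sum>j\<in>UNIV. z $ j *\<^sub>R (LINT x|lborel. \<phi> x *\<^sub>R (G x $ j)))
      = (LINT x|lborel. (\<Sum>j\<in>UNIV. z $ j *\<^sub>R (\<phi> x *\<^sub>R (G x $ j))))"
    by (rule sum[symmetric]) (rule int[OF c(1) R(1) lGj])
  also have "\<dots> = (LINT x|lborel. \<phi> x *\<^sub>R real_dot z (G x))"
    by (simp add: real_dot_def scaleR_sum_right mult.commute)
  finally show ?thesis .
qed

section \<open>The line integral of a weak gradient\<close>

text \<open>Both sides are tested against a smooth \<open>\<phi>\<close>. Translating the integrals moves the shift by \<open>t z\<close> from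
  \<open>G\<close> to \<open>\<phi>\<close>, where the definition of the weak gradient applies to the translated test function; what
  remains is the fundamental theorem of calculus for \<open>\<phi>\<close> along the segment. The fundamental lemma
  concludes.\<close>

lemma weak_gradient_line_integral:
  fixes u :: "real ^ 'n \<Rightarrow> complex" and G :: "real ^ 'n \<Rightarrow> complex ^ 'n"
  assumes wg: "has_weak_gradient u G"
    and [measurable]: "u \<in> borel_measurable borel" "G \<in> borel_measurable borel"
    and T: "0 \<le> T" "T \<le> 1"
  shows "AE x in lborel. u (x + T *\<^sub>R z) - u x =
           (LINT t|lborel. indicator {0..T} t *\<^sub>R real_dot z (G (x + t *\<^sub>R z)))"
proof -
  have lu: "\<And>R. integrable lborel (\<lambda>x. indicator (cball 0 R) x *\<^sub>R u x)"
    and lG: "\<And>R. integrable lborel (\<lambda>x. indicator (cball 0 R) x *\<^sub>R G x)"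
    using wg by (auto simp: has_weak_gradient_def locally_integrable_borel_iff)
  have ball_meas[measurable]: "(\<lambda>x. indicator (cball 0 R) x :: real) \<in> borel_measurable borel" for R and x :: "real ^ 'n"
    by (intro borel_measurable_indicator) auto
  have lGz: "integrable lborel (\<lambda>x. indicator (cball 0 R) x *\<^sub>R real_dot z (G x))" for R
  proof -
    have "integrable lborel (\<lambda>x. norm z *\<^sub>R (indicator (cball 0 R) x *\<^sub>R G x))"
      using lG by (intro integrable_scaleR_right) auto
    then show ?thesis
    proof (rule Bochner_Integration.integrable_bound)
      show "AE x in lborel. norm (indicator (cball 0 R) x *\<^sub>R real_dot z (G x))
          \<le> norm (norm z *\<^sub>R (indicator (cball 0 R) x *\<^sub>R G x))"
      proof (rule AE_I2)
        fix x
        show "norm (indicator (cball 0 R) x *\<^sub>R real_dot z (G x))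
          \<le> norm (norm z *\<^sub>R (indicator (cball 0 R) x *\<^sub>R G x))"
          by (cases "x \<in> cball 0 R") (simp_all add: cmod_real_dot_le)
      qed
    qed measurable
  qed
  define I where "I x = (LINT t|lborel. indicator {0..T} t *\<^sub>R real_dot z (G (x + t *\<^sub>R z)))" for x
  define w where "w x = u (x + T *\<^sub>R z) - u x - I x" for x
  have [measurable]: "I \<in> borel_measurable borel" "w \<in> borel_measurable borel"
    unfolding I_def w_def by measurable
  \<comment> \<open>segments that start in the ball of radius \<open>R\<close> stay in the ball of radius \<open>R + norm z\<close>, outside of
    which \<open>G\<close> may be cut off\<close>
  have prod: "integrable (lborel \<Otimes>\<^sub>M lborel) (\<lambda>(x, t). indicator {0..T} t *\<^sub>R (f x *\<^sub>R real_dot z (G (x + t *\<^sub>R z))))"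
    if f[measurable]: "f \<in> borel_measurable borel" and B: "\<And>x. \<bar>f x\<bar> \<le> B" and v: "\<And>x. norm x > R \<Longrightarrow> f x = 0"
    for f :: "real ^ 'n \<Rightarrow> real" and R B
  proof -
    have B0: "B \<ge> 0" using order_trans[OF abs_ge_zero B[of 0]] .
    define h where "h x = indicator (cball 0 (R + norm z)) x *\<^sub>R real_dot z (G x)" for x
    have "integrable (lborel \<Otimes>\<^sub>M lborel) (\<lambda>(x, t). indicator {0..1::real} t *\<^sub>R h (x + t *\<^sub>R z))"
      using lGz unfolding h_def by (rule integrable_pair_shifted)
    then have "integrable (lborel \<Otimes>\<^sub>M lborel) (\<lambda>p. B *\<^sub>R (case p of (x, t) \<Rightarrow> indicator {0..1::real} t *\<^sub>R h (x + t *\<^sub>R z)))"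
      by (rule integrable_scaleR_right)
    then show ?thesis
    proof (rule Bochner_Integration.integrable_bound)
      have "norm (indicator {0..T} t *\<^sub>R (f x *\<^sub>R real_dot z (G (x + t *\<^sub>R z))))
          \<le> norm (B *\<^sub>R (indicator {0..1::real} t *\<^sub>R h (x + t *\<^sub>R z)))" for x t
      proof (cases "t \<in> {0..T} \<and> norm x \<le> R")
        case True
        have "norm (x + t *\<^sub>R z) \<le> norm x + \<bar>t\<bar> * norm z"
          using norm_triangle_ineq[of x "t *\<^sub>R z"] by simp
        also have "\<dots> \<le> R + 1 * norm z"
          using True T by (intro add_mono mult_right_mono) auto
        finally have "h (x + t *\<^sub>R z) = real_dot z (G (x + t *\<^sub>R z))" by (simp add: h_def)
        then show ?thesis using True T B[of x] B0 by (auto intro!: mult_right_mono)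
      next
        case False
        then show ?thesis using v[of x] B0 by (auto simp: indicator_def)
      qed
      then show "AE p in lborel \<Otimes>\<^sub>M lborel. norm (case p of (x, t) \<Rightarrow> indicator {0..T} t *\<^sub>R (f x *\<^sub>R real_dot z (G (x + t *\<^sub>R z))))
          \<le> norm (B *\<^sub>R (case p of (x, t) \<Rightarrow> indicator {0..1::real} t *\<^sub>R h (x + t *\<^sub>R z)))"
        by (auto intro!: AE_I2 simp del: norm_scaleR scaleR_scaleR)
    qed measurable
  qed
  have "locally_integrable w"
  proof (subst locally_integrable_borel_iff, measurable, intro allI)
    fix R
    have 1: "integrable lborel (\<lambda>x. indicator (cball 0 R) x *\<^sub>R u (x + T *\<^sub>R z))"
    proof -
      have "integrable lborel (\<lambda>x. indicator (cball 0 (R + norm z)) (x + T *\<^sub>R z) *\<^sub>R u (x + T *\<^sub>R z))"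
        using lu by (subst integral_lborel_translate(2)) (auto intro!: borel_measurable_scaleR)
      then show ?thesis
      proof (rule Bochner_Integration.integrable_bound)
        show "AE x in lborel. norm (indicator (cball 0 R) x *\<^sub>R u (x + T *\<^sub>R z))
            \<le> norm (indicator (cball 0 (R + norm z)) (x + T *\<^sub>R z) *\<^sub>R u (x + T *\<^sub>R z))"
        proof (rule AE_I2)
          fix x
          have "norm (x + T *\<^sub>R z) \<le> R + norm z" if "norm x \<le> R"
          proof -
            have "norm (x + T *\<^sub>R z) \<le> norm x + \<bar>T\<bar> * norm z"
              using norm_triangle_ineq[of x "T *\<^sub>R z"] by simp
            also have "\<dots> \<le> R + 1 * norm z"
              using that T by (intro add_mono mult_right_mono) auto
            finally show ?thesis by simp
          qed
          then show "norm (indicator (cball 0 R) x *\<^sub>R u (x + T *\<^sub>R z))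
            \<le> norm (indicator (cball 0 (R + norm z)) (x + T *\<^sub>R z) *\<^sub>R u (x + T *\<^sub>R z))"
            by (auto simp: indicator_def)
        qed
      qed measurable
    qed
    have "integrable (lborel \<Otimes>\<^sub>M lborel) (\<lambda>(x, t). indicator {0..T} t *\<^sub>R (indicator (cball 0 R) x *\<^sub>R real_dot z (G (x + t *\<^sub>R z))))"
      by (rule prod[of _ 1 R]) (auto simp: indicator_def)
    then have "integrable lborel (\<lambda>x. LINT t|lborel. indicator {0..T} t *\<^sub>R (indicator (cball 0 R) x *\<^sub>R real_dot z (G (x + t *\<^sub>R z))))"
      using lborel_pair.integrable_fst' by fastforce
    also have "(\<lambda>x. LINT t|lborel. indicator {0..T} t *\<^sub>R (indicator (cball 0 R) x *\<^sub>R real_dot z (G (x + t *\<^sub>R z))))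
        = (\<lambda>x. indicator (cball 0 R) x *\<^sub>R I x)"
      unfolding I_def by (subst scaleR_left_commute) (simp only: Bochner_Integration.integral_scaleR_right)
    finally show "integrable lborel (\<lambda>x. indicator (cball 0 R) x *\<^sub>R w x)"
      using 1 lu[of R] unfolding w_def scaleR_diff_right by (intro Bochner_Integration.integrable_diff)
  qed
  moreover have "(LINT x|lebesgue. \<phi> x *\<^sub>R w x) = 0" if \<phi>: "test_function \<phi>" for \<phi>
  proof -
    obtain R where R: "\<And>x. norm x > R \<Longrightarrow> \<phi> x = 0" "\<And>j x. norm x > R \<Longrightarrow> partial_deriv j \<phi> x = 0"
      using test_function_vanishes[OF \<phi>] by metis
    note c = test_function_continuous[OF \<phi>]
    have [measurable]: "\<phi> \<in> borel_measurable borel" "partial_deriv j \<phi> \<in> borel_measurable borel" for j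
      using c by (auto intro: borel_measurable_continuous_onI)
    define d where "d x = (\<Sum>j\<in>UNIV. z $ j * partial_deriv j \<phi> x)" for x
    have dc: "continuous_on UNIV d" unfolding d_def by (intro continuous_intros c)
    have d0: "d x = 0" if "norm x > R" for x using R(2)[OF that] by (simp add: d_def)
    have [measurable]: "d \<in> borel_measurable borel" using dc by (rule borel_measurable_continuous_onI)
    obtain B1 where B1: "B1 > 0" "\<And>x. \<bar>\<phi> x\<bar> \<le> B1" using bounded_vanishing[OF c(1) R(1)] by metis
    obtain B2 where B2: "B2 > 0" "\<And>x. \<bar>d x\<bar> \<le> B2" using bounded_vanishing[OF dc d0] by metis
    have iu: "integrable lborel (\<lambda>x. f x *\<^sub>R u (x + c))"
      if f[measurable]: "f \<in> borel_measurable borel" and B: "\<And>x. \<bar>f x\<bar> \<le> B" and v: "\<And>x. norm x > R \<Longrightarrow> f x = 0"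
      for f :: "real ^ 'n \<Rightarrow> real" and R B c
    proof -
      have B0: "B \<ge> 0" using order_trans[OF abs_ge_zero B[of 0]] .
      have "integrable lborel (\<lambda>x. B *\<^sub>R (indicator (cball 0 (R + norm c)) (x + c) *\<^sub>R u (x + c)))"
        using lu by (intro integrable_scaleR_right, subst integral_lborel_translate(2)) (auto intro!: borel_measurable_scaleR)
      then show ?thesis
      proof (rule Bochner_Integration.integrable_bound)
        show "AE x in lborel. norm (f x *\<^sub>R u (x + c)) \<le> norm (B *\<^sub>R (indicator (cball 0 (R + norm c)) (x + c) *\<^sub>R u (x + c)))"
        proof (rule AE_I2)
          fix x
          show "norm (f x *\<^sub>R u (x + c)) \<le> norm (B *\<^sub>R (indicator (cball 0 (R + norm c)) (x + c) *\<^sub>R u (x + c)))"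
          proof (cases "norm x \<le> R")
            case True
            then have "norm (x + c) \<le> R + norm c" using norm_triangle_ineq[of x c] by simp
            then show ?thesis using B[of x] B0 by (auto intro!: mult_right_mono)
          qed (use v[of x] in auto)
        qed
      qed measurable
    qed
    have ftc: "(LINT t|lborel. indicator {0..T} t *\<^sub>R d (x - t *\<^sub>R z)) = \<phi> x - \<phi> (x - T *\<^sub>R z)" for x
    proof -
      have "(LINT t|lborel. indicator {0..T} t *\<^sub>R d (x - t *\<^sub>R z)) = - \<phi> (x - T *\<^sub>R z) - (- \<phi> (x - 0 *\<^sub>R z))"
      proof (rule integral_FTC_atLeastAtMost[OF T(1)])
        fix t
        have "((\<lambda>t. \<phi> (x - t *\<^sub>R z)) has_derivative (\<lambda>h. \<Sum>j\<in>UNIV. (- h *\<^sub>R z) $ j * partial_deriv j \<phi> (x - t *\<^sub>R z))) (at t within {0..T})"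
          by (rule has_derivative_compose[of "\<lambda>t. x - t *\<^sub>R z" "\<lambda>h. - h *\<^sub>R z" _ _ \<phi>, OF _ test_function_has_derivative[OF \<phi>]])
             (auto intro!: derivative_eq_intros)
        then have "((\<lambda>t. - \<phi> (x - t *\<^sub>R z)) has_derivative (\<lambda>h. - (\<Sum>j\<in>UNIV. (- h *\<^sub>R z) $ j * partial_deriv j \<phi> (x - t *\<^sub>R z)))) (at t within {0..T})"
          by (rule has_derivative_minus)
        then show "((\<lambda>t. - \<phi> (x - t *\<^sub>R z)) has_vector_derivative d (x - t *\<^sub>R z)) (at t within {0..T})"
          by (simp add: has_vector_derivative_def d_def sum_distrib_left sum_negf mult.assoc)
      next
        show "continuous_on {0..T} (\<lambda>t. d (x - t *\<^sub>R z))"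
          by (intro continuous_on_compose2[OF dc] continuous_intros) auto
      qed
      then show ?thesis by simp
    qed
    have P1: "integrable (lborel \<Otimes>\<^sub>M lborel) (\<lambda>(x, t). indicator {0..T} t *\<^sub>R (\<phi> x *\<^sub>R real_dot z (G (x + t *\<^sub>R z))))"
      by (rule prod[OF _ B1(2) R(1)]) auto
    have P2: "integrable (lborel \<Otimes>\<^sub>M lborel) (\<lambda>(x, t). indicator {0..T} t *\<^sub>R (d (x - t *\<^sub>R z) *\<^sub>R u x))"
    proof (rule integrable_pair_dominated)
      show "integrable lborel (\<lambda>x. norm (B2 *\<^sub>R (indicator (cball 0 (R + norm z)) x *\<^sub>R u x)))"
        using lu by (intro integrable_norm integrable_scaleR_right)
      fix x t
      show "norm (case (x, t) of (x, t) \<Rightarrow> indicator {0..T} t *\<^sub>R (d (x - t *\<^sub>R z) *\<^sub>R u x))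
         \<le> indicator {0..1} t * norm (B2 *\<^sub>R (indicator (cball 0 (R + norm z)) x *\<^sub>R u x))"
      proof (cases "t \<in> {0..T} \<and> norm x \<le> R + norm z")
        case True
        then show ?thesis using T B2 by (auto intro!: mult_right_mono)
      next
        case False
        have "d (x - t *\<^sub>R z) = 0" if "t \<in> {0..T}"
        proof (rule d0)
          have "norm x > R + norm z" using False that by auto
          moreover have "\<bar>t\<bar> * norm z \<le> 1 * norm z" using that T by (intro mult_right_mono) auto
          moreover have "norm x - \<bar>t\<bar> * norm z \<le> norm (x - t *\<^sub>R z)"
            using norm_triangle_ineq2[of x "t *\<^sub>R z"] by simp
          ultimately show "norm (x - t *\<^sub>R z) > R" by simp
        qed
        then show ?thesis using B2 by (auto simp: indicator_def)
      qed
    qed measurable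
    have "(LINT x|lborel. \<phi> x *\<^sub>R I x) = (LINT x|lborel. LINT t|lborel. indicator {0..T} t *\<^sub>R (\<phi> x *\<^sub>R real_dot z (G (x + t *\<^sub>R z))))"
      unfolding I_def by (subst scaleR_left_commute) (simp only: Bochner_Integration.integral_scaleR_right)
    also have "\<dots> = (LINT t|lborel. LINT x|lborel. indicator {0..T} t *\<^sub>R (\<phi> x *\<^sub>R real_dot z (G (x + t *\<^sub>R z))))"
      by (rule lborel_pair.Fubini_integral[symmetric, OF P1])
    also have "\<dots> = (LINT t|lborel. LINT x|lborel. - (indicator {0..T} t *\<^sub>R (d (x - t *\<^sub>R z) *\<^sub>R u x)))"
    proof (rule Bochner_Integration.integral_cong[OF refl])
      fix t :: real
      have "(LINT x|lborel. \<phi> x *\<^sub>R real_dot z (G (x + t *\<^sub>R z)))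
          = (LINT x|lborel. \<phi> ((x + t *\<^sub>R z) - t *\<^sub>R z) *\<^sub>R real_dot z (G (x + t *\<^sub>R z)))" by simp
      also have "\<dots> = (LINT x|lborel. \<phi> (x - t *\<^sub>R z) *\<^sub>R real_dot z (G x))"
        by (rule integral_lborel_translate(1)) measurable
      also have "\<dots> = - (LINT x|lborel. d (x - t *\<^sub>R z) *\<^sub>R u x)"
      proof -
        have "C_k (Suc 0) \<phi>" using \<phi> unfolding test_function_def by blast
        then have "\<phi> differentiable_on UNIV" by simp
        then show ?thesis
          using weak_gradient_directional[OF wg _ _ test_function_translate[OF \<phi>, of "t *\<^sub>R z"], of z]
          by (simp add: partial_deriv_translate d_def)
      qed
      finally show "(LINT x|lborel. indicator {0..T} t *\<^sub>R (\<phi> x *\<^sub>R real_dot z (G (x + t *\<^sub>R z))))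
         = (LINT x|lborel. - (indicator {0..T} t *\<^sub>R (d (x - t *\<^sub>R z) *\<^sub>R u x)))"
        by (simp only: Bochner_Integration.integral_scaleR_right Bochner_Integration.integral_minus scaleR_minus_right)
    qed
    also have "\<dots> = - (LINT t|lborel. LINT x|lborel. indicator {0..T} t *\<^sub>R (d (x - t *\<^sub>R z) *\<^sub>R u x))"
      by (simp only: Bochner_Integration.integral_minus)
    also have "\<dots> = - (LINT x|lborel. LINT t|lborel. indicator {0..T} t *\<^sub>R (d (x - t *\<^sub>R z) *\<^sub>R u x))"
      by (subst lborel_pair.Fubini_integral[OF P2]) rule
    also have "\<dots> = - (LINT x|lborel. (\<phi> x - \<phi> (x - T *\<^sub>R z)) *\<^sub>R u x)"
    proof -
      have "(LINT t|lborel. indicator {0..T} t *\<^sub>R (d (x - t *\<^sub>R z) *\<^sub>R u x)) = (\<phi> x - \<phi> (x - T *\<^sub>R z)) *\<^sub>R u x" for x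
      proof -
        have "integrable lborel (\<lambda>t. indicator {0..T} t *\<^sub>R d (x - t *\<^sub>R z))"
          by (rule borel_integrable_compact[unfolded set_integrable_def, simplified])
             (auto intro!: continuous_on_compose2[OF dc] continuous_intros)
        then show ?thesis
          unfolding scaleR_scaleR ftc[symmetric] real_scaleR_def by (rule Bochner_Integration.integral_scaleR_left)
      qed
      then show ?thesis by simp
    qed
    also have "\<dots> = (LINT x|lborel. \<phi> (x - T *\<^sub>R z) *\<^sub>R u x) - (LINT x|lborel. \<phi> x *\<^sub>R u x)"
    proof -
      have 1: "integrable lborel (\<lambda>x. \<phi> x *\<^sub>R u x)"
        using iu[of \<phi> B1 R 0] B1 R by simp
      have 2: "integrable lborel (\<lambda>x. \<phi> (x - T *\<^sub>R z) *\<^sub>R u x)"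
      proof -
        have "integrable lborel (\<lambda>x. \<phi> ((x + T *\<^sub>R z) - T *\<^sub>R z) *\<^sub>R u (x + T *\<^sub>R z))"
          using iu[of \<phi> B1 R "T *\<^sub>R z"] B1 R by simp
        moreover have m: "(\<lambda>x. \<phi> (x - T *\<^sub>R z) *\<^sub>R u x) \<in> borel_measurable borel" by measurable
        ultimately show ?thesis using integral_lborel_translate(2)[OF m, of "T *\<^sub>R z"] by (simp only:)
      qed
      show ?thesis unfolding scaleR_diff_left using 1 2 by (simp add: Bochner_Integration.integral_diff)
    qed
    also have "(LINT x|lborel. \<phi> (x - T *\<^sub>R z) *\<^sub>R u x) = (LINT x|lborel. \<phi> ((x + T *\<^sub>R z) - T *\<^sub>R z) *\<^sub>R u (x + T *\<^sub>R z))"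
      by (rule integral_lborel_translate(1)[symmetric]) measurable
    finally have main: "(LINT x|lborel. \<phi> x *\<^sub>R I x) = (LINT x|lborel. \<phi> x *\<^sub>R u (x + T *\<^sub>R z)) - (LINT x|lborel. \<phi> x *\<^sub>R u x)"
      by simp
    have iI: "integrable lborel (\<lambda>x. \<phi> x *\<^sub>R I x)"
    proof -
      have "integrable lborel (\<lambda>x. LINT t|lborel. indicator {0..T} t *\<^sub>R (\<phi> x *\<^sub>R real_dot z (G (x + t *\<^sub>R z))))"
        using lborel_pair.integrable_fst'[OF P1] by simp
      then show ?thesis
        unfolding I_def by (subst (asm) scaleR_left_commute) (simp only: Bochner_Integration.integral_scaleR_right)
    qed
    have "(LINT x|lebesgue. \<phi> x *\<^sub>R w x) = (LINT x|lborel. \<phi> x *\<^sub>R w x)"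
      by (rule integral_completion) measurable
    also have "\<dots> = (LINT x|lborel. \<phi> x *\<^sub>R u (x + T *\<^sub>R z)) - (LINT x|lborel. \<phi> x *\<^sub>R u x) - (LINT x|lborel. \<phi> x *\<^sub>R I x)"
      unfolding w_def scaleR_diff_right
      using iI iu[of \<phi> B1 R 0] iu[of \<phi> B1 R "T *\<^sub>R z"] B1 R by (simp add: Bochner_Integration.integral_diff)
    finally show ?thesis using main by simp
  qed
  ultimately have "AE x in lebesgue. w x = 0"
    by (rule fundamental_lemma_variations)
  then show ?thesis
    by (simp add: AE_completion_iff w_def I_def)
qed

section \<open>The segment formula with a frozen phase\<close>

lemma integral_exp_phase:
  fixes \<alpha> s :: real
  assumes "s \<le> 1"
  shows "(LINT t|lborel. indicator {s..1} t *\<^sub>R (\<i> * \<alpha> * exp (- \<i> * t * \<alpha>)))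
     = exp (- \<i> * s * \<alpha>) - exp (- \<i> * \<alpha>)"
proof -
  have "(LINT t|lborel. indicator {s..1} t *\<^sub>R (\<i> * \<alpha> * exp (- \<i> * t * \<alpha>)))
     = - exp (- \<i> * of_real 1 * \<alpha>) - (- exp (- \<i> * s * \<alpha>))"
  proof (rule integral_FTC_atLeastAtMost[OF assms])
    fix t
    have "((\<lambda>w. - exp (- \<i> * w * \<alpha>)) has_field_derivative (\<i> * \<alpha> * exp (- \<i> * of_real t * \<alpha>))) (at (of_real t))"
      by (auto intro!: derivative_eq_intros)
    then have "((\<lambda>t. - exp (- \<i> * of_real t * \<alpha>)) has_vector_derivative (\<i> * \<alpha> * exp (- \<i> * t * \<alpha>))) (at t)"
      by (rule has_vector_derivative_real_field)
    then show "((\<lambda>t. - exp (- \<i> * of_real t * \<alpha>)) has_vector_derivative (\<i> * \<alpha> * exp (- \<i> * t * \<alpha>))) (at t within {s..1})"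
      by (rule has_vector_derivative_at_within)
  qed (intro continuous_intros)
  then show ?thesis by simp
qed

text \<open>Since \<open>g\<close> is merely integrable, \<open>v\<close> has no derivative to which a product rule could be applied at
  every point. The formula comes from exchanging the order of integration over the triangle \<open>s \<le> t\<close>.\<close>

lemma integration_by_parts_phase:
  fixes g :: "real \<Rightarrow> complex" and a :: complex and \<alpha> :: real
  assumes g: "integrable lborel (\<lambda>t. indicator {0..1} t *\<^sub>R g t)"
    and v: "\<And>t. v t = a + (LINT s|lborel. indicator {0..t} s *\<^sub>R g s)"
  shows "integrable lborel (\<lambda>t. indicator {0..1} t *\<^sub>R (exp (- \<i> * t * \<alpha>) * (g t - \<i> * \<alpha> * v t)))"
    and "exp (- \<i> * \<alpha>) * v 1 - a =
      (LINT t|lborel. indicator {0..1} t *\<^sub>R (exp (- \<i> * t * \<alpha>) * (g t - \<i> * \<alpha> * v t)))"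
proof -
  define h where "h s = indicator {0..1} s *\<^sub>R g s" for s
  define e where "e t = exp (- \<i> * of_real t * \<alpha>)" for t :: real
  have h: "integrable lborel h" unfolding h_def by (rule g)
  have [measurable]: "h \<in> borel_measurable borel" using h by simp
  have ce: "continuous_on UNIV e" unfolding e_def by (intro continuous_intros)
  then have [measurable]: "e \<in> borel_measurable borel" by (rule borel_measurable_continuous_onI)
  have ne: "norm (e t) = 1" for t
  proof -
    have "e t = exp (\<i> * of_real (- t * \<alpha>))" by (simp add: e_def mult_ac)
    then show ?thesis by (simp only: norm_exp_i_times)
  qed
  have ind_e: "integrable lborel (\<lambda>t. indicator {0..1} t *\<^sub>R (\<i> * \<alpha> * e t))"
    using ce by (intro borel_integrable_compact[unfolded set_integrable_def]) (auto intro!: continuous_intros intro: continuous_on_subset)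
  have eh: "integrable lborel (\<lambda>s. e s * h s)"
    using h by (rule Bochner_Integration.integrable_bound) (auto simp: norm_mult ne)
  have P: "integrable (lborel \<Otimes>\<^sub>M lborel) (\<lambda>(s, t). indicator {0..1} t *\<^sub>R (indicator {s..1} t *\<^sub>R (\<i> * \<alpha> * e t)) * h s)"
  proof (rule integrable_pair_dominated[of _ "\<lambda>s. norm (\<alpha> *\<^sub>R h s)"])
    show "integrable lborel (\<lambda>s. norm (\<alpha> *\<^sub>R h s))" using h by (intro integrable_norm integrable_scaleR_right)
    show "norm (case (s, t) of (s, t) \<Rightarrow> indicator {0..1} t *\<^sub>R (indicator {s..1} t *\<^sub>R (\<i> * \<alpha> * e t)) * h s)
        \<le> indicator {0..1} t * norm (\<alpha> *\<^sub>R h s)" for s t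
      by (auto simp: indicator_def norm_mult ne)
    have "(\<lambda>(s :: real, t). indicator {s..1} t :: real) = (\<lambda>p. indicator {p. fst p \<le> snd p \<and> snd p \<le> 1} p)"
      by (auto simp: indicator_def fun_eq_iff)
    moreover have "(\<lambda>p. indicator {p. fst p \<le> snd p \<and> snd p \<le> 1} p :: real) \<in> borel_measurable (borel \<Otimes>\<^sub>M (borel :: real measure))"
      by measurable
    ultimately have [measurable]: "(\<lambda>(s :: real, t). indicator {s..1} t :: real) \<in> borel_measurable (borel \<Otimes>\<^sub>M (borel :: real measure))"
      by (simp only:)
    show "(\<lambda>(s, t). indicator {0..1} t *\<^sub>R (indicator {s..1} t *\<^sub>R (\<i> * \<alpha> * e t)) * h s) \<in> borel_measurable (lborel \<Otimes>\<^sub>M lborel)"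
      by measurable
  qed
  have inner_s: "(LINT t|lborel. indicator {0..1} t *\<^sub>R (indicator {s..1} t *\<^sub>R (\<i> * \<alpha> * e t)) * h s) = e s * h s - e 1 * h s" for s
  proof (cases "s \<in> {0..1}")
    case True
    then have "(LINT t|lborel. indicator {0..1} t *\<^sub>R (indicator {s..1} t *\<^sub>R (\<i> * \<alpha> * e t)) * h s)
        = (LINT t|lborel. indicator {s..1} t *\<^sub>R (\<i> * \<alpha> * e t) * h s)"
      by (intro Bochner_Integration.integral_cong) (auto simp: indicator_def)
    also have "\<dots> = (LINT t|lborel. indicator {s..1} t *\<^sub>R (\<i> * \<alpha> * e t)) * h s"
      by (rule Bochner_Integration.integral_mult_left_zero)
    also have "\<dots> = (e s - e 1) * h s"
      using integral_exp_phase[of s \<alpha>] True by (simp add: e_def)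
    finally show ?thesis by (simp add: algebra_simps)
  qed (simp add: h_def)
  have inner_t: "(LINT s|lborel. indicator {0..1} t *\<^sub>R (indicator {s..1} t *\<^sub>R (\<i> * \<alpha> * e t)) * h s)
      = indicator {0..1} t *\<^sub>R (\<i> * \<alpha> * e t) * (v t - a)" for t
  proof -
    have "(LINT s|lborel. indicator {0..1} t *\<^sub>R (indicator {s..1} t *\<^sub>R (\<i> * \<alpha> * e t)) * h s)
        = (LINT s|lborel. indicator {0..1} t *\<^sub>R (\<i> * \<alpha> * e t) * (indicator {0..t} s *\<^sub>R g s))"
      by (intro Bochner_Integration.integral_cong) (auto simp: indicator_def h_def)
    also have "\<dots> = indicator {0..1} t *\<^sub>R (\<i> * \<alpha> * e t) * (LINT s|lborel. indicator {0..t} s *\<^sub>R g s)"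
      by (rule Bochner_Integration.integral_mult_right_zero)
    finally show ?thesis by (simp add: v)
  qed
  have Iv: "integrable lborel (\<lambda>t. indicator {0..1} t *\<^sub>R (\<i> * \<alpha> * e t) * (v t - a))"
    using lborel_pair.integrable_snd[OF P] by (simp only: inner_t)
  have fub: "(LINT t|lborel. indicator {0..1} t *\<^sub>R (\<i> * \<alpha> * e t) * (v t - a)) = (LINT s|lborel. e s * h s - e 1 * h s)"
    using lborel_pair.Fubini_integral[OF P] by (simp only: inner_t inner_s)
  have Ia: "integrable lborel (\<lambda>t. indicator {0..1} t *\<^sub>R (\<i> * \<alpha> * e t) * a)"
    using ind_e by (rule integrable_mult_left)
  have split: "indicator {0..1} t *\<^sub>R (exp (- \<i> * t * \<alpha>) * (g t - \<i> * \<alpha> * v t))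
      = e t * h t - (indicator {0..1} t *\<^sub>R (\<i> * \<alpha> * e t) * (v t - a) + indicator {0..1} t *\<^sub>R (\<i> * \<alpha> * e t) * a)" for t
    by (simp add: e_def h_def indicator_def algebra_simps)
  show "integrable lborel (\<lambda>t. indicator {0..1} t *\<^sub>R (exp (- \<i> * t * \<alpha>) * (g t - \<i> * \<alpha> * v t)))"
    unfolding split by (intro Bochner_Integration.integrable_diff Bochner_Integration.integrable_add eh Iv Ia)
  have "(LINT t|lborel. indicator {0..1} t *\<^sub>R (exp (- \<i> * t * \<alpha>) * (g t - \<i> * \<alpha> * v t)))
      = (LINT s|lborel. e s * h s) - ((LINT s|lborel. e s * h s - e 1 * h s) + (LINT t|lborel. indicator {0..1} t *\<^sub>R (\<i> * \<alpha> * e t) * a))"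
    unfolding split fub[symmetric]
    by (simp only: Bochner_Integration.integral_diff Bochner_Integration.integral_add eh Iv Ia Bochner_Integration.integrable_add)
  also have "(LINT s|lborel. e s * h s - e 1 * h s) = (LINT s|lborel. e s * h s) - e 1 * (LINT s|lborel. h s)"
    using eh h by (simp add: Bochner_Integration.integral_diff)
  also have "(LINT t|lborel. indicator {0..1} t *\<^sub>R (\<i> * \<alpha> * e t) * a) = (e 0 - e 1) * a"
    using integral_exp_phase[of 0 \<alpha>]
    by (subst Bochner_Integration.integral_mult_left_zero) (simp add: e_def)
  finally show "exp (- \<i> * \<alpha>) * v 1 - a =
      (LINT t|lborel. indicator {0..1} t *\<^sub>R (exp (- \<i> * t * \<alpha>) * (g t - \<i> * \<alpha> * v t)))"
    by (simp add: v h_def[symmetric] algebra_simps) (simp add: e_def algebra_simps)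
qed

lemma real_dot_scaleR_right: "real_dot v (c *\<^sub>R m) = c *\<^sub>R real_dot v m"
  by (simp add: real_dot_def scaleR_sum_right mult.commute)

text \<open>Integrability on almost every segment holds after cutting \<open>f\<close> off outside a ball. Countably many
  balls suffice, since each segment lies in one of them.\<close>

lemma AE_integrable_on_segment:
  fixes f :: "real ^ 'n \<Rightarrow> 'b::euclidean_space"
  assumes [measurable]: "f \<in> borel_measurable borel" and f: "locally_integrable f"
  shows "AE x in lborel. integrable lborel (\<lambda>t. indicator {0..1::real} t *\<^sub>R f (x + t *\<^sub>R z))"
proof -
  have "AE x in lborel. \<forall>k::nat. integrable lborel (\<lambda>t. indicator {0..1::real} t *\<^sub>R (indicator (cball 0 (real k)) (x + t *\<^sub>R z) *\<^sub>R f (x + t *\<^sub>R z)))"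
    unfolding AE_all_countable
  proof
    fix k :: nat
    have "integrable lborel (\<lambda>x. indicator (cball 0 (real k)) x *\<^sub>R f x)"
      using f by (auto simp: locally_integrable_borel_iff)
    from integrable_pair_shifted[OF this, of z]
    show "AE x in lborel. integrable lborel (\<lambda>t. indicator {0..1::real} t *\<^sub>R (indicator (cball 0 (real k)) (x + t *\<^sub>R z) *\<^sub>R f (x + t *\<^sub>R z)))"
      using lborel_pair.AE_integrable_fst'[of "\<lambda>(x, t). indicator {0..1::real} t *\<^sub>R (indicator (cball 0 (real k)) (x + t *\<^sub>R z) *\<^sub>R f (x + t *\<^sub>R z))"]
      by simp
  qed
  then show ?thesis
  proof eventually_elim
    case (elim x)
    obtain k :: nat where k: "norm x + norm z \<le> real k" using real_arch_simple by blast
    have "x + t *\<^sub>R z \<in> cball 0 (real k)" if "t \<in> {0..1}" for t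
    proof -
      have "norm (x + t *\<^sub>R z) \<le> norm x + \<bar>t\<bar> * norm z"
        using norm_triangle_ineq[of x "t *\<^sub>R z"] by simp
      also have "\<dots> \<le> norm x + 1 * norm z"
        using that by (intro add_mono mult_right_mono) auto
      finally show ?thesis using k by simp
    qed
    then have eq: "(\<lambda>t. indicator {0..1::real} t *\<^sub>R (indicator (cball 0 (real k)) (x + t *\<^sub>R z) *\<^sub>R f (x + t *\<^sub>R z)))
        = (\<lambda>t. indicator {0..1::real} t *\<^sub>R f (x + t *\<^sub>R z))"
      by (auto simp: indicator_def fun_eq_iff)
    show ?case using elim[rule_format, of k] unfolding eq .
  qed
qed

text \<open>The derivative of \<open>t \<mapsto> exp(-it\<alpha>) u(x + tz)\<close> with the frozen phase \<open>\<alpha> = z \<bullet> A(x + z/2)\<close>, expressed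
  through the magnetic gradient \<open>M\<close> in place of the gradient.\<close>

definition magnetic_increment ::
    "(real ^ 'n \<Rightarrow> real ^ 'n) \<Rightarrow> (real ^ 'n \<Rightarrow> complex) \<Rightarrow> (real ^ 'n \<Rightarrow> complex ^ 'n) \<Rightarrow>
     real ^ 'n \<Rightarrow> real ^ 'n \<Rightarrow> real \<Rightarrow> complex" where
  "magnetic_increment A u M x z t =
     exp (- \<i> * of_real t * of_real (z \<bullet> A (x + (1 / 2) *\<^sub>R z))) *
       (real_dot z (M (x + t *\<^sub>R z))
         + \<i> * of_real (z \<bullet> (A (x + t *\<^sub>R z) - A (x + (1 / 2) *\<^sub>R z))) * u (x + t *\<^sub>R z))"

text \<open>For almost every \<open>x\<close> the restriction of \<open>u\<close> to the segment agrees at the end point \<open>t = 1\<close>, and for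
  almost every \<open>t\<close>, with the primitive of \<open>z \<cdot> G(x + t z)\<close> that starts at \<open>u x\<close>. Integration by parts
  against the frozen phase is applied to this primitive.\<close>

lemma Psi_eq_line_integral:
  fixes u :: "real ^ 'n \<Rightarrow> complex" and G :: "real ^ 'n \<Rightarrow> complex ^ 'n" and A :: "real ^ 'n \<Rightarrow> real ^ 'n"
  assumes wg: "has_weak_gradient u G"
    and [measurable]: "u \<in> borel_measurable borel" "G \<in> borel_measurable borel"
  defines "F \<equiv> magnetic_increment A u (magnetic_gradient A u G)"
  shows "AE x in lborel. integrable lborel (\<lambda>t. indicator {0..1::real} t *\<^sub>R F x z t) \<and>
      Psi A u x (x + z) - u x = (LINT t|lborel. indicator {0..1::real} t *\<^sub>R F x z t)"
proof -
  define \<alpha> where "\<alpha> x z = z \<bullet> A (x + (1 / 2) *\<^sub>R z)" for x z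
  let ?g = "\<lambda>x t. real_dot z (G (x + t *\<^sub>R z))"
  have lu: "locally_integrable u" and lG: "locally_integrable G"
    using wg by (auto simp: has_weak_gradient_def)
  have G1: "AE x in lborel. integrable lborel (\<lambda>t. indicator {0..1::real} t *\<^sub>R G (x + t *\<^sub>R z))"
    by (rule AE_integrable_on_segment) (auto simp: lG)
  have line: "AE x in lborel. AE t in lborel. t \<in> {0..1} \<longrightarrow>
      u (x + t *\<^sub>R z) - u x = (LINT s|lborel. indicator {0..t} s *\<^sub>R ?g x s)"
  proof (subst lborel_pair.AE_commute)
    have eq: "(LINT s|lborel. indicator {0..snd p} s *\<^sub>R ?g (fst p) s) =
        (LINT s|lborel. (if 0 \<le> s \<and> s \<le> snd p then 1 else 0) *\<^sub>R ?g (fst p) s)" for p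
      by (auto simp: indicator_def intro!: Bochner_Integration.integral_cong)
    have [measurable]: "(\<lambda>p. LINT s|lborel. indicator {0..snd p} s *\<^sub>R ?g (fst p) s) \<in> borel_measurable (lborel \<Otimes>\<^sub>M lborel)"
      unfolding eq by measurable
    show "{x \<in> space (lborel \<Otimes>\<^sub>M lborel). snd x \<in> {0..1} \<longrightarrow>
       u (fst x + snd x *\<^sub>R z) - u (fst x) = (LINT s|lborel. indicator {0..snd x} s *\<^sub>R ?g (fst x) s)} \<in> sets (lborel \<Otimes>\<^sub>M lborel)"
      by measurable
    show "AE t in lborel. AE x in lborel. t \<in> {0..1} \<longrightarrow>
      u (x + t *\<^sub>R z) - u x = (LINT s|lborel. indicator {0..t} s *\<^sub>R ?g x s)"
    proof (rule AE_I2)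
      fix t :: real
      show "AE x in lborel. t \<in> {0..1} \<longrightarrow>
        u (x + t *\<^sub>R z) - u x = (LINT s|lborel. indicator {0..t} s *\<^sub>R ?g x s)"
        using weak_gradient_line_integral[OF wg _ _, of t z] by (cases "t \<in> {0..1}") auto
    qed
  qed
  have line1: "AE x in lborel. u (x + 1 *\<^sub>R z) - u x = (LINT s|lborel. indicator {0..1} s *\<^sub>R ?g x s)"
    by (rule weak_gradient_line_integral[OF wg]) auto
  show ?thesis
    using G1 line line1
  proof eventually_elim
    case (elim x)
    define v where "v t = u x + (LINT s|lborel. indicator {0..t} s *\<^sub>R ?g x s)" for t
    have g: "integrable lborel (\<lambda>t. indicator {0..1} t *\<^sub>R ?g x t)"
    proof -
      have "bounded_linear (real_dot z)"
        unfolding real_dot_def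
        by (intro bounded_linear_sum bounded_linear_scaleR_right[THEN bounded_linear_compose] bounded_linear_vec_nth)
      from integrable_bounded_linear[OF this elim(1)] show ?thesis
        by (simp only: real_dot_scaleR_right)
    qed
    note parts = integration_by_parts_phase[OF g, of v "u x" "\<alpha> x z", OF v_def]
    have F: "F x z t = exp (- \<i> * t * \<alpha> x z) * (?g x t - \<i> * \<alpha> x z * u (x + t *\<^sub>R z))" for t
    proof -
      have rd: "real_dot z (magnetic_gradient A u G y) = real_dot z (G y) - \<i> * of_real (z \<bullet> A y) * u y" for y
        by (simp add: magnetic_gradient_def real_dot_diff)
           (simp add: real_dot_def inner_vec_def sum_distrib_left sum_distrib_right scaleR_conv_of_real mult_ac)
      show ?thesis unfolding F_def magnetic_increment_def \<alpha>_def rd by (simp add: inner_diff_right algebra_simps)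
    qed
    have AEF: "AE t in lborel. indicator {0..1} t *\<^sub>R (exp (- \<i> * t * \<alpha> x z) * (?g x t - \<i> * \<alpha> x z * v t))
        = indicator {0..1} t *\<^sub>R F x z t"
      using elim(2) by eventually_elim (auto simp: F v_def indicator_def algebra_simps)
    have meas: "(\<lambda>t. indicator {0..1} t *\<^sub>R F x z t) \<in> borel_measurable lborel"
      unfolding F by measurable
    have "integrable lborel (\<lambda>t. indicator {0..1} t *\<^sub>R F x z t)"
      by (rule integrable_cong_AE_imp[OF parts(1) meas]) (use AEF in \<open>auto elim: AE_mp\<close>)
    moreover have "Psi A u x (x + z) - u x = exp (- \<i> * \<alpha> x z) * v 1 - u x"
    proof -
      have "(1 / 2) *\<^sub>R (x + (x + z)) = x + (1 / 2) *\<^sub>R z"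
        by (simp add: vec_eq_iff field_simps)
      then have "Psi A u x (x + z) = exp (- \<i> * \<alpha> x z) * u (x + z)"
        by (simp add: Psi_def \<alpha>_def)
      moreover have "v 1 = u (x + z)" using elim(3) by (simp add: v_def algebra_simps)
      ultimately show ?thesis by simp
    qed
    moreover have "exp (- \<i> * \<alpha> x z) * v 1 - u x = (LINT t|lborel. indicator {0..1} t *\<^sub>R F x z t)"
      unfolding parts(2)
      by (rule integral_cong_AE[OF borel_measurable_integrable[OF parts(1)] meas AEF])
    ultimately show ?case by simp
  qed
qed

section \<open>Invariance of Lebesgue measure under orthogonal maps\<close>

lemma orthogonal_transformation_borel_measurable:
  fixes T :: "real ^ 'n \<Rightarrow> real ^ 'n"
  assumes "orthogonal_transformation T"
  shows "T \<in> borel_measurable borel"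
  using assms
  by (intro borel_measurable_continuous_onI linear_continuous_on linear_conv_bounded_linear[THEN iffD1])
     (rule orthogonal_transformation_linear)

lemma nn_integral_lborel_translate:
  fixes f :: "'a::euclidean_space \<Rightarrow> ennreal"
  assumes [measurable]: "f \<in> borel_measurable borel"
  shows "(\<integral>\<^sup>+x. f (x + c) \<partial>lborel) = (\<integral>\<^sup>+x. f x \<partial>lborel)"
proof -
  have "(\<integral>\<^sup>+x. f x \<partial>lborel) = (\<integral>\<^sup>+x. f x \<partial>distr lborel borel ((+) c))"
    by (simp add: lborel_distr_plus)
  also have "\<dots> = (\<integral>\<^sup>+x. f (c + x) \<partial>lborel)"
    by (rule nn_integral_distr) auto
  finally show ?thesis by (simp add: add.commute)
qed

lemma nn_integral_lborel_minus:
  fixes f :: "'a::euclidean_space \<Rightarrow> ennreal"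
  assumes [measurable]: "f \<in> borel_measurable borel"
  shows "(\<integral>\<^sup>+x. f (c - x) \<partial>lborel) = (\<integral>\<^sup>+x. f x \<partial>lborel)"
proof -
  have "lborel = density (distr lborel borel (\<lambda>x::'a. c - x)) (\<lambda>_. 1)"
    using lborel_affine[of "- 1" c] by simp
  then have "(\<integral>\<^sup>+x. f x \<partial>lborel) = (\<integral>\<^sup>+x. f x \<partial>density (distr lborel borel (\<lambda>x::'a. c - x)) (\<lambda>_. 1))"
    by (rule arg_cong)
  also have "\<dots> = (\<integral>\<^sup>+x. f (c - x) \<partial>lborel)"
    by (simp add: nn_integral_density nn_integral_distr)
  finally show ?thesis by simp
qed

text \<open>This is the uniqueness argument for Haar measure. The image measure is translation invariant, so
  integrating \<open>1\<^sub>X(T x) 1\<^sub>B(y + T x)\<close> over \<open>x\<close> and \<open>y\<close> in both orders gives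
  \<open>|T\<^sup>-\<^sup>1 X| |B| = |X| |T\<^sup>-\<^sup>1 B|\<close>. For the unit ball \<open>B\<close> the two factors with \<open>B\<close> coincide.\<close>

lemma lborel_distr_orthogonal:
  fixes T :: "real ^ 'n \<Rightarrow> real ^ 'n"
  assumes T: "orthogonal_transformation T"
  shows "distr lborel borel T = lborel"
proof (rule measure_eqI)
  have lin: "linear T" using T by (rule orthogonal_transformation_linear)
  have surj: "surj T" using T by (rule orthogonal_transformation_surj)
  note [measurable] = orthogonal_transformation_borel_measurable[OF T]
  define B where "B = ball (0::real ^ 'n) 1"
  have [measurable]: "B \<in> sets borel" by (simp add: B_def)
  fix X :: "(real ^ 'n) set" assume "X \<in> sets (distr lborel borel T)"
  then have X[measurable]: "X \<in> sets borel" by simp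
  have "emeasure lborel (T -` X) * emeasure lborel B =
      (\<integral>\<^sup>+x. indicator X (T x) * (\<integral>\<^sup>+y. indicator B y \<partial>lborel) \<partial>lborel)"
  proof -
    have "(\<integral>\<^sup>+x. indicator X (T x) \<partial>lborel) = (\<integral>\<^sup>+x. indicator (T -` X) x \<partial>lborel)"
      by (intro nn_integral_cong) (auto simp: indicator_def)
    moreover have "T -` X \<in> sets borel"
      by (rule measurable_sets_borel[OF _ X]) measurable
    ultimately show ?thesis by (simp add: nn_integral_multc)
  qed
  also have "\<dots> = (\<integral>\<^sup>+x. indicator X (T x) * (\<integral>\<^sup>+y. indicator B (y + T x) \<partial>lborel) \<partial>lborel)"
  proof -
    have "(\<integral>\<^sup>+y. indicator B (y + T c) \<partial>lborel) = (\<integral>\<^sup>+y. indicator B y \<partial>lborel)" for c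
      by (rule nn_integral_lborel_translate) measurable
    then show ?thesis by (simp only:)
  qed
  also have "\<dots> = (\<integral>\<^sup>+x. (\<integral>\<^sup>+y. indicator X (T x) * indicator B (y + T x) \<partial>lborel) \<partial>lborel)"
    by (rule nn_integral_cong, rule nn_integral_cmult[symmetric]) measurable
  also have "\<dots> = (\<integral>\<^sup>+y. (\<integral>\<^sup>+x. indicator X (T x) * indicator B (y + T x) \<partial>lborel) \<partial>lborel)"
    by (rule lborel_pair.Fubini'[symmetric]) measurable
  also have "\<dots> = (\<integral>\<^sup>+y. (\<integral>\<^sup>+x. indicator X (T x - y) * indicator B (T x) \<partial>lborel) \<partial>lborel)"
  proof (rule nn_integral_cong)
    fix y
    obtain c where c: "y = T c" using surj by (metis surjD)
    have "(\<integral>\<^sup>+x. indicator X (T x - y) * indicator B (T x) \<partial>lborel) =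
        (\<integral>\<^sup>+x. indicator X (T (x + c) - y) * indicator B (T (x + c)) \<partial>lborel)"
      by (rule nn_integral_lborel_translate[symmetric]) measurable
    then show "(\<integral>\<^sup>+x. indicator X (T x) * indicator B (y + T x) \<partial>lborel) =
        (\<integral>\<^sup>+x. indicator X (T x - y) * indicator B (T x) \<partial>lborel)"
      by (simp add: c linear_add[OF lin] add.commute)
  qed
  also have "\<dots> = (\<integral>\<^sup>+x. (\<integral>\<^sup>+y. indicator X (T x - y) * indicator B (T x) \<partial>lborel) \<partial>lborel)"
    by (rule lborel_pair.Fubini') measurable
  also have "\<dots> = (\<integral>\<^sup>+x. emeasure lborel X * indicator B (T x) \<partial>lborel)"
  proof (rule nn_integral_cong)
    fix x
    have "(\<integral>\<^sup>+y. indicator X (T x - y) \<partial>lborel) = (\<integral>\<^sup>+y. indicator X y \<partial>lborel)"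
      by (rule nn_integral_lborel_minus) measurable
    then show "(\<integral>\<^sup>+y. indicator X (T x - y) * indicator B (T x) \<partial>lborel) = emeasure lborel X * indicator B (T x)"
      by (simp add: nn_integral_multc)
  qed
  also have "\<dots> = emeasure lborel X * (\<integral>\<^sup>+x. indicator B x \<partial>lborel)"
  proof -
    have "indicator B (T x) = (indicator B x :: ennreal)" for x
      using T by (auto simp: B_def indicator_def orthogonal_transformation_norm)
    then show ?thesis by (simp add: nn_integral_cmult)
  qed
  finally have "emeasure lborel (T -` X) * emeasure lborel B = emeasure lborel X * emeasure lborel B"
    by simp
  moreover have "emeasure lborel B \<noteq> 0"
  proof -
    have "emeasure lborel B = ennreal (measure lborel B)"
      using emeasure_lborel_ball_finite[of "0::real^'n" 1] unfolding B_def by (intro emeasure_eq_ennreal_measure) auto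
    moreover have "measure lborel B > 0"
      using content_ball_pos[of 1 "0::real^'n"] by (simp add: B_def)
    ultimately show ?thesis by simp
  qed
  ultimately have "emeasure lborel (T -` X) = emeasure lborel X"
    using emeasure_lborel_ball_finite[of "0::real^'n" 1]
    by (simp add: B_def mult.commute[of _ "emeasure lborel (ball 0 1)"] ennreal_mult_cancel_left) auto
  then show "emeasure (distr lborel borel T) X = emeasure lborel X"
    by (simp add: emeasure_distr)
qed simp

lemma nn_integral_lborel_orthogonal:
  fixes T :: "real ^ 'n \<Rightarrow> real ^ 'n"
  assumes T: "orthogonal_transformation T" and [measurable]: "f \<in> borel_measurable borel"
  shows "(\<integral>\<^sup>+x. f (T x) \<partial>lborel) = (\<integral>\<^sup>+x. f x \<partial>lborel)"
proof -
  note [measurable] = orthogonal_transformation_borel_measurable[OF T]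
  have "(\<integral>\<^sup>+x. f x \<partial>lborel) = (\<integral>\<^sup>+x. f x \<partial>distr lborel borel T)"
    by (simp add: lborel_distr_orthogonal[OF T])
  also have "\<dots> = (\<integral>\<^sup>+x. f (T x) \<partial>lborel)"
    by (rule nn_integral_distr) auto
  finally show ?thesis ..
qed

section \<open>Polar coordinates\<close>

text \<open>The radial factor of Lebesgue measure on \<open>\<real>\<^sup>N\<close>.\<close>

definition radial_measure :: "nat \<Rightarrow> real measure" where
  "radial_measure N = density lborel (\<lambda>r. ennreal (indicator {0<..} r * r ^ (N - 1)))"

lemma sets_sphere_measure[measurable_cong]:
  "sets (sphere_measure :: (real ^ 'n) measure) = sets (restrict_space borel (sphere 0 1))"
  by (simp add: sphere_measure_def)

lemma space_sphere_measure: "space (sphere_measure :: (real ^ 'n) measure) = sphere 0 1"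
  by (simp add: sphere_measure_def space_scale_measure space_restrict_space)

lemma finite_sphere_measure:
  "finite_measure (sphere_measure :: (real ^ 'n) measure)"
proof
  have "emeasure (sphere_measure :: (real ^ 'n) measure) (sphere 0 1) =
      of_nat CARD('n) * emeasure lborel {x::real^'n \<in> ball 0 1 - {0}. x /\<^sub>R norm x \<in> sphere 0 1}"
    by (rule emeasure_sphere_measure) auto
  also have "\<dots> \<le> of_nat CARD('n) * emeasure lborel (ball (0::real^'n) 1)"
    by (intro mult_left_mono emeasure_mono) auto
  also have "\<dots> < \<infinity>"
    using emeasure_lborel_ball_finite[of "0::real^'n" 1] by (simp add: ennreal_mult_less_top of_nat_less_top)
  finally show "emeasure (sphere_measure :: (real ^ 'n) measure) (space sphere_measure) \<noteq> \<infinity>"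
    by (simp add: space_sphere_measure)
qed

text \<open>Dilation by \<open>R\<close> maps the cone inside the unit ball, whose volume defines \<open>sphere_measure\<close>, onto this
  one.\<close>

lemma emeasure_cone:
  fixes E :: "(real ^ 'n) set"
  assumes E: "E \<in> sets borel" "E \<subseteq> sphere 0 1" and R: "R \<ge> 0"
  shows "emeasure lborel {x. 0 < norm x \<and> norm x < R \<and> x /\<^sub>R norm x \<in> E} =
     ennreal (R ^ CARD('n) / CARD('n)) * emeasure sphere_measure E"
proof (cases "R = 0")
  case True
  then have "{x. 0 < norm x \<and> norm x < R \<and> x /\<^sub>R norm x \<in> E} = {}" by auto
  then show ?thesis using True by simp
next
  case False
  then have R: "R > 0" using R by simp
  let ?U = "{x \<in> ball 0 1 - {0}. x /\<^sub>R norm x \<in> E}"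
  have m: "?U \<in> sets borel" using E(1) by measurable
  have dil: "(*\<^sub>R) R ` X = (\<lambda>x. x /\<^sub>R R) -` X" for X :: "(real ^ 'n) set"
    using R by (auto simp: image_iff intro!: bexI[of _ "x /\<^sub>R R" for x])
  have "{x. 0 < norm x \<and> norm x < R \<and> x /\<^sub>R norm x \<in> E} = (*\<^sub>R) R ` ?U"
    unfolding dil using R by (auto simp: field_simps)
  moreover have "emeasure lborel ((*\<^sub>R) R ` ?U) = ennreal (R ^ CARD('n)) * emeasure lborel ?U"
  proof -
    have "emeasure lebesgue ((\<lambda>x. R *\<^sub>R x + 0) ` ?U) = ennreal (\<bar>R\<bar> ^ DIM(real^'n)) * emeasure lebesgue ?U"
      by (rule emeasure_lebesgue_affine)
    moreover have "(*\<^sub>R) R ` ?U \<in> sets borel"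
    proof -
      show ?thesis unfolding dil
        by (rule measurable_sets_borel[OF _ m]) auto
    qed
    ultimately show ?thesis using m R by simp
  qed
  moreover have "emeasure sphere_measure E = of_nat CARD('n) * emeasure lborel ?U"
    by (rule emeasure_sphere_measure[OF E])
  moreover have "ennreal (R ^ CARD('n) / CARD('n)) * (of_nat CARD('n) * e) = ennreal (R ^ CARD('n)) * e" for e
    by (simp add: mult.assoc[symmetric] ennreal_of_nat_eq_real_of_nat ennreal_mult[symmetric] R less_imp_le)
  ultimately show ?thesis by simp
qed

lemma emeasure_radial_measure_Ioo:
  assumes "N > 0" "0 \<le> R"
  shows "emeasure (radial_measure N) {..<R} = ennreal (R ^ N / N)"
proof -
  have "emeasure (radial_measure N) {..<R} =
      (\<integral>\<^sup>+r. ennreal (indicator {0<..} r * r ^ (N - 1)) * indicator {..<R} r \<partial>lborel)"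
    unfolding radial_measure_def by (rule emeasure_density) auto
  also have "\<dots> = (\<integral>\<^sup>+r. ennreal (r ^ (N - 1)) * indicator {0..R} r \<partial>lborel)"
  proof (rule nn_integral_cong_AE)
    show "AE r in lborel. ennreal (indicator {0<..} r * r ^ (N - 1)) * indicator {..<R} r =
        ennreal (r ^ (N - 1)) * indicator {0..R} r"
      using AE_lborel_singleton[of 0] AE_lborel_singleton[of R]
      by eventually_elim (auto simp: indicator_def)
  qed
  also have "\<dots> = ennreal (R ^ N / N - 0 ^ N / N)"
  proof (rule nn_integral_FTC_Icc)
    show "((\<lambda>x. x ^ N / N) has_real_derivative x ^ (N - 1)) (at x)" for x
      using assms by (auto intro!: derivative_eq_intros)
  qed (use assms in auto)
  finally show ?thesis using assms by (simp add: power_0_left)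
qed

lemma borel_measurable_scaleR_sphere:
  fixes f :: "real ^ 'n \<Rightarrow> ennreal"
  assumes [measurable]: "f \<in> borel_measurable borel"
  shows "(\<lambda>p. f (fst p *\<^sub>R snd p)) \<in> borel_measurable (borel \<Otimes>\<^sub>M restrict_space borel (sphere 0 1))"
proof -
  have [measurable]: "snd \<in> borel \<Otimes>\<^sub>M restrict_space borel (sphere 0 1) \<rightarrow>\<^sub>M (borel :: (real^'n) measure)"
    by (rule measurable_compose[OF measurable_snd]) (rule measurable_restrict_space1, simp)
  show ?thesis by measurable
qed

text \<open>The image of Lebesgue measure under \<open>x \<mapsto> (|x|, x / |x|)\<close> is compared with the product measure on
  rectangles \<open>A \<times> B\<close>. For fixed \<open>B\<close> both sides are measures in \<open>A\<close>, and they agree on the intervals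
  \<open>{..<R}\<close> by \<open>emeasure_cone\<close>.\<close>

theorem polar_coordinates:
  fixes f :: "real ^ 'n \<Rightarrow> ennreal"
  assumes f[measurable]: "f \<in> borel_measurable borel"
  shows "(\<integral>\<^sup>+x. f x \<partial>lborel) =
     (\<integral>\<^sup>+r. (\<integral>\<^sup>+\<sigma>. f (r *\<^sub>R \<sigma>) \<partial>sphere_measure) \<partial>radial_measure CARD('n))"
proof -
  let ?N = "CARD('n)"
  let ?S = "sphere_measure :: (real ^ 'n) measure"
  let ?P = "\<lambda>x::real^'n. (norm x, x /\<^sub>R norm x)"
  let ?L = "restrict_space lborel (- {0}) :: (real ^ 'n) measure"
  let ?D = "distr ?L (borel \<Otimes>\<^sub>M restrict_space borel (sphere 0 1)) ?P"
  interpret S: finite_measure ?S by (rule finite_sphere_measure)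
  have P[measurable]: "?P \<in> ?L \<rightarrow>\<^sub>M borel \<Otimes>\<^sub>M restrict_space borel (sphere 0 1)"
    by (intro measurable_Pair measurable_restrict_space2 measurable_restrict_space1)
       (auto simp: space_restrict_space)
  have setsL: "A \<in> sets ?L \<longleftrightarrow> A \<in> sets borel \<and> 0 \<notin> A" for A
    by (subst sets_restrict_space_iff) auto
  have emD: "emeasure ?D (A \<times> B) = emeasure lborel {x. x \<noteq> 0 \<and> norm x \<in> A \<and> x /\<^sub>R norm x \<in> B}"
    if "A \<in> sets borel" "B \<in> sets (restrict_space borel (sphere 0 1))" for A B
  proof -
    have "emeasure ?D (A \<times> B) = emeasure ?L (?P -` (A \<times> B) \<inter> space ?L)"
      by (rule emeasure_distr) (use that in auto)
    also have "\<dots> = emeasure lborel (?P -` (A \<times> B) \<inter> space ?L)"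
      by (rule emeasure_restrict_space) (auto simp: space_restrict_space)
    also have "?P -` (A \<times> B) \<inter> space ?L = {x. x \<noteq> 0 \<and> norm x \<in> A \<and> x /\<^sub>R norm x \<in> B}"
      by (auto simp: space_restrict_space)
    finally show ?thesis .
  qed
  have main: "radial_measure ?N \<Otimes>\<^sub>M ?S = ?D"
  proof (rule pair_measure_eqI)
    show "sigma_finite_measure (radial_measure ?N)"
      unfolding radial_measure_def
      by (subst sigma_finite_measure.sigma_finite_iff_density_finite') (auto intro: sigma_finite_lborel)
    show "sigma_finite_measure ?S" by (rule S.sigma_finite_measure_axioms)
    show "sets (radial_measure ?N \<Otimes>\<^sub>M ?S) = sets ?D"
      by (auto simp: radial_measure_def sets_sphere_measure intro!: sets_pair_measure_cong)
    fix A and B :: "(real ^ 'n) set"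
    assume A: "A \<in> sets (radial_measure ?N)" and B: "B \<in> sets ?S"
    then have A': "A \<in> sets borel" by (simp add: radial_measure_def)
    have B': "B \<in> sets (restrict_space borel (sphere 0 1))" "B \<in> sets borel" "B \<subseteq> sphere 0 1"
      using B by (auto simp: sets_sphere_measure sets_restrict_space)
    let ?C = "{x. x \<noteq> 0 \<and> x /\<^sub>R norm x \<in> B} :: (real^'n) set"
    have C: "?C \<in> sets borel" using B'(2) by measurable
    define \<mu> where "\<mu> = distr (restrict_space lborel ?C) borel norm"
    define \<nu> where "\<nu> = scale_measure (emeasure ?S B) (radial_measure ?N)"
    have \<mu>: "emeasure \<mu> X = emeasure lborel {x. x \<noteq> 0 \<and> norm x \<in> X \<and> x /\<^sub>R norm x \<in> B}"
      if "X \<in> sets borel" for X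
    proof -
      have "emeasure \<mu> X = emeasure (restrict_space lborel ?C) (norm -` X \<inter> space (restrict_space lborel ?C))"
        unfolding \<mu>_def by (rule emeasure_distr) (use that in \<open>auto intro!: measurable_restrict_space1\<close>)
      also have "\<dots> = emeasure lborel (norm -` X \<inter> space (restrict_space lborel ?C))"
        by (rule emeasure_restrict_space) (use C in \<open>auto simp: space_restrict_space\<close>)
      also have "norm -` X \<inter> space (restrict_space lborel ?C) = {x. x \<noteq> 0 \<and> norm x \<in> X \<and> x /\<^sub>R norm x \<in> B}"
        by (auto simp: space_restrict_space)
      finally show ?thesis .
    qed
    have eq: "emeasure \<mu> {..<R} = emeasure \<nu> {..<R}" for R
    proof (cases "R \<ge> 0")
      case True
      have "{x::real^'n. x \<noteq> 0 \<and> norm x \<in> {..<R} \<and> x /\<^sub>R norm x \<in> B} =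
          {x. 0 < norm x \<and> norm x < R \<and> x /\<^sub>R norm x \<in> B}" by auto
      then have "emeasure \<mu> {..<R} = ennreal (R ^ ?N / ?N) * emeasure ?S B"
        unfolding \<mu>[OF lessThan_borel] using emeasure_cone[OF B'(2,3) True] by (simp only:)
      moreover have "emeasure \<nu> {..<R} = emeasure ?S B * ennreal (R ^ ?N / ?N)"
        unfolding \<nu>_def using emeasure_radial_measure_Ioo[OF _ True, of ?N] by simp
      ultimately show ?thesis by (simp only: mult.commute)
    next
      case False
      then have "\<not> norm x < R" for x :: "real ^ 'n"
        using norm_ge_zero[of x] by linarith
      then have "{x::real^'n. x \<noteq> 0 \<and> norm x \<in> {..<R} \<and> x /\<^sub>R norm x \<in> B} = {}"
        by simp
      moreover have "emeasure (radial_measure ?N) {..<R} \<le> emeasure (radial_measure ?N) {..<0}"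
        using False by (intro emeasure_mono) (auto simp: radial_measure_def)
      then have "emeasure (radial_measure ?N) {..<R} = 0"
        using emeasure_radial_measure_Ioo[of ?N 0] by (simp add: power_0_left)
      ultimately show ?thesis
        by (simp only: \<mu>[OF lessThan_borel] \<nu>_def emeasure_empty emeasure_scale_measure) simp
    qed
    have "\<mu> = \<nu>"
    proof (rule measure_eqI_generator_eq[where E = "range lessThan" and \<Omega> = UNIV and A = "\<lambda>n. {..<real n}"])
      show "Int_stable (range lessThan :: real set set)"
      proof (rule Int_stableI)
        fix X Y :: "real set" assume "X \<in> range lessThan" "Y \<in> range lessThan"
        then obtain x y where "X = {..<x}" "Y = {..<y}" by blast
        then have "X \<inter> Y = {..<min x y}" by auto
        then show "X \<inter> Y \<in> range lessThan" by blast
      qed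
      show "sets \<mu> = sigma_sets UNIV (range lessThan)"
        by (simp add: \<mu>_def borel_Iio)
      show "sets \<nu> = sigma_sets UNIV (range lessThan)"
        by (simp add: \<nu>_def radial_measure_def borel_Iio)
      show "(\<Union>i. {..<real i}) = UNIV"
        by (auto simp: reals_Archimedean2)
      show "emeasure \<mu> {..<real i} \<noteq> \<infinity>" for i
        using emeasure_radial_measure_Ioo[of ?N "real i"] S.emeasure_finite[of B]
        by (simp add: eq \<nu>_def ennreal_mult_eq_top_iff top.not_eq_extremum)
    qed (use eq in auto)
    then show "emeasure (radial_measure ?N) A * emeasure ?S B = emeasure ?D (A \<times> B)"
      using \<mu>[OF A'] emD[OF A' B'(1)] by (simp add: \<nu>_def mult.commute)
  qed
  note [measurable] = borel_measurable_scaleR_sphere[OF f]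
  have "(\<integral>\<^sup>+x. f x \<partial>lborel) = (\<integral>\<^sup>+x. f x * indicator (- {0}) x \<partial>lborel)"
  proof (rule nn_integral_cong_AE)
    show "AE x in lborel. f x = f x * indicator (- {0}) x"
      using AE_lborel_singleton[of 0] by eventually_elim (auto simp: indicator_def)
  qed
  also have "\<dots> = (\<integral>\<^sup>+x. f x \<partial>?L)"
    by (subst nn_integral_restrict_space) auto
  also have "\<dots> = (\<integral>\<^sup>+x. f (fst (?P x) *\<^sub>R snd (?P x)) \<partial>?L)"
    by (intro nn_integral_cong) (auto simp: space_restrict_space)
  also have "\<dots> = (\<integral>\<^sup>+p. f (fst p *\<^sub>R snd p) \<partial>?D)"
    by (rule nn_integral_distr[symmetric, OF P]) measurable
  also have "\<dots> = (\<integral>\<^sup>+p. f (fst p *\<^sub>R snd p) \<partial>(radial_measure ?N \<Otimes>\<^sub>M ?S))"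
    by (simp add: main)
  also have "\<dots> = (\<integral>\<^sup>+r. (\<integral>\<^sup>+\<sigma>. f (r *\<^sub>R \<sigma>) \<partial>?S) \<partial>radial_measure ?N)"
    by (subst S.nn_integral_fst[symmetric]) (auto simp: radial_measure_def cong: measurable_cong_sets)
  finally show ?thesis .
qed

lemma sets_radial_measure[measurable_cong]: "sets (radial_measure N) = sets borel"
  by (simp add: radial_measure_def)

lemma borel_measurable_sphere_integral[measurable]:
  fixes f :: "real ^ 'n \<Rightarrow> ennreal"
  assumes f: "f \<in> borel_measurable borel"
  shows "(\<lambda>r. \<integral>\<^sup>+\<sigma>. f (r *\<^sub>R \<sigma>) \<partial>sphere_measure) \<in> borel_measurable borel"
proof -
  interpret S: finite_measure "sphere_measure :: (real ^ 'n) measure" by (rule finite_sphere_measure)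
  note [measurable] = borel_measurable_scaleR_sphere[OF f]
  have "(\<lambda>p. f (fst p *\<^sub>R snd p)) \<in> borel_measurable (borel \<Otimes>\<^sub>M (sphere_measure :: (real ^ 'n) measure))"
    by measurable
  from S.borel_measurable_nn_integral_fst[OF this] show ?thesis by simp
qed

lemma AE_radial_measure_pos: "AE r in radial_measure N. r > 0"
  unfolding radial_measure_def by (subst AE_density) (auto simp: indicator_def split: if_splits)

lemma nn_integral_radial_weight:
  fixes k :: "real ^ 'n \<Rightarrow> ennreal"
  assumes k[measurable]: "k \<in> borel_measurable borel" and w[measurable]: "w \<in> borel_measurable borel"
  shows "(\<integral>\<^sup>+z. w (norm z) * k z \<partial>lborel) =
     (\<integral>\<^sup>+r. w r * (\<integral>\<^sup>+\<sigma>. k (r *\<^sub>R \<sigma>) \<partial>sphere_measure) \<partial>radial_measure CARD('n))"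
proof -
  have "(\<integral>\<^sup>+z. w (norm z) * k z \<partial>lborel) =
      (\<integral>\<^sup>+r. (\<integral>\<^sup>+\<sigma>. w (norm (r *\<^sub>R \<sigma>)) * k (r *\<^sub>R \<sigma>) \<partial>sphere_measure) \<partial>radial_measure CARD('n))"
    by (rule polar_coordinates) measurable
  also have "\<dots> = (\<integral>\<^sup>+r. w r * (\<integral>\<^sup>+\<sigma>. k (r *\<^sub>R \<sigma>) \<partial>sphere_measure) \<partial>radial_measure CARD('n))"
  proof (rule nn_integral_cong_AE)
    show "AE r in radial_measure CARD('n). (\<integral>\<^sup>+\<sigma>. w (norm (r *\<^sub>R \<sigma>)) * k (r *\<^sub>R \<sigma>) \<partial>sphere_measure)
        = w r * (\<integral>\<^sup>+\<sigma>. k (r *\<^sub>R \<sigma>) \<partial>sphere_measure)"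
      using AE_radial_measure_pos
    proof eventually_elim
      case (elim r)
      have "(\<integral>\<^sup>+\<sigma>. w (norm (r *\<^sub>R \<sigma>)) * k (r *\<^sub>R \<sigma>) \<partial>sphere_measure) = (\<integral>\<^sup>+\<sigma>. w r * k (r *\<^sub>R \<sigma>) \<partial>sphere_measure)"
        using elim by (intro nn_integral_cong) (auto simp: space_sphere_measure)
      also have "\<dots> = w r * (\<integral>\<^sup>+\<sigma>. k (r *\<^sub>R \<sigma>) \<partial>sphere_measure)"
      proof (rule nn_integral_cmult)
        have "(\<lambda>\<sigma>. k (r *\<^sub>R \<sigma>)) \<in> borel_measurable (restrict_space borel (sphere 0 1))"
          by (rule measurable_restrict_space1) measurable
        then show "(\<lambda>\<sigma>. k (r *\<^sub>R \<sigma>)) \<in> borel_measurable sphere_measure"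
          by (simp cong: measurable_cong_sets add: sets_sphere_measure)
      qed
      finally show ?case .
    qed
  qed
  finally show ?thesis .
qed

section \<open>Second moments of the sphere\<close>

lemma nn_integral_sphere_measure:
  fixes k :: "real ^ 'n \<Rightarrow> ennreal"
  assumes k[measurable]: "k \<in> borel_measurable borel"
  shows "(\<integral>\<^sup>+\<sigma>. k \<sigma> \<partial>sphere_measure) =
    of_nat CARD('n) * (\<integral>\<^sup>+x. k (x /\<^sub>R norm x) * indicator (ball 0 1 - {0}) x \<partial>lborel)"
proof -
  have k': "k \<in> borel_measurable (restrict_space borel (sphere 0 1))"
    by (rule measurable_restrict_space1[OF k])
  have "(\<integral>\<^sup>+\<sigma>. k \<sigma> \<partial>sphere_measure) = of_nat CARD('n) *
    (\<integral>\<^sup>+\<sigma>. k \<sigma> \<partial>(distr (restrict_space lborel (ball 0 1 - {0})) (restrict_space borel (sphere 0 1)) (\<lambda>x. x /\<^sub>R norm x)))"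
    unfolding sphere_measure_def
    by (rule nn_integral_scale_measure) (simp add: measurable_restrict_space1)
  also have "(\<integral>\<^sup>+\<sigma>. k \<sigma> \<partial>(distr (restrict_space lborel (ball 0 1 - {0})) (restrict_space borel (sphere 0 1)) (\<lambda>x. x /\<^sub>R norm x)))
      = (\<integral>\<^sup>+x. k (x /\<^sub>R norm x) \<partial>(restrict_space lborel (ball 0 1 - {0})))"
    by (intro nn_integral_distr measurable_restrict_space2 measurable_restrict_space1)
       (auto simp: space_restrict_space k')
  also have "\<dots> = (\<integral>\<^sup>+x. k (x /\<^sub>R norm x) * indicator (ball 0 1 - {0}) x \<partial>lborel)"
    by (rule nn_integral_restrict_space) auto
  finally show ?thesis .
qed

lemma sphere_measure_orthogonal:
  fixes T :: "real ^ 'n \<Rightarrow> real ^ 'n"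
  assumes T: "orthogonal_transformation T" and k[measurable]: "k \<in> borel_measurable borel"
  shows "(\<integral>\<^sup>+\<sigma>. k (T \<sigma>) \<partial>sphere_measure) = (\<integral>\<^sup>+\<sigma>. k \<sigma> \<partial>sphere_measure)"
proof -
  note [measurable] = orthogonal_transformation_borel_measurable[OF T]
  have meas: "ball (0::real^'n) 1 - {0} \<in> sets borel" by auto
  have Ts: "T (x /\<^sub>R norm x) = T x /\<^sub>R norm (T x)" for x
    using T by (simp add: orthogonal_transformation_norm linear_scale orthogonal_transformation_linear)
  have Ti: "indicator (ball 0 1 - {0}) (T x) = (indicator (ball 0 1 - {0}) x :: ennreal)" for x
    using T by (auto simp: indicator_def orthogonal_transformation_norm)
       (metis norm_eq_zero orthogonal_transformation_norm)+
  have "(\<integral>\<^sup>+\<sigma>. k (T \<sigma>) \<partial>sphere_measure) =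
      of_nat CARD('n) * (\<integral>\<^sup>+x. k (T x /\<^sub>R norm (T x)) * indicator (ball 0 1 - {0}) (T x) \<partial>lborel)"
    by (simp only: nn_integral_sphere_measure[of "\<lambda>x. k (T x)"] Ts Ti) (subst nn_integral_sphere_measure, auto simp: Ts)
  also have "(\<integral>\<^sup>+x. k (T x /\<^sub>R norm (T x)) * indicator (ball 0 1 - {0}) (T x) \<partial>lborel) =
      (\<integral>\<^sup>+x. k (x /\<^sub>R norm x) * indicator (ball 0 1 - {0}) x \<partial>lborel)"
    by (rule nn_integral_lborel_orthogonal[OF T], rule borel_measurable_times_ennreal[OF _ borel_measurable_indicator[OF meas]]) measurable
  finally show ?thesis by (simp add: nn_integral_sphere_measure)
qed

lemma sphere_borel_measurable:
  fixes f :: "real ^ 'n \<Rightarrow> 'b::topological_space"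
  assumes "f \<in> borel_measurable borel"
  shows "f \<in> borel_measurable sphere_measure"
  using measurable_restrict_space1[OF assms, of "sphere 0 1"]
  by (simp cong: measurable_cong_sets add: sets_sphere_measure)

lemma sphere_second_moment_unit:
  fixes \<omega> :: "real ^ 'n"
  assumes "norm \<omega> = 1"
  shows "(\<integral>\<^sup>+\<sigma>. ennreal ((\<omega> \<bullet> \<sigma>)\<^sup>2) \<partial>sphere_measure) = ennreal (2 * Q_const \<omega>)"
    and "Q_const \<omega> \<ge> 0"
proof -
  interpret S: finite_measure "sphere_measure :: (real ^ 'n) measure" by (rule finite_sphere_measure)
  have m: "(\<lambda>\<sigma>. (\<omega> \<bullet> \<sigma>)\<^sup>2) \<in> borel_measurable sphere_measure"
    by (rule sphere_borel_measurable) measurable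
  have "integrable sphere_measure (\<lambda>\<sigma>. (\<omega> \<bullet> \<sigma>)\<^sup>2)"
  proof (rule S.integrable_const_bound[of _ 1])
    show "AE \<sigma> in sphere_measure. norm ((\<omega> \<bullet> \<sigma>)\<^sup>2) \<le> 1"
    proof (rule AE_I2)
      fix \<sigma> :: "real ^ 'n" assume "\<sigma> \<in> space sphere_measure"
      then have "\<bar>\<omega> \<bullet> \<sigma>\<bar> \<le> 1"
        using Cauchy_Schwarz_ineq2[of \<omega> \<sigma>] assms by (simp add: space_sphere_measure)
      then show "norm ((\<omega> \<bullet> \<sigma>)\<^sup>2) \<le> 1" by (simp add: abs_square_le_1)
    qed
  qed (rule m)
  then show "(\<integral>\<^sup>+\<sigma>. ennreal ((\<omega> \<bullet> \<sigma>)\<^sup>2) \<partial>sphere_measure) = ennreal (2 * Q_const \<omega>)"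
    by (subst nn_integral_eq_integral) (auto simp: Q_const_def)
  show "Q_const \<omega> \<ge> 0" by (simp add: Q_const_def)
qed

text \<open>An orthogonal map taking \<open>v / |v|\<close> to \<open>\<omega>\<close> reduces every direction to \<open>\<omega>\<close>. In particular \<open>Q_const\<close>
  is the same for all unit vectors.\<close>

lemma sphere_second_moment:
  fixes \<omega> v :: "real ^ 'n"
  assumes \<omega>: "norm \<omega> = 1"
  shows "(\<integral>\<^sup>+\<sigma>. ennreal ((v \<bullet> \<sigma>)\<^sup>2) \<partial>sphere_measure) = ennreal (2 * Q_const \<omega> * (norm v)\<^sup>2)"
proof (cases "v = 0")
  case False
  define a where "a = v /\<^sub>R norm v"
  have "norm a = 1" using False by (simp add: a_def)
  then obtain T where T: "orthogonal_transformation T" "T a = \<omega>"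
    using orthogonal_transformation_exists_1[of a \<omega>] \<omega> by metis
  have "(v \<bullet> \<sigma>)\<^sup>2 = (norm v)\<^sup>2 * (\<omega> \<bullet> T \<sigma>)\<^sup>2" for \<sigma>
  proof -
    have "v \<bullet> \<sigma> = norm v * (a \<bullet> \<sigma>)" using False by (simp add: a_def)
    also have "a \<bullet> \<sigma> = \<omega> \<bullet> T \<sigma>" using T by (metis orthogonal_transformation_def)
    finally show ?thesis by (simp add: power_mult_distrib)
  qed
  then have "(\<integral>\<^sup>+\<sigma>. ennreal ((v \<bullet> \<sigma>)\<^sup>2) \<partial>sphere_measure) =
      (\<integral>\<^sup>+\<sigma>. ennreal ((norm v)\<^sup>2) * ennreal ((\<omega> \<bullet> T \<sigma>)\<^sup>2) \<partial>sphere_measure)"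
    by (simp add: ennreal_mult)
  also have "\<dots> = ennreal ((norm v)\<^sup>2) * (\<integral>\<^sup>+\<sigma>. ennreal ((\<omega> \<bullet> T \<sigma>)\<^sup>2) \<partial>sphere_measure)"
  proof (rule nn_integral_cmult, rule sphere_borel_measurable)
    note [measurable] = orthogonal_transformation_borel_measurable[OF T(1)]
    show "(\<lambda>\<sigma>. ennreal ((\<omega> \<bullet> T \<sigma>)\<^sup>2)) \<in> borel_measurable borel" by measurable
  qed
  also have "(\<integral>\<^sup>+\<sigma>. ennreal ((\<omega> \<bullet> T \<sigma>)\<^sup>2) \<partial>sphere_measure) = ennreal (2 * Q_const \<omega>)"
    using sphere_measure_orthogonal[OF T(1), of "\<lambda>\<sigma>. ennreal ((\<omega> \<bullet> \<sigma>)\<^sup>2)"] sphere_second_moment_unit[OF \<omega>] by simp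
  finally show ?thesis
    using sphere_second_moment_unit(2)[OF \<omega>] by (simp add: ennreal_mult[symmetric] mult.commute)
qed simp

text \<open>The real and the imaginary part of \<open>m\<close> contribute separately, so the real case suffices.\<close>

lemma sphere_second_moment_complex:
  fixes \<omega> :: "real ^ 'n" and m :: "complex ^ 'n"
  assumes \<omega>: "norm \<omega> = 1"
  shows "(\<integral>\<^sup>+\<sigma>. ennreal ((cmod (real_dot \<sigma> m))\<^sup>2) \<partial>sphere_measure) = ennreal (2 * Q_const \<omega> * (norm m)\<^sup>2)"
proof -
  have m: "(\<lambda>\<sigma>. ennreal ((v \<bullet> \<sigma>)\<^sup>2)) \<in> borel_measurable sphere_measure" for v :: "real ^ 'n"
    by (rule sphere_borel_measurable) measurable
  have "(\<integral>\<^sup>+\<sigma>. ennreal ((cmod (real_dot \<sigma> m))\<^sup>2) \<partial>sphere_measure) =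
     (\<integral>\<^sup>+\<sigma>. ennreal ((Re_vec m \<bullet> \<sigma>)\<^sup>2) + ennreal ((Im_vec m \<bullet> \<sigma>)\<^sup>2) \<partial>sphere_measure)"
    by (simp add: cmod_real_dot_sq inner_commute)
  also have "\<dots> = ennreal (2 * Q_const \<omega> * (norm (Re_vec m))\<^sup>2) + ennreal (2 * Q_const \<omega> * (norm (Im_vec m))\<^sup>2)"
    by (subst nn_integral_add) (simp_all add: m sphere_second_moment[OF \<omega>])
  also have "\<dots> = ennreal (2 * Q_const \<omega> * (norm m)\<^sup>2)"
    using sphere_second_moment_unit(2)[OF \<omega>]
    by (subst ennreal_plus[symmetric]) (auto simp: norm_complex_vec_sq[of m] distrib_left)
  finally show ?thesis .
qed

section \<open>Quadratic bounds for the magnetic increment\<close>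

text \<open>Cauchy-Schwarz on an interval of length 1, stated for a majorant \<open>k\<close> of the squared integrand because
  the right-hand side may then be infinite.\<close>

lemma norm_unit_interval_integral_sq_le:
  fixes f :: "real \<Rightarrow> 'b::{banach, second_countable_topology}"
  assumes f: "integrable lborel (\<lambda>t. indicator {0..1} t *\<^sub>R f t)"
    and k: "\<And>t. t \<in> {0..1} \<Longrightarrow> (norm (f t))\<^sup>2 \<le> k t"
  shows "ennreal ((norm (LINT t|lborel. indicator {0..1} t *\<^sub>R f t))\<^sup>2) \<le> (\<integral>\<^sup>+t. ennreal (k t) * indicator {0..1} t \<partial>lborel)"
proof -
  let ?h = "\<lambda>t. indicator {0..1} t *\<^sub>R f t"
  have [measurable]: "?h \<in> borel_measurable lborel" using f by (rule borel_measurable_integrable)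
  have "ennreal (norm (LINT t|lborel. ?h t)) \<le> (\<integral>\<^sup>+t. ennreal (norm (?h t)) \<partial>lborel)"
    by (rule integral_norm_bound_ennreal[OF f])
  also have "\<dots> = (\<integral>\<^sup>+t. ennreal (norm (?h t)) * indicator {0..1} t \<partial>lborel)"
    by (intro nn_integral_cong) (auto simp: indicator_def)
  finally have "(ennreal (norm (LINT t|lborel. ?h t)))\<^sup>2 \<le> (\<integral>\<^sup>+t. ennreal (norm (?h t)) * indicator {0..1} t \<partial>lborel)\<^sup>2"
    by (rule power_mono) simp
  also have "\<dots> \<le> (\<integral>\<^sup>+t. (ennreal (norm (?h t)))\<^sup>2 \<partial>lborel) * (\<integral>\<^sup>+t. (indicator {0..1::real} t)\<^sup>2 \<partial>lborel)"
    by (rule Cauchy_Schwarz_nn_integral) measurable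
  also have "(\<integral>\<^sup>+t. (indicator {0..1::real} t)\<^sup>2 \<partial>lborel) = (\<integral>\<^sup>+t. indicator {0..1::real} t \<partial>lborel)"
    by (intro nn_integral_cong) (auto simp: indicator_def)
  also have "\<dots> = 1" by simp
  also have "(\<integral>\<^sup>+t. (ennreal (norm (?h t)))\<^sup>2 \<partial>lborel) * 1 \<le> (\<integral>\<^sup>+t. ennreal (k t) * indicator {0..1} t \<partial>lborel)"
  proof -
    have "(ennreal (norm (?h t)))\<^sup>2 \<le> ennreal (k t) * indicator {0..1} t" for t
      using k[of t] by (auto simp: indicator_def ennreal_power intro!: ennreal_leI)
    then show ?thesis by (simp add: nn_integral_mono)
  qed
  finally show ?thesis by (simp add: ennreal_power)
qed

lemma square_sum2_le:
  fixes a b \<eta> :: real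
  assumes "\<eta> > 0"
  shows "(a + b)\<^sup>2 \<le> (1 + \<eta>) * a\<^sup>2 + (1 + 1 / \<eta>) * b\<^sup>2"
proof -
  have "0 \<le> (\<eta> * a - b)\<^sup>2 / \<eta>" using assms by simp
  also have "\<dots> = (1 + \<eta>) * a\<^sup>2 + (1 + 1 / \<eta>) * b\<^sup>2 - (a + b)\<^sup>2"
    using assms by (simp add: power2_eq_square field_simps)
  finally show ?thesis by simp
qed

lemma square_sum3_le:
  fixes a b c :: real
  shows "(a + b + c)\<^sup>2 \<le> 3 * a\<^sup>2 + 3 * b\<^sup>2 + 3 * c\<^sup>2"
proof -
  have "0 \<le> (a - b)\<^sup>2 + (b - c)\<^sup>2 + (a - c)\<^sup>2" by simp
  also have "\<dots> = 3 * a\<^sup>2 + 3 * b\<^sup>2 + 3 * c\<^sup>2 - (a + b + c)\<^sup>2"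
    by (simp add: power2_eq_square algebra_simps)
  finally show ?thesis by simp
qed

lemma cmod_exp_minus_1_le: "cmod (exp (- \<i> * of_real a) - 1) \<le> \<bar>a\<bar>"
proof -
  have "cmod (exp (\<i> * of_real (- a)) - 1) = 2 * \<bar>sin (- a / 2)\<bar>"
    by (rule dist_exp_i_1)
  also have "\<dots> \<le> \<bar>a\<bar>"
    using abs_sin_x_le_abs_x[of "- a / 2"] by simp
  finally show ?thesis by simp
qed

text \<open>The midpoint is at distance at most \<open>|z| / 2\<close> from every point of the segment.\<close>

lemma magnetic_increment_error_le:
  assumes lip: "L-lipschitz_on UNIV A" and t: "t \<in> {0..1}"
  shows "cmod (\<i> * of_real (z \<bullet> (A (x + t *\<^sub>R z) - A (x + (1 / 2) *\<^sub>R z))) * c) \<le> L / 2 * (norm z)\<^sup>2 * cmod c"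
proof -
  have L: "L \<ge> 0" using lip by (rule lipschitz_on_nonneg)
  have "norm (A (x + t *\<^sub>R z) - A (x + (1 / 2) *\<^sub>R z)) \<le> L * norm ((x + t *\<^sub>R z) - (x + (1 / 2) *\<^sub>R z))"
    using lipschitz_onD[OF lip, of "x + t *\<^sub>R z" "x + (1 / 2) *\<^sub>R z"] by (simp add: dist_norm)
  also have "(x + t *\<^sub>R z) - (x + (1 / 2) *\<^sub>R z) = (t - 1 / 2) *\<^sub>R z" by (simp add: algebra_simps)
  also have "L * norm ((t - 1 / 2) *\<^sub>R z) \<le> L * (1 / 2 * norm z)"
    unfolding norm_scaleR real_norm_def using t L by (intro mult_left_mono mult_right_mono) (auto simp: abs_if)
  finally have A: "norm (A (x + t *\<^sub>R z) - A (x + (1 / 2) *\<^sub>R z)) \<le> L / 2 * norm z" by simp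
  have "\<bar>z \<bullet> (A (x + t *\<^sub>R z) - A (x + (1 / 2) *\<^sub>R z))\<bar> \<le> norm z * norm (A (x + t *\<^sub>R z) - A (x + (1 / 2) *\<^sub>R z))"
    by (rule Cauchy_Schwarz_ineq2)
  also have "\<dots> \<le> norm z * (L / 2 * norm z)" by (intro mult_left_mono A) simp
  finally have "\<bar>z \<bullet> (A (x + t *\<^sub>R z) - A (x + (1 / 2) *\<^sub>R z))\<bar> * cmod c \<le> norm z * (L / 2 * norm z) * cmod c"
    by (rule mult_right_mono) simp
  then show ?thesis
    by (simp add: norm_mult power2_eq_square mult_ac)
qed

lemma magnetic_increment_sq_le:
  assumes lip: "L-lipschitz_on UNIV A" and t: "t \<in> {0..1}" and \<eta>: "\<eta> > 0"
  shows "(cmod (magnetic_increment A u M x z t))\<^sup>2 \<le>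
    (1 + \<eta>) * (cmod (real_dot z (M (x + t *\<^sub>R z))))\<^sup>2 + (1 + 1 / \<eta>) * (L\<^sup>2 / 4 * (norm z) ^ 4 * (cmod (u (x + t *\<^sub>R z)))\<^sup>2)"
proof -
  let ?e = "exp (- \<i> * of_real t * of_real (z \<bullet> A (x + (1 / 2) *\<^sub>R z)))"
  let ?a = "real_dot z (M (x + t *\<^sub>R z))"
  let ?b = "\<i> * of_real (z \<bullet> (A (x + t *\<^sub>R z) - A (x + (1 / 2) *\<^sub>R z))) * u (x + t *\<^sub>R z)"
  have e: "cmod ?e = 1"
  proof -
    have "?e = exp (\<i> * of_real (- t * (z \<bullet> A (x + (1 / 2) *\<^sub>R z))))" by (simp add: mult_ac)
    then show ?thesis by (simp only: norm_exp_i_times)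
  qed
  have "cmod (magnetic_increment A u M x z t) = cmod (?a + ?b)"
    unfolding magnetic_increment_def norm_mult e by simp
  also have "\<dots> \<le> cmod ?a + L / 2 * (norm z)\<^sup>2 * cmod (u (x + t *\<^sub>R z))"
    by (rule order_trans[OF norm_triangle_ineq add_left_mono[OF magnetic_increment_error_le[OF lip t]]])
  finally have "(cmod (magnetic_increment A u M x z t))\<^sup>2 \<le> (cmod ?a + L / 2 * (norm z)\<^sup>2 * cmod (u (x + t *\<^sub>R z)))\<^sup>2"
    by (rule power_mono) simp
  also have "\<dots> \<le> (1 + \<eta>) * (cmod ?a)\<^sup>2 + (1 + 1 / \<eta>) * (L / 2 * (norm z)\<^sup>2 * cmod (u (x + t *\<^sub>R z)))\<^sup>2"
    by (rule square_sum2_le[OF \<eta>])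
  also have "(L / 2 * (norm z)\<^sup>2 * cmod (u (x + t *\<^sub>R z)))\<^sup>2 = L\<^sup>2 / 4 * (norm z) ^ 4 * (cmod (u (x + t *\<^sub>R z)))\<^sup>2"
    by (simp add: power_mult_distrib power_divide power_mult[symmetric])
  finally show ?thesis .
qed

text \<open>There are three errors: the oscillation of \<open>M\<close> along the segment, the factor \<open>exp(-it\<alpha>) - 1\<close> of order
  \<open>|z|\<close>, and the Lipschitz error in \<open>A\<close>. Only the first is not small by virtue of \<open>|z|\<close> alone, which is
  why it stands apart from the inner factor \<open>|z|\<^sup>2\<close>.\<close>

lemma magnetic_increment_minus_linear_sq_le:
  assumes lip: "L-lipschitz_on UNIV A" and t: "t \<in> {0..1}" and z: "norm z \<le> 1"
  shows "(cmod (magnetic_increment A u M x z t - real_dot z (M x)))\<^sup>2 \<le>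
    (norm z)\<^sup>2 * (3 * (norm (M (x + t *\<^sub>R z) - M x))\<^sup>2
      + (norm z)\<^sup>2 * (3 * ((norm (A x) + L) * norm (M x))\<^sup>2 + L\<^sup>2 * (cmod (u (x + t *\<^sub>R z)))\<^sup>2))"
proof -
  let ?\<alpha> = "z \<bullet> A (x + (1 / 2) *\<^sub>R z)"
  let ?e = "exp (- \<i> * of_real t * of_real ?\<alpha>)"
  let ?b = "\<i> * of_real (z \<bullet> (A (x + t *\<^sub>R z) - A (x + (1 / 2) *\<^sub>R z))) * u (x + t *\<^sub>R z)"
  have L: "L \<ge> 0" using lip by (rule lipschitz_on_nonneg)
  have e': "?e = exp (- \<i> * of_real (t * ?\<alpha>))" by (simp add: mult_ac)
  have e: "cmod ?e = 1"
  proof -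
    have "?e = exp (\<i> * of_real (- t * ?\<alpha>))" by (simp add: mult_ac)
    then show ?thesis by (simp only: norm_exp_i_times)
  qed
  have split: "magnetic_increment A u M x z t - real_dot z (M x) =
      ?e * real_dot z (M (x + t *\<^sub>R z) - M x) + (?e - 1) * real_dot z (M x) + ?e * ?b"
    by (simp add: magnetic_increment_def real_dot_diff algebra_simps)
  have a1: "cmod (?e * real_dot z (M (x + t *\<^sub>R z) - M x)) \<le> norm z * norm (M (x + t *\<^sub>R z) - M x)"
    unfolding norm_mult e using cmod_real_dot_le by simp
  have "\<bar>t * ?\<alpha>\<bar> \<le> norm z * (norm (A x) + L)"
  proof -
    have "norm (A (x + (1 / 2) *\<^sub>R z) - A x) \<le> L * norm ((1 / 2) *\<^sub>R z)"
      using lipschitz_onD[OF lip, of "x + (1 / 2) *\<^sub>R z" x] by (simp add: dist_norm)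
    also have "\<dots> \<le> L * 1" using z L by (intro mult_left_mono) auto
    finally have "norm (A (x + (1 / 2) *\<^sub>R z)) \<le> norm (A x) + L"
      using norm_triangle_sub[of "A (x + (1 / 2) *\<^sub>R z)" "A x"] by simp
    then have "\<bar>?\<alpha>\<bar> \<le> norm z * (norm (A x) + L)"
      using Cauchy_Schwarz_ineq2[of z "A (x + (1 / 2) *\<^sub>R z)"]
      by (meson mult_left_mono norm_ge_zero order_trans)
    moreover have "\<bar>t * ?\<alpha>\<bar> \<le> 1 * \<bar>?\<alpha>\<bar>"
      unfolding abs_mult using t by (intro mult_right_mono) auto
    ultimately show ?thesis by simp
  qed
  then have "cmod (?e - 1) \<le> norm z * (norm (A x) + L)"
    using cmod_exp_minus_1_le[of "t * ?\<alpha>"] unfolding e' by (rule order_trans[rotated])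
  then have "cmod ((?e - 1) * real_dot z (M x)) \<le> (norm z * (norm (A x) + L)) * (norm z * norm (M x))"
    unfolding norm_mult using cmod_real_dot_le[of z "M x"] L
    by (intro mult_mono) auto
  then have a2: "cmod ((?e - 1) * real_dot z (M x)) \<le> (norm z)\<^sup>2 * ((norm (A x) + L) * norm (M x))"
    by (simp add: power2_eq_square mult_ac)
  have a3: "cmod (?e * ?b) \<le> L / 2 * (norm z)\<^sup>2 * cmod (u (x + t *\<^sub>R z))"
    unfolding norm_mult[of ?e] e using magnetic_increment_error_le[OF lip t] by simp
  have "cmod (magnetic_increment A u M x z t - real_dot z (M x)) \<le>
     norm z * norm (M (x + t *\<^sub>R z) - M x) + (norm z)\<^sup>2 * ((norm (A x) + L) * norm (M x)) + L / 2 * (norm z)\<^sup>2 * cmod (u (x + t *\<^sub>R z))"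
    unfolding split by (intro order_trans[OF norm_triangle_ineq] add_mono a1 a2 a3)
  then have "(cmod (magnetic_increment A u M x z t - real_dot z (M x)))\<^sup>2 \<le>
     (norm z * norm (M (x + t *\<^sub>R z) - M x) + (norm z)\<^sup>2 * ((norm (A x) + L) * norm (M x)) + L / 2 * (norm z)\<^sup>2 * cmod (u (x + t *\<^sub>R z)))\<^sup>2"
    by (rule power_mono) simp
  also have "\<dots> \<le> 3 * (norm z * norm (M (x + t *\<^sub>R z) - M x))\<^sup>2 + 3 * ((norm z)\<^sup>2 * ((norm (A x) + L) * norm (M x)))\<^sup>2
      + 3 * (L / 2 * (norm z)\<^sup>2 * cmod (u (x + t *\<^sub>R z)))\<^sup>2"
    by (rule square_sum3_le)
  also have "\<dots> \<le> 3 * (norm z * norm (M (x + t *\<^sub>R z) - M x))\<^sup>2 + 3 * ((norm z)\<^sup>2 * ((norm (A x) + L) * norm (M x)))\<^sup>2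
      + (L * (norm z)\<^sup>2 * cmod (u (x + t *\<^sub>R z)))\<^sup>2"
    by (simp add: power_mult_distrib power_divide)
  also have "\<dots> = (norm z)\<^sup>2 * (3 * (norm (M (x + t *\<^sub>R z) - M x))\<^sup>2
      + (norm z)\<^sup>2 * (3 * ((norm (A x) + L) * norm (M x))\<^sup>2 + L\<^sup>2 * (cmod (u (x + t *\<^sub>R z)))\<^sup>2))"
    by (simp add: power2_eq_square algebra_simps)
  finally show ?thesis .
qed

section \<open>Averages along radial segments\<close>

lemma dyadic_cover:
  fixes r s :: real
  assumes "0 < s" "s \<le> r"
  obtains k :: nat where "r / 2 ^ Suc k < s" "s \<le> r / 2 ^ k"
proof -
  have "\<exists>n. r / 2 ^ n < s"
  proof -
    obtain n where "(1 / 2) ^ n < s / r"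
      using real_arch_pow_inv[of "s / r" "1 / 2"] assms by auto
    then show ?thesis using assms by (auto simp: field_simps power_divide)
  qed
  define n where "n = (LEAST n. r / 2 ^ n < s)"
  have n: "r / 2 ^ n < s" unfolding n_def using \<open>\<exists>n. r / 2 ^ n < s\<close> by (rule LeastI_ex)
  have "n \<noteq> 0" using n assms by (cases n) auto
  then obtain k where k: "n = Suc k" by (cases n) auto
  have "\<not> r / 2 ^ k < s"
    using not_less_Least[of k "\<lambda>n. r / 2 ^ n < s"] k unfolding n_def by simp
  then show ?thesis using that n k by simp
qed

text \<open>The bound on balls controls the integral with weight \<open>s^(N - 1)\<close>. On each dyadic shell this weight is
  comparable to a constant and can be divided out; the resulting bounds form a geometric series.\<close>

lemma sphere_integral_mass_le:
  fixes h :: "real ^ 'n \<Rightarrow> ennreal"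
  assumes h[measurable]: "h \<in> borel_measurable borel" and C: "C \<ge> 0" and r: "0 < r"
    and bound: "\<And>s. 0 < s \<Longrightarrow> s \<le> r \<Longrightarrow> (\<integral>\<^sup>+z. h z * indicator (cball 0 s) z \<partial>lborel) \<le> ennreal (C * s ^ CARD('n))"
  shows "(\<integral>\<^sup>+s. (\<integral>\<^sup>+\<sigma>. h (s *\<^sub>R \<sigma>) \<partial>sphere_measure) * indicator {0<..r} s \<partial>lborel) \<le> ennreal (2 ^ CARD('n) * C * r)"
proof -
  let ?N = "CARD('n)"
  define g where "g s = (\<integral>\<^sup>+\<sigma>. h (s *\<^sub>R \<sigma>) \<partial>sphere_measure)" for s
  have [measurable]: "g \<in> borel_measurable borel"
    unfolding g_def by measurable
  have shell: "(\<integral>\<^sup>+s. g s * indicator {r / 2 ^ Suc k<..r / 2 ^ k} s \<partial>lborel) \<le> ennreal (C * 2 ^ (?N - 1) * r * (1 / 2) ^ k)" for k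
  proof -
    define \<rho> where "\<rho> = r / 2 ^ k"
    have \<rho>: "0 < \<rho>" "\<rho> \<le> r" "r / 2 ^ Suc k = \<rho> / 2"
      using r by (auto simp: \<rho>_def field_simps)
    have "(\<integral>\<^sup>+s. g s * indicator {\<rho> / 2<..\<rho>} s \<partial>lborel) \<le>
        (\<integral>\<^sup>+s. ennreal (1 / (\<rho> / 2) ^ (?N - 1)) * (ennreal (indicator {0<..} s * s ^ (?N - 1)) * (indicator {..\<rho>} s * g s)) \<partial>lborel)"
    proof (rule nn_integral_mono)
      fix s :: real
      show "g s * indicator {\<rho> / 2<..\<rho>} s \<le>
        ennreal (1 / (\<rho> / 2) ^ (?N - 1)) * (ennreal (indicator {0<..} s * s ^ (?N - 1)) * (indicator {..\<rho>} s * g s))"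
      proof (cases "s \<in> {\<rho> / 2<..\<rho>}")
        case True
        then have s: "s > 0" "s > \<rho> / 2" "s \<le> \<rho>" using \<rho> by auto
        have "(\<rho> / 2) ^ (?N - 1) \<le> s ^ (?N - 1)" using s \<rho> by (intro power_mono) auto
        then have "1 \<le> 1 / (\<rho> / 2) ^ (?N - 1) * s ^ (?N - 1)"
          using \<rho> by (simp add: field_simps)
        then have "1 \<le> ennreal (1 / (\<rho> / 2) ^ (?N - 1)) * ennreal (s ^ (?N - 1))"
          using s \<rho> ennreal_leI[of 1] by (simp add: ennreal_mult[symmetric])
        then have "1 * g s \<le> ennreal (1 / (\<rho> / 2) ^ (?N - 1)) * ennreal (s ^ (?N - 1)) * g s"
          by (rule mult_right_mono) simp
        then show ?thesis using s by (simp add: mult.assoc)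
      qed simp
    qed
    also have "\<dots> = ennreal (1 / (\<rho> / 2) ^ (?N - 1)) * (\<integral>\<^sup>+s. ennreal (indicator {0<..} s * s ^ (?N - 1)) * (indicator {..\<rho>} s * g s) \<partial>lborel)"
      by (rule nn_integral_cmult) measurable
    also have "(\<integral>\<^sup>+s. ennreal (indicator {0<..} s * s ^ (?N - 1)) * (indicator {..\<rho>} s * g s) \<partial>lborel)
        = (\<integral>\<^sup>+s. indicator {..\<rho>} s * g s \<partial>radial_measure ?N)"
      unfolding radial_measure_def by (rule nn_integral_density[symmetric]) auto
    also have "\<dots> = (\<integral>\<^sup>+z. indicator {..\<rho>} (norm z) * h z \<partial>lborel)"
      unfolding g_def by (rule nn_integral_radial_weight[symmetric]) auto
    also have "\<dots> = (\<integral>\<^sup>+z. h z * indicator (cball 0 \<rho>) z \<partial>lborel)"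
      by (intro nn_integral_cong) (auto simp: indicator_def)
    also have "ennreal (1 / (\<rho> / 2) ^ (?N - 1)) * \<dots> \<le> ennreal (1 / (\<rho> / 2) ^ (?N - 1)) * ennreal (C * \<rho> ^ ?N)"
      by (intro mult_left_mono bound \<rho>) simp
    also have "\<dots> = ennreal (C * 2 ^ (?N - 1) * \<rho>)"
    proof -
      have "1 / (\<rho> / 2) ^ (?N - 1) * (C * \<rho> ^ ?N) = C * 2 ^ (?N - 1) * \<rho>"
        using \<rho>(1) by (cases ?N) (auto simp: power_divide)
      then show ?thesis using \<rho> C by (simp add: ennreal_mult[symmetric])
    qed
    finally show ?thesis unfolding \<rho>(3)[symmetric] by (simp add: \<rho>_def power_divide)
  qed
  have "(\<integral>\<^sup>+s. g s * indicator {0<..r} s \<partial>lborel) \<le> (\<integral>\<^sup>+s. (\<Sum>k. g s * indicator {r / 2 ^ Suc k<..r / 2 ^ k} s) \<partial>lborel)"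
  proof (rule nn_integral_mono)
    fix s :: real
    show "g s * indicator {0<..r} s \<le> (\<Sum>k. g s * indicator {r / 2 ^ Suc k<..r / 2 ^ k} s)"
    proof (cases "s \<in> {0<..r}")
      case True
      then obtain k where k: "r / 2 ^ Suc k < s" "s \<le> r / 2 ^ k" using dyadic_cover[of s r] by auto
      have "g s * indicator {0<..r} s = (\<Sum>k\<in>{k}. g s * indicator {r / 2 ^ Suc k<..r / 2 ^ k} s)"
        using True k by simp
      also have "\<dots> \<le> (\<Sum>k. g s * indicator {r / 2 ^ Suc k<..r / 2 ^ k} s)"
        by (rule sum_le_suminf) auto
      finally show ?thesis .
    qed simp
  qed
  also have "\<dots> = (\<Sum>k. \<integral>\<^sup>+s. g s * indicator {r / 2 ^ Suc k<..r / 2 ^ k} s \<partial>lborel)"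
    by (rule nn_integral_suminf) measurable
  also have "\<dots> \<le> (\<Sum>k. ennreal (C * 2 ^ (?N - 1) * r * (1 / 2) ^ k))"
    by (intro suminf_le shell) auto
  also have "\<dots> = ennreal (\<Sum>k. C * 2 ^ (?N - 1) * r * (1 / 2) ^ k)"
    using C r by (intro suminf_ennreal2) (auto intro!: summable_mult summable_geometric)
  also have "(\<Sum>k. C * 2 ^ (?N - 1) * r * (1 / 2 :: real) ^ k) = C * 2 ^ (?N - 1) * r * 2"
    by (subst suminf_mult) (auto simp: suminf_geometric)
  also have "\<dots> = 2 ^ ?N * C * r" by (cases ?N) auto
  finally show ?thesis by (simp add: g_def)
qed

text \<open>On the ray through \<open>\<sigma>\<close> the average over \<open>t\<close> of \<open>h (t r \<sigma>)\<close> is \<open>1 / r\<close> times the integral over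
  \<open>(0, r)\<close>. By the preceding lemma its integral over \<open>\<sigma>\<close> is at most \<open>2\<^sup>N C\<close> for every \<open>r \<le> R\<close>, so the
  weight enters through its mass only.\<close>

lemma radial_segment_average_le:
  fixes h :: "real ^ 'n \<Rightarrow> ennreal"
  assumes h[measurable]: "h \<in> borel_measurable borel" and w[measurable]: "w \<in> borel_measurable borel" and C: "C \<ge> 0"
    and bound: "\<And>s. 0 < s \<Longrightarrow> s \<le> R \<Longrightarrow> (\<integral>\<^sup>+z. h z * indicator (cball 0 s) z \<partial>lborel) \<le> ennreal (C * s ^ CARD('n))"
  shows "(\<integral>\<^sup>+z. (w (norm z) * indicator {..R} (norm z)) * (\<integral>\<^sup>+t. h (t *\<^sub>R z) * indicator {0..1} t \<partial>lborel) \<partial>lborel)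
     \<le> ennreal (2 ^ CARD('n) * C) * (\<integral>\<^sup>+r. w r * indicator {..R} r \<partial>radial_measure CARD('n))"
proof -
  let ?N = "CARD('n)"
  interpret S: finite_measure "sphere_measure :: (real ^ 'n) measure" by (rule finite_sphere_measure)
  interpret SL: pair_sigma_finite "sphere_measure :: (real ^ 'n) measure" "lborel :: real measure"
    by unfold_locales
  have "(\<integral>\<^sup>+z. (w (norm z) * indicator {..R} (norm z)) * (\<integral>\<^sup>+t. h (t *\<^sub>R z) * indicator {0..1} t \<partial>lborel) \<partial>lborel)
    = (\<integral>\<^sup>+r. (w r * indicator {..R} r) * (\<integral>\<^sup>+\<sigma>. (\<integral>\<^sup>+t. h (t *\<^sub>R (r *\<^sub>R \<sigma>)) * indicator {0..1} t \<partial>lborel) \<partial>sphere_measure) \<partial>radial_measure ?N)"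
    by (rule nn_integral_radial_weight) measurable
  also have "\<dots> \<le> (\<integral>\<^sup>+r. (w r * indicator {..R} r) * ennreal (2 ^ ?N * C) \<partial>radial_measure ?N)"
  proof (rule nn_integral_mono_AE)
    show "AE r in radial_measure ?N. (w r * indicator {..R} r) * (\<integral>\<^sup>+\<sigma>. (\<integral>\<^sup>+t. h (t *\<^sub>R (r *\<^sub>R \<sigma>)) * indicator {0..1} t \<partial>lborel) \<partial>sphere_measure)
       \<le> (w r * indicator {..R} r) * ennreal (2 ^ ?N * C)"
      using AE_radial_measure_pos
    proof eventually_elim
      case (elim r)
      have "(\<integral>\<^sup>+\<sigma>. (\<integral>\<^sup>+t. h (t *\<^sub>R (r *\<^sub>R \<sigma>)) * indicator {0..1} t \<partial>lborel) \<partial>sphere_measure) \<le> ennreal (2 ^ ?N * C)" if R: "r \<le> R"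
      proof -
        define g where "g s = (\<integral>\<^sup>+\<sigma>. h (s *\<^sub>R \<sigma>) \<partial>sphere_measure)" for s
        have [measurable]: "g \<in> borel_measurable borel" unfolding g_def by measurable
        have [measurable]: "fst \<in> sphere_measure \<Otimes>\<^sub>M (lborel :: real measure) \<rightarrow>\<^sub>M (borel :: (real^'n) measure)"
          by (rule measurable_compose[OF measurable_fst sphere_borel_measurable[of "\<lambda>x. x"]]) simp
        have hs: "(\<lambda>\<sigma>. h (s *\<^sub>R \<sigma>)) \<in> borel_measurable sphere_measure" for s
          by (rule sphere_borel_measurable) measurable
        have "(\<integral>\<^sup>+\<sigma>. (\<integral>\<^sup>+t. h (t *\<^sub>R (r *\<^sub>R \<sigma>)) * indicator {0..1} t \<partial>lborel) \<partial>sphere_measure)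
          = (\<integral>\<^sup>+t. (\<integral>\<^sup>+\<sigma>. h (t *\<^sub>R (r *\<^sub>R \<sigma>)) * indicator {0..1} t \<partial>sphere_measure) \<partial>lborel)"
          by (rule SL.Fubini'[symmetric]) measurable
        also have "\<dots> = (\<integral>\<^sup>+t. g (0 + r * t) * indicator {0..r} (0 + r * t) \<partial>lborel)"
        proof (rule nn_integral_cong)
          fix t :: real
          have "(indicator {0..1} t :: ennreal) = indicator {0..r} (0 + r * t)"
            using elim by (auto simp: indicator_def zero_le_mult_iff mult_le_cancel_left1)
          then show "(\<integral>\<^sup>+\<sigma>. h (t *\<^sub>R (r *\<^sub>R \<sigma>)) * indicator {0..1} t \<partial>sphere_measure) = g (0 + r * t) * indicator {0..r} (0 + r * t)"
            unfolding g_def using hs[of "r * t"] by (simp add: nn_integral_multc mult.commute[of t])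
        qed
        finally have "ennreal r * (\<integral>\<^sup>+\<sigma>. (\<integral>\<^sup>+t. h (t *\<^sub>R (r *\<^sub>R \<sigma>)) * indicator {0..1} t \<partial>lborel) \<partial>sphere_measure)
           = (\<integral>\<^sup>+s. g s * indicator {0..r} s \<partial>lborel)"
          using nn_integral_real_affine[of "\<lambda>s. g s * indicator {0..r} s" r 0] elim by simp
        also have "\<dots> = (\<integral>\<^sup>+s. g s * indicator {0<..r} s \<partial>lborel)"
        proof (rule nn_integral_cong_AE)
          show "AE s in lborel. g s * indicator {0..r} s = g s * indicator {0<..r} s"
            using AE_lborel_singleton[of 0] by eventually_elim (auto simp: indicator_def)
        qed
        also have "\<dots> \<le> ennreal (2 ^ ?N * C * r)"
          unfolding g_def by (rule sphere_integral_mass_le[OF h C elim]) (use R bound in auto)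
        also have "\<dots> = ennreal r * ennreal (2 ^ ?N * C)"
          using C elim by (simp add: ennreal_mult[symmetric] mult.commute)
        finally show ?thesis
          using elim by (simp add: ennreal_mult_le_mult_iff)
      qed
      then show ?case by (cases "r \<le> R") (auto intro!: mult_left_mono)
    qed
  qed
  also have "\<dots> = ennreal (2 ^ ?N * C) * (\<integral>\<^sup>+r. w r * indicator {..R} r \<partial>radial_measure ?N)"
    by (subst nn_integral_multc) (auto simp: mult.commute)
  finally show ?thesis .
qed

section \<open>Lebesgue points\<close>

text \<open>The differentiation theorem \<open>integrable_ccontinuous_explicit\<close> concerns the cubes with corner \<open>x\<close>
  extending in the positive directions. Reflecting coordinates yields cubes in all orthants, which
  together cover a ball around \<open>x\<close>.\<close>

definition reflect :: "'n set \<Rightarrow> real ^ 'n \<Rightarrow> real ^ 'n" where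
  "reflect S x = (\<chi> j. if j \<in> S then - x $ j else x $ j)"

lemma orthogonal_transformation_reflect: "orthogonal_transformation (reflect S)"
  unfolding orthogonal_transformation_def
proof (intro conjI allI linearI)
  show "reflect S v \<bullet> reflect S w = v \<bullet> w" for v w
    unfolding inner_vec_def reflect_def by (intro sum.cong) auto
qed (auto simp: reflect_def vec_eq_iff)

lemma reflect_reflect: "reflect S (reflect S x) = x"
  by (simp add: reflect_def vec_eq_iff)

lemma reflect_add: "reflect S (x + y) = reflect S x + reflect S y"
  by (simp add: reflect_def vec_eq_iff)

lemma nn_integral_eq_henstock_integral:
  fixes g :: "'a::euclidean_space \<Rightarrow> real"
  assumes [measurable]: "g \<in> borel_measurable borel" and g: "\<And>x. g x \<ge> 0"
    and fin: "(\<integral>\<^sup>+x. ennreal (g x) * indicator (cbox a b) x \<partial>lborel) < \<infinity>"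
  shows "g integrable_on cbox a b"
    and "(\<integral>\<^sup>+x. ennreal (g x) * indicator (cbox a b) x \<partial>lborel) = ennreal (integral (cbox a b) g)"
proof -
  have eq: "(\<integral>\<^sup>+x. ennreal (g x) * indicator (cbox a b) x \<partial>lborel) = (\<integral>\<^sup>+x. ennreal (indicator (cbox a b) x *\<^sub>R g x) \<partial>lborel)"
    by (intro nn_integral_cong) (auto simp: indicator_def)
  have int: "integrable lborel (\<lambda>x. indicator (cbox a b) x *\<^sub>R g x)"
  proof (rule integrableI_nonneg)
    show "(\<lambda>x. indicator (cbox a b) x *\<^sub>R g x) \<in> borel_measurable lborel"
      by (rule borel_measurable_scaleR) auto
  qed (use g fin eq in auto)
  then have s: "set_integrable lborel (cbox a b) g" by (simp add: set_integrable_def)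
  show "g integrable_on cbox a b" by (rule set_borel_integral_eq_integral(1)[OF s])
  show "(\<integral>\<^sup>+x. ennreal (g x) * indicator (cbox a b) x \<partial>lborel) = ennreal (integral (cbox a b) g)"
    unfolding eq set_borel_integral_eq_integral(2)[OF s, symmetric] set_lebesgue_integral_def
    by (rule nn_integral_eq_integral[OF int]) (use g in auto)
qed

text \<open>A ball of radius \<open>s\<close> is covered by the \<open>2\<^sup>N\<close> cubes of side \<open>s\<close> with corner \<open>x\<close>, one for each orthant.
  The average of \<open>g\<close> over each cube converges to \<open>g x\<close> almost everywhere.\<close>

lemma AE_ball_average_le:
  fixes g :: "real ^ 'n \<Rightarrow> real"
  assumes gm[measurable]: "g \<in> borel_measurable borel" and g: "\<And>x. g x \<ge> 0"
    and fin: "\<And>r. (\<integral>\<^sup>+x. ennreal (g x) * indicator (cball 0 r) x \<partial>lborel) < \<infinity>"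
  shows "AE x in lborel. \<forall>\<epsilon>>0. \<exists>\<delta>>0. \<forall>s. 0 < s \<and> s < \<delta> \<longrightarrow>
     (\<integral>\<^sup>+z. ennreal (g (x + z)) * indicator (cball 0 s) z \<partial>lborel) \<le> ennreal (2 ^ CARD('n) * (g x + \<epsilon>) * s ^ CARD('n))"
proof -
  note refl_meas[measurable] = orthogonal_transformation_borel_measurable[OF orthogonal_transformation_reflect]
  have gS: "\<exists>N \<in> null_sets lborel. \<forall>x. x \<notin> N \<longrightarrow> (\<forall>\<epsilon>>0. \<exists>\<delta>>0. \<forall>s. 0 < s \<and> s < \<delta> \<longrightarrow>
      (\<integral>\<^sup>+y. ennreal (g (reflect S y)) * indicator (cbox x (x + s *\<^sub>R One)) y \<partial>lborel) \<le> ennreal ((g (reflect S x) + \<epsilon>) * s ^ CARD('n)))" for S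
  proof -
    let ?g = "\<lambda>y. g (reflect S y)"
    have fin': "(\<integral>\<^sup>+y. ennreal (?g y) * indicator (cbox a b) y \<partial>lborel) < \<infinity>" for a b
    proof -
      obtain r where r: "cbox a b \<subseteq> cball 0 r"
        using bounded_cbox[of a b] by (auto simp: bounded_iff subset_iff)
      have "(\<integral>\<^sup>+y. ennreal (?g y) * indicator (cbox a b) y \<partial>lborel) \<le> (\<integral>\<^sup>+y. ennreal (?g y) * indicator (cball 0 r) (reflect S y) \<partial>lborel)"
      proof (intro nn_integral_mono mult_left_mono)
        fix y
        have "norm (reflect S y) = norm y"
          using orthogonal_transformation_norm[OF orthogonal_transformation_reflect] .
        then show "indicator (cbox a b) y \<le> (indicator (cball 0 r) (reflect S y) :: ennreal)"
          using r by (auto simp: indicator_def)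
      qed simp
      also have "\<dots> = (\<integral>\<^sup>+y. ennreal (g y) * indicator (cball 0 r) y \<partial>lborel)"
        by (rule nn_integral_lborel_orthogonal[OF orthogonal_transformation_reflect, of "\<lambda>y. ennreal (g y) * indicator (cball 0 r) y"])
           (intro borel_measurable_times_ennreal borel_measurable_indicator, auto)
      finally show ?thesis using fin[of r] by (rule le_less_trans)
    qed
    have gm': "?g \<in> borel_measurable borel" by measurable
    note HK = nn_integral_eq_henstock_integral[OF gm' _ fin']
    have "\<And>a b. ?g integrable_on cbox a b" by (rule HK(1)) (rule g)
    then obtain N where N: "negligible N"
      "\<And>x e. \<lbrakk>x \<notin> N; 0 < e\<rbrakk> \<Longrightarrow> \<exists>d>0. \<forall>h. 0 < h \<and> h < d \<longrightarrow>
          norm (integral (cbox x (x + h *\<^sub>R One)) ?g /\<^sub>R h ^ DIM(real ^ 'n) - ?g x) < e"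
      using integrable_ccontinuous_explicit[of ?g] by metis
    from N(1) have "N \<in> null_sets (completion lborel)" by (simp add: negligible_iff_null_sets)
    then obtain N' where N': "N \<subseteq> N'" "N' \<in> null_sets lborel"
      by (auto simp: null_sets_completion_iff2)
    show ?thesis
    proof (rule bexI[OF _ N'(2)], intro allI impI)
      fix x \<epsilon> assume x: "x \<notin> N'" and \<epsilon>: "\<epsilon> > (0::real)"
      then obtain d where d: "d > 0" "\<forall>h. 0 < h \<and> h < d \<longrightarrow>
          norm (integral (cbox x (x + h *\<^sub>R One)) ?g /\<^sub>R h ^ DIM(real ^ 'n) - ?g x) < \<epsilon>"
        using N(2)[of x \<epsilon>] N'(1) by blast
      show "\<exists>\<delta>>0. \<forall>s. 0 < s \<and> s < \<delta> \<longrightarrow>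
        (\<integral>\<^sup>+y. ennreal (?g y) * indicator (cbox x (x + s *\<^sub>R One)) y \<partial>lborel) \<le> ennreal ((?g x + \<epsilon>) * s ^ CARD('n))"
      proof (intro exI[of _ d] conjI allI impI d(1))
        fix s assume s: "0 < s \<and> s < d"
        then have "\<bar>integral (cbox x (x + s *\<^sub>R One)) ?g / s ^ CARD('n) - ?g x\<bar> < \<epsilon>"
          using d(2) by (simp add: divide_inverse mult.commute)
        then have "integral (cbox x (x + s *\<^sub>R One)) ?g / s ^ CARD('n) \<le> ?g x + \<epsilon>" by linarith
        then have "integral (cbox x (x + s *\<^sub>R One)) ?g \<le> (?g x + \<epsilon>) * s ^ CARD('n)"
          using s by (simp add: divide_le_eq)
        then show "(\<integral>\<^sup>+y. ennreal (?g y) * indicator (cbox x (x + s *\<^sub>R One)) y \<partial>lborel) \<le> ennreal ((?g x + \<epsilon>) * s ^ CARD('n))"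
          by (subst HK(2)) (auto intro: ennreal_leI g)
      qed
    qed
  qed
  define Q where "Q S x \<longleftrightarrow> (\<forall>\<epsilon>>0. \<exists>\<delta>>0. \<forall>s. 0 < s \<and> s < \<delta> \<longrightarrow>
      (\<integral>\<^sup>+y. ennreal (g (reflect S y)) * indicator (cbox x (x + s *\<^sub>R One)) y \<partial>lborel) \<le> ennreal ((g (reflect S x) + \<epsilon>) * s ^ CARD('n)))" for S x
  have "\<forall>S. \<exists>N. N \<in> null_sets lborel \<and> (\<forall>x. x \<notin> N \<longrightarrow> Q S x)"
    unfolding Q_def using gS by blast
  from choice[OF this] obtain N where N: "\<And>S. N S \<in> null_sets lborel" and NQ: "\<And>S x. x \<notin> N S \<Longrightarrow> Q S x"
    by blast
  have "AE x in lborel. \<forall>S. reflect S x \<notin> N S"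
    unfolding AE_all_countable
  proof
    fix S
    have "AE y in distr lborel borel (reflect S). y \<notin> N S"
      unfolding lborel_distr_orthogonal[OF orthogonal_transformation_reflect] using N by (rule AE_not_in)
    then show "AE x in lborel. reflect S x \<notin> N S"
      using N[of S] by (subst (asm) AE_distr_iff) auto
  qed
  then show ?thesis
  proof eventually_elim
    case (elim x)
    show ?case
    proof (intro allI impI)
      fix \<epsilon> :: real assume \<epsilon>: "\<epsilon> > 0"
      have "\<exists>\<delta>>0. \<forall>s. 0 < s \<and> s < \<delta> \<longrightarrow>
        (\<integral>\<^sup>+y. ennreal (g (reflect S y)) * indicator (cbox (reflect S x) (reflect S x + s *\<^sub>R One)) y \<partial>lborel) \<le> ennreal ((g x + \<epsilon>) * s ^ CARD('n))" for S
        using NQ[of "reflect S x" S] elim \<epsilon> by (simp add: Q_def reflect_reflect)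
      then have "\<forall>S. \<exists>\<delta>. \<delta> > 0 \<and> (\<forall>s. 0 < s \<and> s < \<delta> \<longrightarrow>
        (\<integral>\<^sup>+y. ennreal (g (reflect S y)) * indicator (cbox (reflect S x) (reflect S x + s *\<^sub>R One)) y \<partial>lborel) \<le> ennreal ((g x + \<epsilon>) * s ^ CARD('n)))"
        by blast
      from choice[OF this] obtain \<delta> where \<delta>: "\<And>S. \<delta> S > 0" "\<And>S s. 0 < s \<Longrightarrow> s < \<delta> S \<Longrightarrow>
        (\<integral>\<^sup>+y. ennreal (g (reflect S y)) * indicator (cbox (reflect S x) (reflect S x + s *\<^sub>R One)) y \<partial>lborel) \<le> ennreal ((g x + \<epsilon>) * s ^ CARD('n))"
        by blast
      show "\<exists>\<delta>>0. \<forall>s. 0 < s \<and> s < \<delta> \<longrightarrow>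
        (\<integral>\<^sup>+z. ennreal (g (x + z)) * indicator (cball 0 s) z \<partial>lborel) \<le> ennreal (2 ^ CARD('n) * (g x + \<epsilon>) * s ^ CARD('n))"
      proof (intro exI[of _ "Min (range \<delta>)"] conjI allI impI)
        show "0 < Min (range \<delta>)" using \<delta>(1) by simp
        fix s assume "0 < s \<and> s < Min (range \<delta>)"
        then have s: "0 < s" "\<And>S. s < \<delta> S" by auto
        have box: "(\<integral>\<^sup>+z. ennreal (g (x + z)) * indicator (cbox 0 (s *\<^sub>R One)) (reflect S z) \<partial>lborel) \<le> ennreal ((g x + \<epsilon>) * s ^ CARD('n))" for S
        proof -
          have "(\<integral>\<^sup>+z. ennreal (g (x + z)) * indicator (cbox 0 (s *\<^sub>R One)) (reflect S z) \<partial>lborel)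
            = (\<integral>\<^sup>+z. ennreal (g (reflect S (reflect S z + reflect S x))) * indicator (cbox 0 (s *\<^sub>R One)) (reflect S z) \<partial>lborel)"
            by (simp add: reflect_add reflect_reflect add.commute)
          also have "\<dots> = (\<integral>\<^sup>+z. ennreal (g (reflect S (z + reflect S x))) * indicator (cbox 0 (s *\<^sub>R One)) z \<partial>lborel)"
            by (rule nn_integral_lborel_orthogonal[OF orthogonal_transformation_reflect, of "\<lambda>z. ennreal (g (reflect S (z + reflect S x))) * indicator (cbox 0 (s *\<^sub>R One)) z"])
               (intro borel_measurable_times_ennreal borel_measurable_indicator; measurable)
          also have "\<dots> = (\<integral>\<^sup>+z. ennreal (g (reflect S (z + reflect S x))) * indicator (cbox (reflect S x) (reflect S x + s *\<^sub>R One)) (z + reflect S x) \<partial>lborel)"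
            by (intro nn_integral_cong) (auto simp: indicator_def mem_box inner_add_left algebra_simps)
          also have "\<dots> = (\<integral>\<^sup>+y. ennreal (g (reflect S y)) * indicator (cbox (reflect S x) (reflect S x + s *\<^sub>R One)) y \<partial>lborel)"
            by (rule nn_integral_lborel_translate[of "\<lambda>y. ennreal (g (reflect S y)) * indicator (cbox (reflect S x) (reflect S x + s *\<^sub>R One)) y"])
               (intro borel_measurable_times_ennreal borel_measurable_indicator; measurable)
          also have "\<dots> \<le> ennreal ((g x + \<epsilon>) * s ^ CARD('n))" by (rule \<delta>(2)[OF s])
          finally show ?thesis .
        qed
        have "(\<integral>\<^sup>+z. ennreal (g (x + z)) * indicator (cball 0 s) z \<partial>lborel)
            \<le> (\<integral>\<^sup>+z. (\<Sum>S\<in>UNIV. ennreal (g (x + z)) * indicator (cbox 0 (s *\<^sub>R One)) (reflect S z)) \<partial>lborel)"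
        proof (rule nn_integral_mono)
          fix z :: "real ^ 'n"
          show "ennreal (g (x + z)) * indicator (cball 0 s) z \<le> (\<Sum>S\<in>UNIV. ennreal (g (x + z)) * indicator (cbox 0 (s *\<^sub>R One)) (reflect S z))"
          proof (cases "norm z \<le> s")
            case True
            let ?S = "{j. z $ j < 0}"
            have refl_nth: "reflect ?S z $ j = \<bar>z $ j\<bar>" for j by (simp add: reflect_def)
            have z_le: "\<bar>z $ j\<bar> \<le> s" for j using component_le_norm_cart[of z j] True by simp
            have "reflect ?S z \<in> cbox 0 (s *\<^sub>R One)"
            proof -
              have "(One :: real ^ 'n) $ j = 1" for j
                using inner_sum_left_Basis[of "axis j (1::real) :: real ^ 'n" "\<lambda>_. 1"]
                by (simp add: cart_eq_inner_axis[of _ j])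
              then show ?thesis using refl_nth z_le by (simp add: mem_box_cart)
            qed
            then have "ennreal (g (x + z)) * indicator (cball 0 s) z \<le> ennreal (g (x + z)) * indicator (cbox 0 (s *\<^sub>R One)) (reflect ?S z)"
              by (simp add: indicator_def)
            also have "\<dots> \<le> (\<Sum>S\<in>UNIV. ennreal (g (x + z)) * indicator (cbox 0 (s *\<^sub>R One)) (reflect S z))"
              by (rule member_le_sum) auto
            finally show ?thesis .
          qed simp
        qed
        also have "\<dots> = (\<Sum>S\<in>UNIV. \<integral>\<^sup>+z. ennreal (g (x + z)) * indicator (cbox 0 (s *\<^sub>R One)) (reflect S z) \<partial>lborel)"
        proof (rule nn_integral_sum)
          fix S :: "'n set"
          have "(\<lambda>z. indicator (cbox 0 (s *\<^sub>R One)) (reflect S z) :: ennreal) \<in> borel_measurable borel"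
            by (rule measurable_compose[OF refl_meas borel_measurable_indicator]) simp
          then show "(\<lambda>z. ennreal (g (x + z)) * indicator (cbox 0 (s *\<^sub>R One)) (reflect S z)) \<in> borel_measurable lborel"
            by measurable
        qed
        also have "\<dots> \<le> (\<Sum>S\<in>(UNIV :: 'n set set). ennreal ((g x + \<epsilon>) * s ^ CARD('n)))"
          by (intro sum_mono box)
        also have "\<dots> = ennreal (2 ^ CARD('n) * (g x + \<epsilon>) * s ^ CARD('n))"
        proof -
          have "card (UNIV :: 'n set set) = 2 ^ CARD('n)"
            using card_Pow[of "UNIV :: 'n set"] by (simp add: Pow_UNIV)
          then show ?thesis
            using g[of x] \<epsilon> s by (simp add: ennreal_of_nat_eq_real_of_nat ennreal_mult[symmetric] mult.assoc)
        qed
        finally show "(\<integral>\<^sup>+z. ennreal (g (x + z)) * indicator (cball 0 s) z \<partial>lborel) \<le> ennreal (2 ^ CARD('n) * (g x + \<epsilon>) * s ^ CARD('n))" .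
      qed
    qed
  qed
qed

text \<open>The preceding lemma is applied to \<open>|f - q|\<^sup>2\<close> for all \<open>q\<close> in a countable dense set. At a given \<open>x\<close>, a
  \<open>q\<close> close to \<open>f x\<close> makes both \<open>|f - q|\<^sup>2\<close> on small balls and \<open>|q - f x|\<^sup>2\<close> small.\<close>

theorem AE_L2_Lebesgue_point:
  fixes f :: "real ^ 'n \<Rightarrow> 'b::euclidean_space"
  assumes fm[measurable]: "f \<in> borel_measurable borel"
    and fin: "(\<integral>\<^sup>+x. ennreal ((norm (f x))\<^sup>2) \<partial>lborel) < \<infinity>"
  shows "AE x in lborel. \<forall>\<epsilon>>0. \<exists>\<delta>>0. \<forall>s. 0 < s \<and> s < \<delta> \<longrightarrow>
     (\<integral>\<^sup>+z. ennreal ((norm (f (x + z) - f x))\<^sup>2) * indicator (cball 0 s) z \<partial>lborel) \<le> ennreal (\<epsilon> * s ^ CARD('n))"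
proof -
  obtain D :: "'b set" where D: "countable D" "\<And>X. open X \<Longrightarrow> X \<noteq> {} \<Longrightarrow> \<exists>d\<in>D. d \<in> X"
    using countable_dense_exists by blast
  define K where "K = unit_ball_vol (real CARD('n))"
  have K: "K \<ge> 0" by (simp add: K_def)
  have vol: "emeasure lborel (cball (0::real^'n) s) = ennreal (K * s ^ CARD('n))" if "s \<ge> 0" for s
    using that by (simp add: emeasure_cball K_def)
  have cb[measurable]: "cball (0::real^'n) s \<in> sets borel" for s by simp
  have tri: "(norm (a - b))\<^sup>2 \<le> 2 * (norm (a - q))\<^sup>2 + 2 * (norm (q - b))\<^sup>2" for a b q :: 'b
  proof -
    have "(norm (a - b))\<^sup>2 \<le> (norm (a - q) + norm (q - b))\<^sup>2"
      by (rule power_mono) (use norm_triangle_ineq[of "a - q" "q - b"] in auto)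
    also have "\<dots> \<le> 2 * (norm (a - q))\<^sup>2 + 2 * (norm (q - b))\<^sup>2"
      using square_sum2_le[of 1 "norm (a - q)" "norm (q - b)"] by simp
    finally show ?thesis .
  qed
  have "AE x in lborel. \<forall>q\<in>D. \<forall>\<epsilon>>0. \<exists>\<delta>>0. \<forall>s. 0 < s \<and> s < \<delta> \<longrightarrow>
     (\<integral>\<^sup>+z. ennreal ((norm (f (x + z) - q))\<^sup>2) * indicator (cball 0 s) z \<partial>lborel) \<le> ennreal (2 ^ CARD('n) * ((norm (f x - q))\<^sup>2 + \<epsilon>) * s ^ CARD('n))"
  proof (subst AE_ball_countable[OF D(1)], intro ballI AE_ball_average_le)
    fix q r
    have "(\<integral>\<^sup>+x. ennreal ((norm (f x - q))\<^sup>2) * indicator (cball (0::real^'n) r) x \<partial>lborel)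
      \<le> (\<integral>\<^sup>+x. 2 * ennreal ((norm (f x))\<^sup>2) + ennreal (2 * (norm q)\<^sup>2) * indicator (cball (0::real^'n) r) x \<partial>lborel)"
    proof (rule nn_integral_mono)
      fix x
      have "ennreal ((norm (f x - q))\<^sup>2) \<le> ennreal (2 * (norm (f x))\<^sup>2 + 2 * (norm q)\<^sup>2)"
        using tri[of "f x" q 0] by (intro ennreal_leI) simp
      also have "\<dots> = 2 * ennreal ((norm (f x))\<^sup>2) + ennreal (2 * (norm q)\<^sup>2)"
        by (simp add: ennreal_mult)
      finally show "ennreal ((norm (f x - q))\<^sup>2) * indicator (cball (0::real^'n) r) x
          \<le> 2 * ennreal ((norm (f x))\<^sup>2) + ennreal (2 * (norm q)\<^sup>2) * indicator (cball (0::real^'n) r) x"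
        by (auto simp: indicator_def)
    qed
    also have "\<dots> = 2 * (\<integral>\<^sup>+x. ennreal ((norm (f x))\<^sup>2) \<partial>lborel) + ennreal (2 * (norm q)\<^sup>2) * emeasure lborel (cball (0::real^'n) r)"
      by (subst nn_integral_add) (auto simp: nn_integral_cmult)
    also have "\<dots> < \<infinity>"
      using fin emeasure_lborel_cball_finite[of "0::real^'n" r] by (auto simp: ennreal_mult_less_top)
    finally show "(\<integral>\<^sup>+x. ennreal ((norm (f x - q))\<^sup>2) * indicator (cball (0::real^'n) r) x \<partial>lborel) < \<infinity>" .
  qed auto
  then show ?thesis
  proof eventually_elim
    case (elim x)
    show ?case
    proof (intro allI impI)
      fix \<epsilon> :: real assume \<epsilon>: "\<epsilon> > 0"
      \<comment> \<open>the denominator is chosen so that the two error terms below add up to \<open>\<epsilon> s\<^sup>N\<close>\<close>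
      define \<kappa> where "\<kappa> = \<epsilon> / (4 * 2 ^ CARD('n) + 2 * K)"
      have den: "4 * 2 ^ CARD('n) + 2 * K > 0" using K by (simp add: add_pos_nonneg)
      have \<kappa>: "\<kappa> > 0" using \<epsilon> den by (simp add: \<kappa>_def)
      have "\<exists>q\<in>D. q \<in> ball (f x) (sqrt \<kappa>)" by (rule D(2)) (use \<kappa> in auto)
      then obtain q where q: "q \<in> D" "norm (f x - q) < sqrt \<kappa>" by (auto simp: dist_norm)
      then have q2: "(norm (f x - q))\<^sup>2 \<le> \<kappa>"
        using \<kappa> power_mono[of "norm (f x - q)" "sqrt \<kappa>" 2] by simp
      obtain \<delta> where \<delta>: "\<delta> > 0" "\<And>s. 0 < s \<Longrightarrow> s < \<delta> \<Longrightarrow>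
         (\<integral>\<^sup>+z. ennreal ((norm (f (x + z) - q))\<^sup>2) * indicator (cball 0 s) z \<partial>lborel) \<le> ennreal (2 ^ CARD('n) * ((norm (f x - q))\<^sup>2 + \<kappa>) * s ^ CARD('n))"
        using elim q(1) \<kappa> by blast
      show "\<exists>\<delta>>0. \<forall>s. 0 < s \<and> s < \<delta> \<longrightarrow>
         (\<integral>\<^sup>+z. ennreal ((norm (f (x + z) - f x))\<^sup>2) * indicator (cball 0 s) z \<partial>lborel) \<le> ennreal (\<epsilon> * s ^ CARD('n))"
      proof (intro exI[of _ \<delta>] conjI allI impI \<delta>(1))
        fix s assume s: "0 < s \<and> s < \<delta>"
        have "(\<integral>\<^sup>+z. ennreal ((norm (f (x + z) - f x))\<^sup>2) * indicator (cball 0 s) z \<partial>lborel)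
          \<le> (\<integral>\<^sup>+z. 2 * (ennreal ((norm (f (x + z) - q))\<^sup>2) * indicator (cball 0 s) z) + ennreal (2 * \<kappa>) * indicator (cball 0 s) z \<partial>lborel)"
        proof (rule nn_integral_mono)
          fix z
          have "(norm (f (x + z) - f x))\<^sup>2 \<le> 2 * (norm (f (x + z) - q))\<^sup>2 + 2 * \<kappa>"
            using tri[of "f (x + z)" "f x" q] q2 by (simp add: norm_minus_commute)
          then have "ennreal ((norm (f (x + z) - f x))\<^sup>2) \<le> ennreal (2 * (norm (f (x + z) - q))\<^sup>2 + 2 * \<kappa>)"
            by (rule ennreal_leI)
          also have "\<dots> = 2 * ennreal ((norm (f (x + z) - q))\<^sup>2) + ennreal (2 * \<kappa>)"
            using \<kappa> by (simp add: ennreal_mult)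
          finally show "ennreal ((norm (f (x + z) - f x))\<^sup>2) * indicator (cball 0 s) z
            \<le> 2 * (ennreal ((norm (f (x + z) - q))\<^sup>2) * indicator (cball 0 s) z) + ennreal (2 * \<kappa>) * indicator (cball 0 s) z"
            by (auto simp: indicator_def)
        qed
        also have "\<dots> = 2 * (\<integral>\<^sup>+z. ennreal ((norm (f (x + z) - q))\<^sup>2) * indicator (cball 0 s) z \<partial>lborel) + ennreal (2 * \<kappa>) * emeasure lborel (cball (0::real^'n) s)"
          by (subst nn_integral_add) (auto simp: nn_integral_cmult)
        also have "\<dots> \<le> 2 * ennreal (2 ^ CARD('n) * (\<kappa> + \<kappa>) * s ^ CARD('n)) + ennreal (2 * \<kappa>) * ennreal (K * s ^ CARD('n))"
        proof (intro add_mono mult_left_mono order_trans[OF \<delta>(2)] ennreal_leI mult_right_mono)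
          show "emeasure lborel (cball (0::real^'n) s) \<le> ennreal (K * s ^ CARD('n))" using vol[of s] s by simp
        qed (use s q2 in auto)
        also have "\<dots> = ennreal (2 * (2 ^ CARD('n) * (\<kappa> + \<kappa>) * s ^ CARD('n)) + 2 * \<kappa> * (K * s ^ CARD('n)))"
        proof -
          have "2 * ennreal a + ennreal b * ennreal c = ennreal (2 * a + b * c)" if "a \<ge> 0" "b \<ge> 0" "c \<ge> 0" for a b c
            using that by (simp add: ennreal_mult)
          then show ?thesis using \<kappa> s K by simp
        qed
        also have "2 * (2 ^ CARD('n) * (\<kappa> + \<kappa>) * s ^ CARD('n)) + 2 * \<kappa> * (K * s ^ CARD('n)) = (4 * 2 ^ CARD('n) + 2 * K) * \<kappa> * s ^ CARD('n)"
          by (simp add: algebra_simps)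
        also have "(4 * 2 ^ CARD('n) + 2 * K) * \<kappa> = \<epsilon>" using den by (simp add: \<kappa>_def)
        finally show "(\<integral>\<^sup>+z. ennreal ((norm (f (x + z) - f x))\<^sup>2) * indicator (cball 0 s) z \<partial>lborel) \<le> ennreal (\<epsilon> * s ^ CARD('n))" .
      qed
    qed
  qed
qed

section \<open>Radial weights\<close>

lemma ennreal_tendsto_0I:
  fixes f :: "nat \<Rightarrow> ennreal"
  assumes "\<And>e::real. e > 0 \<Longrightarrow> eventually (\<lambda>n. f n \<le> ennreal e) sequentially"
  shows "f \<longlonglongrightarrow> 0"
proof (rule order_tendstoI)
  fix a :: ennreal assume "0 < a"
  then obtain y where y: "0 < y" "y < a" using dense by blast
  then have "y < top" by (meson less_top_ennreal order_less_le_trans top_greatest)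
  then have "y = ennreal (enn2real y)" by simp
  moreover have "enn2real y > 0" using y \<open>y < top\<close> by (simp add: enn2real_positive_iff)
  ultimately have "eventually (\<lambda>n. f n \<le> y) sequentially" using assms[of "enn2real y"] by simp
  then show "eventually (\<lambda>n. f n < a) sequentially"
    by eventually_elim (use y in auto)
qed simp

text \<open>The quotient depends on \<open>z\<close> only through its direction. The integral therefore factors into the
  second moment of the sphere and the mass of the weight.\<close>

lemma nn_integral_radial_quadratic:
  fixes m :: "complex ^ 'n" and \<omega> :: "real ^ 'n"
  assumes w[measurable]: "w \<in> borel_measurable borel" and \<omega>: "norm \<omega> = 1"
  shows "(\<integral>\<^sup>+z. w (norm z) * ennreal ((cmod (real_dot z m))\<^sup>2 / (norm z)\<^sup>2) \<partial>lborel)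
    = ennreal (2 * Q_const \<omega> * (norm m)\<^sup>2) * (\<integral>\<^sup>+r. w r \<partial>radial_measure CARD('n))"
proof -
  have "(\<integral>\<^sup>+z. w (norm z) * ennreal ((cmod (real_dot z m))\<^sup>2 / (norm z)\<^sup>2) \<partial>lborel)
    = (\<integral>\<^sup>+r. w r * (\<integral>\<^sup>+\<sigma>. ennreal ((cmod (real_dot (r *\<^sub>R \<sigma>) m))\<^sup>2 / (norm (r *\<^sub>R \<sigma>))\<^sup>2) \<partial>sphere_measure) \<partial>radial_measure CARD('n))"
    by (rule nn_integral_radial_weight) measurable
  also have "\<dots> = (\<integral>\<^sup>+r. ennreal (2 * Q_const \<omega> * (norm m)\<^sup>2) * w r \<partial>radial_measure CARD('n))"
  proof (rule nn_integral_cong_AE)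
    show "AE r in radial_measure CARD('n). w r * (\<integral>\<^sup>+\<sigma>. ennreal ((cmod (real_dot (r *\<^sub>R \<sigma>) m))\<^sup>2 / (norm (r *\<^sub>R \<sigma>))\<^sup>2) \<partial>(sphere_measure :: (real ^ 'n) measure))
       = ennreal (2 * Q_const \<omega> * (norm m)\<^sup>2) * w r"
      using AE_radial_measure_pos
    proof eventually_elim
      case (elim r)
      have "(\<integral>\<^sup>+\<sigma>. ennreal ((cmod (real_dot (r *\<^sub>R \<sigma>) m))\<^sup>2 / (norm (r *\<^sub>R \<sigma>))\<^sup>2) \<partial>sphere_measure)
        = (\<integral>\<^sup>+\<sigma>. ennreal ((cmod (real_dot \<sigma> m))\<^sup>2) \<partial>sphere_measure)"
        using elim by (intro nn_integral_cong) (simp add: space_sphere_measure real_dot_scaleR power_mult_distrib)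
      then show ?case by (simp add: sphere_second_moment_complex[OF \<omega>] mult.commute)
    qed
  qed
  also have "\<dots> = ennreal (2 * Q_const \<omega> * (norm m)\<^sup>2) * (\<integral>\<^sup>+r. w r \<partial>radial_measure CARD('n))"
    by (rule nn_integral_cmult) measurable
  finally show ?thesis .
qed

lemma nn_integral_radial_mass:
  assumes w[measurable]: "w \<in> borel_measurable borel"
  shows "(\<integral>\<^sup>+z. w (norm (z :: real ^ 'n)) \<partial>lborel)
    = emeasure (sphere_measure :: (real ^ 'n) measure) (sphere 0 1) * (\<integral>\<^sup>+r. w r \<partial>radial_measure CARD('n))"
proof -
  have "(\<integral>\<^sup>+z. w (norm (z :: real ^ 'n)) \<partial>lborel) = (\<integral>\<^sup>+z. w (norm (z :: real ^ 'n)) * 1 \<partial>lborel)" by simp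
  also have "\<dots> = (\<integral>\<^sup>+r. w r * (\<integral>\<^sup>+\<sigma>. 1 \<partial>(sphere_measure :: (real ^ 'n) measure)) \<partial>radial_measure CARD('n))"
    by (rule nn_integral_radial_weight) measurable
  also have "\<dots> = emeasure (sphere_measure :: (real ^ 'n) measure) (sphere 0 1) * (\<integral>\<^sup>+r. w r \<partial>radial_measure CARD('n))"
    by (simp add: space_sphere_measure nn_integral_multc mult.commute)
  finally show ?thesis .
qed

definition sphere_area :: "'n::finite itself \<Rightarrow> real" where
  "sphere_area _ = measure (sphere_measure :: (real ^ 'n) measure) (sphere 0 1)"

lemma emeasure_sphere_area:
  "emeasure (sphere_measure :: (real ^ 'n) measure) (sphere 0 1) = ennreal (sphere_area TYPE('n))"
proof -
  interpret finite_measure "sphere_measure :: (real ^ 'n) measure" by (rule finite_sphere_measure)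
  show ?thesis by (simp add: sphere_area_def emeasure_eq_measure)
qed

lemma sphere_area_nonneg: "sphere_area TYPE('n::finite) \<ge> 0"
  by (simp add: sphere_area_def)

lemma cmod_Psi: "cmod (Psi A u x y) = cmod (u y)"
  by (simp add: Psi_def norm_mult)

section \<open>The nonlocal energy and its integral\<close>

text \<open>This collects what the convergence proof uses: \<open>M\<close> stands for the magnetic gradient and is tied to \<open>u\<close>
  only by the segment formula. All functions are Borel, so Fubini applies freely.\<close>

locale magnetic_function =
  fixes A :: "real ^ 'n \<Rightarrow> real ^ 'n" and u :: "real ^ 'n \<Rightarrow> complex" and M :: "real ^ 'n \<Rightarrow> complex ^ 'n" and L :: real
  assumes u_meas[measurable]: "u \<in> borel_measurable borel"
    and M_meas[measurable]: "M \<in> borel_measurable borel"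
    and lip: "L-lipschitz_on UNIV A"
    and u_fin: "(\<integral>\<^sup>+x. ennreal ((cmod (u x))\<^sup>2) \<partial>lborel) < \<infinity>"
    and M_fin: "(\<integral>\<^sup>+x. ennreal ((norm (M x))\<^sup>2) \<partial>lborel) < \<infinity>"
    and line: "\<And>z. AE x in lborel. integrable lborel (\<lambda>t. indicator {0..1::real} t *\<^sub>R magnetic_increment A u M x z t) \<and>
      Psi A u x (x + z) - u x = (LINT t|lborel. indicator {0..1::real} t *\<^sub>R magnetic_increment A u M x z t)"
begin

definition increment :: "real ^ 'n \<Rightarrow> real ^ 'n \<Rightarrow> complex" where
  "increment x z = Psi A u x (x + z) - u x"

lemma A_meas[measurable]: "A \<in> borel_measurable borel"
  using lip by (intro borel_measurable_continuous_onI lipschitz_on_continuous_on)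

lemma increment_meas[measurable]:
  assumes [measurable]: "f \<in> borel_measurable N" "g \<in> borel_measurable N"
  shows "(\<lambda>p. increment (f p) (g p)) \<in> borel_measurable N"
proof -
  have [measurable]: "(\<lambda>p. exp (\<i> * of_real ((f p - (f p + g p)) \<bullet> A ((1 / 2) *\<^sub>R (f p + (f p + g p)))))) \<in> borel_measurable N"
    by (rule borel_measurable_continuous_on[of exp]) (intro continuous_intros, measurable)
  show ?thesis unfolding increment_def Psi_def by measurable
qed

lemma increment_sq_le_segment:
  assumes \<eta>: "\<eta> > 0"
  shows "AE x in lborel. ennreal ((cmod (increment x z))\<^sup>2) \<le>
    (\<integral>\<^sup>+t. ennreal ((1 + \<eta>) * (cmod (real_dot z (M (x + t *\<^sub>R z))))\<^sup>2
        + (1 + 1 / \<eta>) * (L\<^sup>2 / 4 * (norm z) ^ 4 * (cmod (u (x + t *\<^sub>R z)))\<^sup>2)) * indicator {0..1} t \<partial>lborel)"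
  using line[of z]
proof eventually_elim
  case (elim x)
  have "ennreal ((cmod (LINT t|lborel. indicator {0..1} t *\<^sub>R magnetic_increment A u M x z t))\<^sup>2) \<le>
    (\<integral>\<^sup>+t. ennreal ((1 + \<eta>) * (cmod (real_dot z (M (x + t *\<^sub>R z))))\<^sup>2
        + (1 + 1 / \<eta>) * (L\<^sup>2 / 4 * (norm z) ^ 4 * (cmod (u (x + t *\<^sub>R z)))\<^sup>2)) * indicator {0..1} t \<partial>lborel)"
    by (rule norm_unit_interval_integral_sq_le[OF elim[THEN conjunct1] magnetic_increment_sq_le[OF lip _ \<eta>]])
  then show ?case using elim by (simp add: increment_def)
qed

abbreviation segment_majorant :: "real ^ 'n \<Rightarrow> real ^ 'n \<Rightarrow> ennreal" where
  "segment_majorant x z \<equiv> (\<integral>\<^sup>+t. ennreal ((norm z)\<^sup>2 * (3 * (norm (M (x + t *\<^sub>R z) - M x))\<^sup>2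
      + (norm z)\<^sup>2 * (3 * ((norm (A x) + L) * norm (M x))\<^sup>2 + L\<^sup>2 * (cmod (u (x + t *\<^sub>R z)))\<^sup>2)))
      * indicator {0..1} t \<partial>lborel)"

text \<open>The term \<open>real_dot z (M x)\<close> is the integral over \<open>[0, 1]\<close> of itself and can be subtracted under the
  integral.\<close>

lemma increment_minus_linear_sq_le_segment:
  assumes z: "norm z \<le> 1"
  shows "AE x in lborel. ennreal ((cmod (increment x z - real_dot z (M x)))\<^sup>2) \<le> segment_majorant x z"
  using line[of z]
proof eventually_elim
  case (elim x)
  have split: "(\<lambda>t. indicator {0..1} t *\<^sub>R (magnetic_increment A u M x z t - real_dot z (M x)))
    = (\<lambda>t. indicator {0..1} t *\<^sub>R magnetic_increment A u M x z t - indicator {0..1::real} t *\<^sub>R real_dot z (M x))"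
    by (simp add: scaleR_diff_right)
  have c: "integrable lborel (\<lambda>t. indicator {0..1::real} t *\<^sub>R real_dot z (M x))"
    by (rule integrable_scaleR_left) simp
  have "integrable lborel (\<lambda>t. indicator {0..1} t *\<^sub>R (magnetic_increment A u M x z t - real_dot z (M x)))"
    unfolding split using elim c by (intro Bochner_Integration.integrable_diff) auto
  from norm_unit_interval_integral_sq_le[OF this magnetic_increment_minus_linear_sq_le[OF lip _ z]]
  have "ennreal ((cmod (LINT t|lborel. indicator {0..1} t *\<^sub>R (magnetic_increment A u M x z t - real_dot z (M x))))\<^sup>2) \<le> segment_majorant x z" .
  moreover have "(LINT t|lborel. indicator {0..1} t *\<^sub>R (magnetic_increment A u M x z t - real_dot z (M x))) = increment x z - real_dot z (M x)"
    unfolding split increment_def using elim c by (subst Bochner_Integration.integral_diff) auto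
  ultimately show ?case by simp
qed

lemma increment_sq_le_sum: "(cmod (increment x z))\<^sup>2 \<le> 2 * (cmod (u (x + z)))\<^sup>2 + 2 * (cmod (u x))\<^sup>2"
proof -
  have "(cmod (increment x z))\<^sup>2 \<le> (cmod (u (x + z)) + cmod (u x))\<^sup>2"
    unfolding increment_def using norm_triangle_ineq4[of "Psi A u x (x + z)" "u x"]
    by (intro power_mono) (auto simp: cmod_Psi)
  also have "\<dots> \<le> 2 * (cmod (u (x + z)))\<^sup>2 + 2 * (cmod (u x))\<^sup>2"
    using square_sum2_le[of 1 "cmod (u (x + z))" "cmod (u x)"] by simp
  finally show ?thesis .
qed

abbreviation "u_mass \<equiv> \<integral>\<^sup>+x. ennreal ((cmod (u x))\<^sup>2) \<partial>lborel"
abbreviation "M_mass \<equiv> \<integral>\<^sup>+x. ennreal ((norm (M x))\<^sup>2) \<partial>lborel"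

lemma integral_increment_sq_le_mass:
  "(\<integral>\<^sup>+x. ennreal ((cmod (increment x z))\<^sup>2) \<partial>lborel) \<le> 4 * u_mass"
proof -
  have "(\<integral>\<^sup>+x. ennreal ((cmod (increment x z))\<^sup>2) \<partial>lborel)
     \<le> (\<integral>\<^sup>+x. 2 * ennreal ((cmod (u (x + z)))\<^sup>2) + 2 * ennreal ((cmod (u x))\<^sup>2) \<partial>lborel)"
  proof (rule nn_integral_mono)
    fix x
    have "ennreal ((cmod (increment x z))\<^sup>2) \<le> ennreal (2 * (cmod (u (x + z)))\<^sup>2 + 2 * (cmod (u x))\<^sup>2)"
      by (rule ennreal_leI[OF increment_sq_le_sum])
    then show "ennreal ((cmod (increment x z))\<^sup>2) \<le> 2 * ennreal ((cmod (u (x + z)))\<^sup>2) + 2 * ennreal ((cmod (u x))\<^sup>2)"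
      by (simp add: ennreal_mult)
  qed
  also have "\<dots> = 2 * (\<integral>\<^sup>+x. ennreal ((cmod (u (x + z)))\<^sup>2) \<partial>lborel) + 2 * u_mass"
    by (subst nn_integral_add) (auto simp: nn_integral_cmult)
  also have "(\<integral>\<^sup>+x. ennreal ((cmod (u (x + z)))\<^sup>2) \<partial>lborel) = u_mass"
    by (rule nn_integral_lborel_translate[of "\<lambda>x. ennreal ((cmod (u x))\<^sup>2)"]) measurable
  also have "2 * u_mass + 2 * u_mass = 4 * u_mass"
    by (simp add: distrib_right[symmetric])
  finally show ?thesis .
qed

text \<open>Translation invariance in \<open>x\<close> removes the shift by \<open>t z\<close>, after which the integral over \<open>t\<close> is trivial.\<close>

lemma integral_increment_sq_le:
  assumes \<eta>: "\<eta> > 0"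
  shows "(\<integral>\<^sup>+x. ennreal ((cmod (increment x z))\<^sup>2) \<partial>lborel) \<le>
     ennreal (1 + \<eta>) * (\<integral>\<^sup>+y. ennreal ((cmod (real_dot z (M y)))\<^sup>2) \<partial>lborel)
     + ennreal ((1 + 1 / \<eta>) * (L\<^sup>2 / 4 * (norm z) ^ 4)) * u_mass"
proof -
  define k where "k y = ennreal ((1 + \<eta>) * (cmod (real_dot z (M y)))\<^sup>2 + (1 + 1 / \<eta>) * (L\<^sup>2 / 4 * (norm z) ^ 4 * (cmod (u y))\<^sup>2))" for y
  have [measurable]: "k \<in> borel_measurable borel" unfolding k_def by measurable
  have "(\<integral>\<^sup>+x. ennreal ((cmod (increment x z))\<^sup>2) \<partial>lborel) \<le> (\<integral>\<^sup>+x. (\<integral>\<^sup>+t. k (x + t *\<^sub>R z) * indicator {0..1} t \<partial>lborel) \<partial>lborel)"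
    unfolding k_def by (rule nn_integral_mono_AE[OF increment_sq_le_segment[OF \<eta>]])
  also have "\<dots> = (\<integral>\<^sup>+t. (\<integral>\<^sup>+x. k (x + t *\<^sub>R z) * indicator {0..1::real} t \<partial>lborel) \<partial>lborel)"
    by (rule lborel_pair.Fubini'[symmetric]) measurable
  also have "\<dots> = (\<integral>\<^sup>+t. (\<integral>\<^sup>+x. k x \<partial>lborel) * indicator {0..1::real} t \<partial>lborel)"
    by (intro nn_integral_cong) (simp add: nn_integral_multc nn_integral_lborel_translate)
  also have "\<dots> = (\<integral>\<^sup>+x. k x \<partial>lborel)" by (simp add: nn_integral_cmult)
  also have "\<dots> = (\<integral>\<^sup>+y. ennreal (1 + \<eta>) * ennreal ((cmod (real_dot z (M y)))\<^sup>2) + ennreal ((1 + 1 / \<eta>) * (L\<^sup>2 / 4 * (norm z) ^ 4)) * ennreal ((cmod (u y))\<^sup>2) \<partial>lborel)"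
    unfolding k_def using \<eta> by (intro nn_integral_cong) (simp add: ennreal_mult[symmetric] ennreal_plus[symmetric] mult.assoc del: ennreal_plus)
  also have "\<dots> = ennreal (1 + \<eta>) * (\<integral>\<^sup>+y. ennreal ((cmod (real_dot z (M y)))\<^sup>2) \<partial>lborel)
     + ennreal ((1 + 1 / \<eta>) * (L\<^sup>2 / 4 * (norm z) ^ 4)) * u_mass"
    by (subst nn_integral_add) (auto simp: nn_integral_cmult)
  finally show ?thesis .
qed

definition nonlocal_energy :: "(real \<Rightarrow> ennreal) \<Rightarrow> real ^ 'n \<Rightarrow> ennreal" where
  "nonlocal_energy w x = (\<integral>\<^sup>+z. w (norm z) * ennreal ((cmod (increment x z))\<^sup>2 / (norm z)\<^sup>2) \<partial>lborel)"

lemma nonlocal_energy_meas: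
  assumes [measurable]: "w \<in> borel_measurable borel"
  shows "nonlocal_energy w \<in> borel_measurable borel"
  unfolding nonlocal_energy_def by measurable

text \<open>For \<open>|z| < \<delta>\<close> the segment estimate applies, and its main part integrates to \<open>2 Q |M|\<^sup>2\<close>. For
  \<open>|z| \<ge> \<delta>\<close> the crude bound \<open>4 \<parallel>u\<parallel>\<^sup>2 / \<delta>\<^sup>2\<close> suffices, since little mass of the weight lies there when
  it concentrates at 0.\<close>

theorem integral_nonlocal_energy_le:
  fixes \<omega> :: "real ^ 'n"
  assumes w[measurable]: "w \<in> borel_measurable borel" and mass: "(\<integral>\<^sup>+r. w r \<partial>radial_measure CARD('n)) = 1"
    and \<omega>: "norm \<omega> = 1" and \<eta>: "\<eta> > 0" and \<delta>: "\<delta> > 0"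
  shows "(\<integral>\<^sup>+x. nonlocal_energy w x \<partial>lborel) \<le>
     ennreal ((1 + \<eta>) * (2 * Q_const \<omega>)) * M_mass
     + ennreal ((1 + 1 / \<eta>) * (L\<^sup>2 / 4 * \<delta>\<^sup>2) * sphere_area TYPE('n)) * u_mass
     + ennreal (4 / \<delta>\<^sup>2 * sphere_area TYPE('n)) * u_mass * (\<integral>\<^sup>+r. w r * indicator {\<delta>..} r \<partial>radial_measure CARD('n))"
proof -
  let ?c1 = "(1 + 1 / \<eta>) * (L\<^sup>2 / 4 * \<delta>\<^sup>2)" and ?S = "sphere_area TYPE('n)"
  have Q: "Q_const \<omega> \<ge> 0" by (rule sphere_second_moment_unit(2)[OF \<omega>])
  have "(\<integral>\<^sup>+x. nonlocal_energy w x \<partial>lborel) =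
      (\<integral>\<^sup>+z. (\<integral>\<^sup>+x. w (norm z) * ennreal ((cmod (increment x z))\<^sup>2 / (norm z)\<^sup>2) \<partial>lborel) \<partial>lborel)"
    unfolding nonlocal_energy_def by (rule lborel_pair.Fubini'[symmetric]) measurable
  also have "\<dots> \<le> (\<integral>\<^sup>+z. ennreal (1 + \<eta>) * (\<integral>\<^sup>+y. w (norm z) * ennreal ((cmod (real_dot z (M y)))\<^sup>2 / (norm z)\<^sup>2) \<partial>lborel)
      + ennreal ?c1 * u_mass * w (norm z) + ennreal (4 / \<delta>\<^sup>2) * u_mass * (w (norm z) * indicator {\<delta>..} (norm z)) \<partial>lborel)"
  proof (rule nn_integral_mono)
    fix z :: "real ^ 'n"
    have pull: "(\<integral>\<^sup>+x. w (norm z) * ennreal (f x / (norm z)\<^sup>2) \<partial>lborel) = w (norm z) * (ennreal (1 / (norm z)\<^sup>2) * (\<integral>\<^sup>+x. ennreal (f x) \<partial>lborel))"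
      if [measurable]: "f \<in> borel_measurable borel" and "\<And>x. f x \<ge> 0" for f :: "real ^ 'n \<Rightarrow> real"
    proof -
      have "ennreal (f x / (norm z)\<^sup>2) = ennreal (1 / (norm z)\<^sup>2) * ennreal (f x)" for x
        using that by (simp add: ennreal_mult[symmetric])
      then show ?thesis by (simp add: nn_integral_cmult)
    qed
    have lhs: "(\<integral>\<^sup>+x. w (norm z) * ennreal ((cmod (increment x z))\<^sup>2 / (norm z)\<^sup>2) \<partial>lborel)
      = w (norm z) * (ennreal (1 / (norm z)\<^sup>2) * (\<integral>\<^sup>+x. ennreal ((cmod (increment x z))\<^sup>2) \<partial>lborel))"
      by (rule pull) auto
    have rhs: "(\<integral>\<^sup>+y. w (norm z) * ennreal ((cmod (real_dot z (M y)))\<^sup>2 / (norm z)\<^sup>2) \<partial>lborel)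
      = w (norm z) * (ennreal (1 / (norm z)\<^sup>2) * (\<integral>\<^sup>+y. ennreal ((cmod (real_dot z (M y)))\<^sup>2) \<partial>lborel))"
      by (rule pull) auto
    show "(\<integral>\<^sup>+x. w (norm z) * ennreal ((cmod (increment x z))\<^sup>2 / (norm z)\<^sup>2) \<partial>lborel) \<le>
      ennreal (1 + \<eta>) * (\<integral>\<^sup>+y. w (norm z) * ennreal ((cmod (real_dot z (M y)))\<^sup>2 / (norm z)\<^sup>2) \<partial>lborel)
      + ennreal ?c1 * u_mass * w (norm z) + ennreal (4 / \<delta>\<^sup>2) * u_mass * (w (norm z) * indicator {\<delta>..} (norm z))"
    proof (cases "norm z < \<delta>")
      case True
      let ?I = "\<integral>\<^sup>+y. ennreal ((cmod (real_dot z (M y)))\<^sup>2) \<partial>lborel"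
      have c1: "ennreal (1 / (norm z)\<^sup>2) * ennreal ((1 + 1 / \<eta>) * (L\<^sup>2 / 4 * (norm z) ^ 4)) \<le> ennreal ?c1"
      proof -
        have z2: "(norm z)\<^sup>2 \<le> \<delta>\<^sup>2" using True by (intro power_mono) auto
        have "1 / (norm z)\<^sup>2 * ((1 + 1 / \<eta>) * (L\<^sup>2 / 4 * (norm z) ^ 4)) = (1 + 1 / \<eta>) * (L\<^sup>2 / 4 * (norm z)\<^sup>2)"
          by (cases "z = 0") (simp_all add: power2_eq_square power4_eq_xxxx)
        also have "\<dots> \<le> ?c1" using \<eta> z2 by (intro mult_left_mono) auto
        finally have "ennreal (1 / (norm z)\<^sup>2 * ((1 + 1 / \<eta>) * (L\<^sup>2 / 4 * (norm z) ^ 4))) \<le> ennreal ?c1" by (rule ennreal_leI)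
        then show ?thesis using \<eta> by (subst ennreal_mult[symmetric]) auto
      qed
      have "ennreal (1 / (norm z)\<^sup>2) * (\<integral>\<^sup>+x. ennreal ((cmod (increment x z))\<^sup>2) \<partial>lborel)
        \<le> ennreal (1 / (norm z)\<^sup>2) * (ennreal (1 + \<eta>) * ?I + ennreal ((1 + 1 / \<eta>) * (L\<^sup>2 / 4 * (norm z) ^ 4)) * u_mass)"
        by (intro mult_left_mono integral_increment_sq_le[OF \<eta>]) simp
      also have "\<dots> = ennreal (1 + \<eta>) * (ennreal (1 / (norm z)\<^sup>2) * ?I)
          + (ennreal (1 / (norm z)\<^sup>2) * ennreal ((1 + 1 / \<eta>) * (L\<^sup>2 / 4 * (norm z) ^ 4))) * u_mass"
        by (simp add: distrib_left mult_ac)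
      also have "\<dots> \<le> ennreal (1 + \<eta>) * (ennreal (1 / (norm z)\<^sup>2) * ?I) + ennreal ?c1 * u_mass"
        by (intro add_left_mono mult_right_mono c1) simp
      finally have "w (norm z) * (ennreal (1 / (norm z)\<^sup>2) * (\<integral>\<^sup>+x. ennreal ((cmod (increment x z))\<^sup>2) \<partial>lborel))
        \<le> w (norm z) * (ennreal (1 + \<eta>) * (ennreal (1 / (norm z)\<^sup>2) * ?I) + ennreal ?c1 * u_mass)"
        by (rule mult_left_mono) simp
      also have "\<dots> = ennreal (1 + \<eta>) * (w (norm z) * (ennreal (1 / (norm z)\<^sup>2) * ?I)) + ennreal ?c1 * u_mass * w (norm z)"
        by (simp add: distrib_left mult_ac)
      finally show ?thesis unfolding lhs rhs by (rule order_trans) simp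
    next
      case False
      then have z: "norm z \<ge> \<delta>" "norm z > 0" using \<delta> by auto
      have "ennreal (1 / (norm z)\<^sup>2) * (\<integral>\<^sup>+x. ennreal ((cmod (increment x z))\<^sup>2) \<partial>lborel) \<le> ennreal (1 / \<delta>\<^sup>2) * (4 * u_mass)"
        using z \<delta> by (intro mult_mono integral_increment_sq_le_mass ennreal_leI divide_left_mono power_mono) auto
      also have "\<dots> = ennreal (4 / \<delta>\<^sup>2) * u_mass"
      proof -
        have "ennreal (1 / \<delta>\<^sup>2) * 4 = ennreal (4 / \<delta>\<^sup>2)"
          using ennreal_mult[of "1 / \<delta>\<^sup>2" 4] by simp
        then show ?thesis by (simp add: mult.assoc[symmetric])
      qed
      finally have "w (norm z) * (ennreal (1 / (norm z)\<^sup>2) * (\<integral>\<^sup>+x. ennreal ((cmod (increment x z))\<^sup>2) \<partial>lborel))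
        \<le> w (norm z) * (ennreal (4 / \<delta>\<^sup>2) * u_mass)" by (rule mult_left_mono) simp
      also have "\<dots> = ennreal (4 / \<delta>\<^sup>2) * u_mass * (w (norm z) * indicator {\<delta>..} (norm z))"
        using z by (simp add: mult_ac)
      finally show ?thesis unfolding lhs by (rule order_trans) simp
    qed
  qed
  also have "\<dots> = ennreal (1 + \<eta>) * (\<integral>\<^sup>+z. (\<integral>\<^sup>+y. w (norm z) * ennreal ((cmod (real_dot z (M y)))\<^sup>2 / (norm z)\<^sup>2) \<partial>lborel) \<partial>lborel)
      + ennreal ?c1 * u_mass * (\<integral>\<^sup>+z. w (norm (z :: real ^ 'n)) \<partial>lborel)
      + ennreal (4 / \<delta>\<^sup>2) * u_mass * (\<integral>\<^sup>+z. w (norm (z :: real ^ 'n)) * indicator {\<delta>..} (norm z) \<partial>lborel)"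
    by (subst nn_integral_add, measurable, subst nn_integral_add, measurable) (simp add: nn_integral_cmult)
  also have "(\<integral>\<^sup>+z. (\<integral>\<^sup>+y. w (norm z) * ennreal ((cmod (real_dot z (M y)))\<^sup>2 / (norm z)\<^sup>2) \<partial>lborel) \<partial>lborel)
      = (\<integral>\<^sup>+y. (\<integral>\<^sup>+z. w (norm z) * ennreal ((cmod (real_dot z (M y)))\<^sup>2 / (norm z)\<^sup>2) \<partial>lborel) \<partial>lborel)"
    by (rule lborel_pair.Fubini') measurable
  also have "\<dots> = (\<integral>\<^sup>+y. ennreal (2 * Q_const \<omega>) * ennreal ((norm (M y))\<^sup>2) \<partial>lborel)"
    using Q by (simp add: nn_integral_radial_quadratic[OF w \<omega>] mass ennreal_mult)
  also have "\<dots> = ennreal (2 * Q_const \<omega>) * M_mass" by (rule nn_integral_cmult) measurable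
  also have "(\<integral>\<^sup>+z. w (norm (z :: real ^ 'n)) \<partial>lborel) = ennreal ?S"
    by (simp add: nn_integral_radial_mass mass emeasure_sphere_area)
  also have "(\<integral>\<^sup>+z. w (norm (z :: real ^ 'n)) * indicator {\<delta>..} (norm z) \<partial>lborel) = ennreal ?S * (\<integral>\<^sup>+r. w r * indicator {\<delta>..} r \<partial>radial_measure CARD('n))"
    by (subst nn_integral_radial_mass[of "\<lambda>r. w r * indicator {\<delta>..} r"]) (auto simp: emeasure_sphere_area)
  also have "ennreal (1 + \<eta>) * (ennreal (2 * Q_const \<omega>) * M_mass) = ennreal ((1 + \<eta>) * (2 * Q_const \<omega>)) * M_mass"
    using \<eta> Q by (subst ennreal_mult) (auto simp: mult.assoc)
  also have "ennreal ?c1 * u_mass * ennreal ?S = ennreal (?c1 * ?S) * u_mass"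
    using \<eta> sphere_area_nonneg[where 'n = 'n] by (subst (2) ennreal_mult) (auto simp: mult_ac)
  also have "ennreal (4 / \<delta>\<^sup>2) * u_mass * (ennreal ?S * (\<integral>\<^sup>+r. w r * indicator {\<delta>..} r \<partial>radial_measure CARD('n)))
     = ennreal (4 / \<delta>\<^sup>2 * ?S) * u_mass * (\<integral>\<^sup>+r. w r * indicator {\<delta>..} r \<partial>radial_measure CARD('n))"
  proof -
    have "ennreal (4 / \<delta>\<^sup>2 * ?S) = ennreal (4 / \<delta>\<^sup>2) * ennreal ?S"
      using sphere_area_nonneg[where 'n = 'n] by (intro ennreal_mult) auto
    then show ?thesis by (simp only: mult_ac)
  qed
  finally show ?thesis .
qed

end

section \<open>Pointwise convergence\<close>

text \<open>With \<open>X\<close>, \<open>Y\<close>, \<open>E\<close> the squared norms of \<open>f\<close>, \<open>g\<close> and \<open>f - g\<close>, the hypotheses are the triangle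
  inequality in squared form. The parameter \<open>\<eta>\<close> must be fixed before \<open>E\<close> becomes small.\<close>

lemma tendsto_of_young_sandwich:
  fixes X Y E :: "nat \<Rightarrow> ennreal" and l :: real
  assumes Y: "Y \<longlonglongrightarrow> ennreal l" and l: "l \<ge> 0" and E: "E \<longlonglongrightarrow> 0"
    and XY: "\<And>n \<eta>. \<eta> > 0 \<Longrightarrow> X n \<le> ennreal (1 + \<eta>) * Y n + ennreal (1 + 1 / \<eta>) * E n"
    and YX: "\<And>n \<eta>. \<eta> > 0 \<Longrightarrow> Y n \<le> ennreal (1 + \<eta>) * X n + ennreal (1 + 1 / \<eta>) * E n"
  shows "X \<longlonglongrightarrow> ennreal l"
proof -
  define x y e where "x n = enn2real (X n)" and "y n = enn2real (Y n)" and "e n = enn2real (E n)" for n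
  have nn: "x n \<ge> 0" "y n \<ge> 0" "e n \<ge> 0" for n by (simp_all add: x_def y_def e_def)
  have yl: "y \<longlonglongrightarrow> l" unfolding y_def by (rule tendsto_enn2real[OF Y l])
  have e0: "e \<longlonglongrightarrow> 0" unfolding e_def by (rule tendsto_enn2real) (use E in simp_all)
  have "eventually (\<lambda>n. Y n < top) sequentially" using order_tendstoD(2)[OF Y, of top] by simp
  moreover have "eventually (\<lambda>n. E n < top) sequentially" using order_tendstoD(2)[OF E, of top] by simp
  ultimately have fin: "eventually (\<lambda>n. X n = ennreal (x n) \<and> Y n = ennreal (y n) \<and> E n = ennreal (e n)) sequentially"
  proof eventually_elim
    case (elim n)
    have "X n \<le> ennreal (1 + 1) * Y n + ennreal (1 + 1 / 1) * E n" using XY[of 1 n] by simp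
    also have "\<dots> < top" using elim by (simp add: ennreal_mult_less_top)
    finally have "X n < top" .
    then show ?case using elim by (simp add: x_def y_def e_def)
  qed
  have rXY: "eventually (\<lambda>n. x n \<le> (1 + \<eta>) * y n + (1 + 1 / \<eta>) * e n \<and> y n \<le> (1 + \<eta>) * x n + (1 + 1 / \<eta>) * e n) sequentially"
    if "\<eta> > 0" for \<eta>
    using fin
  proof eventually_elim
    case (elim n)
    have t: "ennreal (1 + \<eta>) * ennreal a + ennreal (1 + 1 / \<eta>) * ennreal b = ennreal ((1 + \<eta>) * a + (1 + 1 / \<eta>) * b)"
      if "a \<ge> 0" "b \<ge> 0" for a b
    proof -
      have "ennreal (1 + \<eta>) * ennreal a = ennreal ((1 + \<eta>) * a)" "ennreal (1 + 1 / \<eta>) * ennreal b = ennreal ((1 + 1 / \<eta>) * b)"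
        using that \<open>\<eta> > 0\<close> by (auto intro!: ennreal_mult[symmetric] simp del: ennreal_plus)
      then show ?thesis using that \<open>\<eta> > 0\<close> by (simp only:) (rule ennreal_plus[symmetric], auto)
    qed
    have "ennreal (x n) \<le> ennreal ((1 + \<eta>) * y n + (1 + 1 / \<eta>) * e n)"
      using XY[OF that, of n] elim t nn by simp
    moreover have "ennreal (y n) \<le> ennreal ((1 + \<eta>) * x n + (1 + 1 / \<eta>) * e n)"
      using YX[OF that, of n] elim t nn by simp
    ultimately show ?case using nn[of n] that by (subst (asm) (1 2) ennreal_le_iff) auto
  qed
  have "(\<lambda>n. x n - y n) \<longlonglongrightarrow> 0"
  proof (rule LIMSEQ_I)
    fix r :: real assume r: "r > 0"
    define \<eta> where "\<eta> = r / (4 * (l + 2))"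
    have \<eta>: "\<eta> > 0" using r l by (simp add: \<eta>_def)
    have "(\<lambda>n. (1 + 1 / \<eta>) * e n) \<longlonglongrightarrow> (1 + 1 / \<eta>) * 0" by (intro tendsto_mult e0 tendsto_const)
    then have "eventually (\<lambda>n. (1 + 1 / \<eta>) * e n < r / 2) sequentially"
      using r by (intro order_tendstoD(2)[of _ 0]) auto
    moreover have "eventually (\<lambda>n. y n < l + 1) sequentially" using order_tendstoD(2)[OF yl] by simp
    moreover have "eventually (\<lambda>n. e n < 1) sequentially" using order_tendstoD(2)[OF e0] by simp
    ultimately have "eventually (\<lambda>n. norm (x n - y n - 0) < r) sequentially"
      using rXY[OF \<eta>] rXY[of 1, simplified]
    proof eventually_elim
      case (elim n)
      have "x n \<le> 2 * y n + 2 * e n" using elim(5) by simp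
      then have xb: "x n \<le> 2 * (l + 2)" using elim(2,3) by simp
      have yb: "y n \<le> 2 * (l + 2)" using elim(2) l by simp
      have "\<eta> * x n \<le> \<eta> * (2 * (l + 2))" "\<eta> * y n \<le> \<eta> * (2 * (l + 2))"
        using \<eta> xb yb by auto
      moreover have "\<eta> * (2 * (l + 2)) = r / 2" using l by (simp add: \<eta>_def field_simps)
      moreover have "(1 + \<eta>) * y n = y n + \<eta> * y n" "(1 + \<eta>) * x n = x n + \<eta> * x n"
        by (simp_all add: distrib_right)
      ultimately have "x n - y n < r" "y n - x n < r"
        using elim(1,4) by linarith+
      then show ?case by (simp add: abs_less_iff)
    qed
    then show "\<exists>no. \<forall>n\<ge>no. norm (x n - y n - 0) < r" by (simp add: eventually_sequentially)
  qed
  from tendsto_add[OF this yl] have "x \<longlonglongrightarrow> l" by simp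
  then have "(\<lambda>n. ennreal (x n)) \<longlonglongrightarrow> ennreal l" by (rule tendsto_ennrealI)
  moreover have "eventually (\<lambda>n. ennreal (x n) = X n) sequentially" using fin by eventually_elim auto
  ultimately show ?thesis by (rule Lim_transform_eventually)
qed

text \<open>For \<open>\<delta> \<le> s \<le> 1\<close> the total over the unit ball is at most a multiple of \<open>s\<^sup>N\<close>.\<close>

lemma ball_growth_bound:
  fixes h :: "real ^ 'n \<Rightarrow> ennreal"
  assumes fin: "(\<integral>\<^sup>+z. h z * indicator (cball 0 1) z \<partial>lborel) < \<infinity>" and \<delta>: "\<delta> > 0" and c: "c \<ge> 0"
    and bound: "\<And>s. 0 < s \<Longrightarrow> s < \<delta> \<Longrightarrow> (\<integral>\<^sup>+z. h z * indicator (cball 0 s) z \<partial>lborel) \<le> ennreal (c * s ^ CARD('n))"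
  obtains C where "C \<ge> 0" "\<And>s. 0 < s \<Longrightarrow> s \<le> 1 \<Longrightarrow> (\<integral>\<^sup>+z. h z * indicator (cball 0 s) z \<partial>lborel) \<le> ennreal (C * s ^ CARD('n))"
proof
  define B where "B = enn2real (\<integral>\<^sup>+z. h z * indicator (cball 0 1) z \<partial>lborel)"
  have B: "(\<integral>\<^sup>+z. h z * indicator (cball 0 1) z \<partial>lborel) = ennreal B" "B \<ge> 0"
    using fin by (simp_all add: B_def)
  let ?C = "c + B / \<delta> ^ CARD('n)"
  show "?C \<ge> 0" using B c \<delta> by simp
  fix s :: real assume s: "0 < s" "s \<le> 1"
  show "(\<integral>\<^sup>+z. h z * indicator (cball 0 s) z \<partial>lborel) \<le> ennreal (?C * s ^ CARD('n))"
  proof (cases "s < \<delta>")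
    case True
    have "c * s ^ CARD('n) \<le> ?C * s ^ CARD('n)" using B \<delta> s by (intro mult_right_mono) auto
    then show ?thesis using bound[OF s(1) True] by (meson ennreal_leI order_trans)
  next
    case False
    have "(\<integral>\<^sup>+z. h z * indicator (cball 0 s) z \<partial>lborel) \<le> (\<integral>\<^sup>+z. h z * indicator (cball 0 1) z \<partial>lborel)"
      using s by (intro nn_integral_mono mult_left_mono) (auto simp: indicator_def)
    also have "\<dots> = ennreal B" by (rule B)
    also have "\<dots> \<le> ennreal (?C * s ^ CARD('n))"
    proof (rule ennreal_leI)
      have "\<delta> ^ CARD('n) \<le> s ^ CARD('n)" using False \<delta> by (intro power_mono) auto
      then have "B * \<delta> ^ CARD('n) \<le> B * s ^ CARD('n)" using B by (intro mult_left_mono)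
      then have "B \<le> B / \<delta> ^ CARD('n) * s ^ CARD('n)" using \<delta> by (simp add: field_simps)
      also have "\<dots> \<le> ?C * s ^ CARD('n)" using c s by (intro mult_right_mono) auto
      finally show "B \<le> ?C * s ^ CARD('n)" .
    qed
    finally show ?thesis .
  qed
qed

lemma nn_integral_tail_tendsto_0:
  fixes f :: "'a \<Rightarrow> real"
  assumes [measurable]: "f \<in> borel_measurable M" and f: "\<And>x. f x \<ge> 0" and fin: "(\<integral>\<^sup>+x. ennreal (f x) \<partial>M) < \<infinity>"
  shows "(\<lambda>k::nat. \<integral>\<^sup>+x. ennreal (f x) * indicator {x. f x > real k} x \<partial>M) \<longlonglongrightarrow> 0"
proof -
  have "(\<lambda>k::nat. \<integral>\<^sup>+x. ennreal (f x) * indicator {x. f x > real k} x \<partial>M) \<longlonglongrightarrow> (\<integral>\<^sup>+x. 0 \<partial>M)"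
  proof (rule nn_integral_dominated_convergence[where w = "\<lambda>x. ennreal (f x)"])
    show "AE x in M. (\<lambda>k. ennreal (f x) * indicator {x. f x > real k} x) \<longlonglongrightarrow> 0"
    proof (rule AE_I2)
      fix x
      obtain K :: nat where K: "f x \<le> real K" using real_arch_simple by blast
      have "eventually (\<lambda>k. ennreal (f x) * indicator {x. f x > real k} x = 0) sequentially"
        unfolding eventually_sequentially
        by (rule exI[of _ K]) (use K in \<open>auto simp: indicator_def\<close>)
      then show "(\<lambda>k. ennreal (f x) * indicator {x. f x > real k} x) \<longlonglongrightarrow> 0"
        by (rule tendsto_eventually)
    qed
  qed (use fin in \<open>auto simp: indicator_def\<close>)
  then show ?thesis by simp
qed

text \<open>The values lie in \<open>ennreal\<close>, so that masses may be computed before finiteness is known. The mass is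
  taken against \<open>radial_measure\<close>, that is with the factor \<open>r^(N - 1)\<close>.\<close>

locale mollifier_weights =
  fixes w :: "nat \<Rightarrow> real \<Rightarrow> ennreal" and N :: nat and C :: real
  assumes w_meas[measurable]: "\<And>n. w n \<in> borel_measurable borel"
    and mass: "\<And>n. (\<integral>\<^sup>+r. w n r \<partial>radial_measure N) = 1"
    and tail: "\<And>\<delta>. \<delta> > 0 \<Longrightarrow> (\<lambda>n. \<integral>\<^sup>+r. w n r * indicator {\<delta>..} r \<partial>radial_measure N) \<longlonglongrightarrow> 0"
    and C_nonneg: "C \<ge> 0"
    and growth: "\<And>n t. t > 1 \<Longrightarrow> w n t \<le> ennreal (C * t\<^sup>2)"

context magnetic_function
begin

text \<open>The exceptional set of \<open>x\<close> depended on \<open>z\<close>. By Fubini almost every \<open>x\<close> is good for almost every \<open>z\<close>.\<close>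

lemma AE_increment_minus_linear:
  "AE x in lborel. AE z in lborel. norm z \<le> 1 \<longrightarrow> ennreal ((cmod (increment x z - real_dot z (M x)))\<^sup>2) \<le> segment_majorant x z"
proof (subst lborel_pair.AE_commute)
  show "{x \<in> space (lborel \<Otimes>\<^sub>M lborel). norm (snd x) \<le> 1 \<longrightarrow> ennreal ((cmod (increment (fst x) (snd x) - real_dot (snd x) (M (fst x))))\<^sup>2) \<le> segment_majorant (fst x) (snd x)}
    \<in> sets (lborel \<Otimes>\<^sub>M lborel)"
    by measurable
  show "AE z in lborel. AE x in lborel. norm z \<le> 1 \<longrightarrow> ennreal ((cmod (increment x z - real_dot z (M x)))\<^sup>2) \<le> segment_majorant x z"
  proof (rule AE_I2)
    fix z :: "real ^ 'n"
    show "AE x in lborel. norm z \<le> 1 \<longrightarrow> ennreal ((cmod (increment x z - real_dot z (M x)))\<^sup>2) \<le> segment_majorant x z"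
      using increment_minus_linear_sq_le_segment[of z] by (cases "norm z \<le> 1") auto
  qed
qed

text \<open>The segment majorant is bounded by the average over \<open>t\<close> of a fixed function of \<open>t z\<close>, so that
  \<open>radial_segment_average_le\<close> applies. The terms with \<open>|z|\<^sup>2\<close> keep a factor \<open>R\<^sup>2\<close>, the gain on small
  balls.\<close>

lemma near_error_le:
  fixes x :: "real ^ 'n"
  defines "e \<equiv> \<lambda>z. ennreal ((cmod (increment x z - real_dot z (M x)))\<^sup>2 / (norm z)\<^sup>2)"
  assumes lin: "AE z in lborel. norm z \<le> 1 \<longrightarrow> ennreal ((cmod (increment x z - real_dot z (M x)))\<^sup>2) \<le> segment_majorant x z"
    and v[measurable]: "v \<in> borel_measurable borel" and R: "0 < R" "R \<le> 1" and c: "c \<ge> 0" and Cu: "Cu \<ge> 0"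
    and hM: "\<And>s. 0 < s \<Longrightarrow> s \<le> R \<Longrightarrow> (\<integral>\<^sup>+z. ennreal ((norm (M (x + z) - M x))\<^sup>2) * indicator (cball 0 s) z \<partial>lborel) \<le> ennreal (c * s ^ CARD('n))"
    and hu: "\<And>s. 0 < s \<Longrightarrow> s \<le> R \<Longrightarrow> (\<integral>\<^sup>+z. ennreal ((cmod (u (x + z)))\<^sup>2) * indicator (cball 0 s) z \<partial>lborel) \<le> ennreal (Cu * s ^ CARD('n))"
  shows "(\<integral>\<^sup>+z. (v (norm z) * indicator {..R} (norm z)) * e z \<partial>lborel) \<le>
    ennreal (2 ^ CARD('n) * (3 * c + R\<^sup>2 * (3 * ((norm (A x) + L) * norm (M x))\<^sup>2 * unit_ball_vol (real CARD('n)) + L\<^sup>2 * Cu)))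
      * (\<integral>\<^sup>+r. v r * indicator {..R} r \<partial>radial_measure CARD('n))"
proof -
  let ?\<kappa> = "3 * ((norm (A x) + L) * norm (M x))\<^sup>2"
  let ?K = "unit_ball_vol (real CARD('n))"
  have K: "?K \<ge> 0" by simp
  define h where "h y = ennreal (3 * (norm (M (x + y) - M x))\<^sup>2 + R\<^sup>2 * (?\<kappa> + L\<^sup>2 * (cmod (u (x + y)))\<^sup>2))" for y
  have hm[measurable]: "h \<in> borel_measurable borel" unfolding h_def by measurable
  have cb[measurable]: "cball (0::real^'n) s \<in> sets borel" for s by simp
  have "(\<integral>\<^sup>+z. (v (norm z) * indicator {..R} (norm z)) * e z \<partial>lborel)
     \<le> (\<integral>\<^sup>+z. (v (norm z) * indicator {..R} (norm z)) * (\<integral>\<^sup>+t. h (t *\<^sub>R z) * indicator {0..1} t \<partial>lborel) \<partial>lborel)"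
  proof (rule nn_integral_mono_AE)
    show "AE z in lborel. (v (norm z) * indicator {..R} (norm z)) * e z \<le> (v (norm z) * indicator {..R} (norm z)) * (\<integral>\<^sup>+t. h (t *\<^sub>R z) * indicator {0..1} t \<partial>lborel)"
      using lin
    proof eventually_elim
      case (elim z)
      have "e z \<le> (\<integral>\<^sup>+t. h (t *\<^sub>R z) * indicator {0..1} t \<partial>lborel)" if z: "norm z \<le> R"
      proof (cases "z = 0")
        case True
        then show ?thesis by (simp add: e_def)
      next
        case False
        have z1: "norm z \<le> 1" using z R by simp
        have z2: "(norm z)\<^sup>2 \<le> R\<^sup>2" using z by (intro power_mono) auto
        have "e z = ennreal (1 / (norm z)\<^sup>2) * ennreal ((cmod (increment x z - real_dot z (M x)))\<^sup>2)"
          by (simp add: e_def ennreal_mult[symmetric])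
        also have "\<dots> \<le> ennreal (1 / (norm z)\<^sup>2) * (\<integral>\<^sup>+t. ennreal ((norm z)\<^sup>2 * (3 * (norm (M (x + t *\<^sub>R z) - M x))\<^sup>2
            + (norm z)\<^sup>2 * (?\<kappa> + L\<^sup>2 * (cmod (u (x + t *\<^sub>R z)))\<^sup>2))) * indicator {0..1} t \<partial>lborel)"
          using elim z1 by (intro mult_left_mono) auto
        also have "\<dots> = (\<integral>\<^sup>+t. ennreal (1 / (norm z)\<^sup>2) * (ennreal ((norm z)\<^sup>2 * (3 * (norm (M (x + t *\<^sub>R z) - M x))\<^sup>2
            + (norm z)\<^sup>2 * (?\<kappa> + L\<^sup>2 * (cmod (u (x + t *\<^sub>R z)))\<^sup>2))) * indicator {0..1} t) \<partial>lborel)"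
          by (rule nn_integral_cmult[symmetric]) measurable
        also have "\<dots> \<le> (\<integral>\<^sup>+t. h (t *\<^sub>R z) * indicator {0..1} t \<partial>lborel)"
        proof (rule nn_integral_mono)
          fix t :: real
          let ?b = "3 * (norm (M (x + t *\<^sub>R z) - M x))\<^sup>2 + (norm z)\<^sup>2 * (?\<kappa> + L\<^sup>2 * (cmod (u (x + t *\<^sub>R z)))\<^sup>2)"
          have b: "?b \<ge> 0" by simp
          have "ennreal (1 / (norm z)\<^sup>2) * ennreal ((norm z)\<^sup>2 * ?b) = ennreal (1 / (norm z)\<^sup>2 * ((norm z)\<^sup>2 * ?b))"
            using b by (intro ennreal_mult[symmetric]) auto
          also have "1 / (norm z)\<^sup>2 * ((norm z)\<^sup>2 * ?b) = ?b" using False by simp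
          also have "ennreal ?b \<le> h (t *\<^sub>R z)"
            unfolding h_def by (intro ennreal_leI add_left_mono mult_right_mono z2) simp
          finally have "ennreal (1 / (norm z)\<^sup>2) * ennreal ((norm z)\<^sup>2 * ?b) \<le> h (t *\<^sub>R z)" .
          then show "ennreal (1 / (norm z)\<^sup>2) * (ennreal ((norm z)\<^sup>2 * ?b) * indicator {0..1} t) \<le> h (t *\<^sub>R z) * indicator {0..1} t"
            by (auto simp: indicator_def)
        qed
        finally show ?thesis .
      qed
      then show ?case by (cases "norm z \<le> R") (auto intro: mult_left_mono)
    qed
  qed
  also have "\<dots> \<le> ennreal (2 ^ CARD('n) * (3 * c + R\<^sup>2 * (?\<kappa> * ?K + L\<^sup>2 * Cu))) * (\<integral>\<^sup>+r. v r * indicator {..R} r \<partial>radial_measure CARD('n))"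
  proof (rule radial_segment_average_le[OF hm v])
    show "0 \<le> 3 * c + R\<^sup>2 * (?\<kappa> * ?K + L\<^sup>2 * Cu)" using c Cu by (intro add_nonneg_nonneg mult_nonneg_nonneg) auto
    fix s :: real assume s: "0 < s" "s \<le> R"
    have "(\<integral>\<^sup>+z. h z * indicator (cball 0 s) z \<partial>lborel) =
      (\<integral>\<^sup>+z. 3 * (ennreal ((norm (M (x + z) - M x))\<^sup>2) * indicator (cball 0 s) z) + (ennreal (R\<^sup>2 * ?\<kappa>) * indicator (cball 0 s) z
        + ennreal (R\<^sup>2 * L\<^sup>2) * (ennreal ((cmod (u (x + z)))\<^sup>2) * indicator (cball 0 s) z)) \<partial>lborel)"
    proof (rule nn_integral_cong)
      fix z
      have "h z = 3 * ennreal ((norm (M (x + z) - M x))\<^sup>2) + (ennreal (R\<^sup>2 * ?\<kappa>) + ennreal (R\<^sup>2 * L\<^sup>2) * ennreal ((cmod (u (x + z)))\<^sup>2))"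
      proof -
        have eq1: "ennreal (3 * a + (b + d * f)) = 3 * ennreal a + (ennreal b + ennreal d * ennreal f)"
          if "a \<ge> 0" "b \<ge> 0" "d \<ge> 0" "f \<ge> 0" for a b d f
          using that by (simp add: ennreal_mult)
        have eq2: "3 * (norm (M (x + z) - M x))\<^sup>2 + R\<^sup>2 * (?\<kappa> + L\<^sup>2 * (cmod (u (x + z)))\<^sup>2)
          = 3 * (norm (M (x + z) - M x))\<^sup>2 + (R\<^sup>2 * ?\<kappa> + R\<^sup>2 * L\<^sup>2 * (cmod (u (x + z)))\<^sup>2)" by (simp add: algebra_simps)
        show ?thesis unfolding h_def eq2 by (rule eq1) auto
      qed
      then show "h z * indicator (cball 0 s) z = 3 * (ennreal ((norm (M (x + z) - M x))\<^sup>2) * indicator (cball 0 s) z) + (ennreal (R\<^sup>2 * ?\<kappa>) * indicator (cball 0 s) z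
        + ennreal (R\<^sup>2 * L\<^sup>2) * (ennreal ((cmod (u (x + z)))\<^sup>2) * indicator (cball 0 s) z))"
        by (auto simp: indicator_def)
    qed
    also have "\<dots> = 3 * (\<integral>\<^sup>+z. ennreal ((norm (M (x + z) - M x))\<^sup>2) * indicator (cball 0 s) z \<partial>lborel)
       + (ennreal (R\<^sup>2 * ?\<kappa>) * emeasure lborel (cball (0::real^'n) s)
         + ennreal (R\<^sup>2 * L\<^sup>2) * (\<integral>\<^sup>+z. ennreal ((cmod (u (x + z)))\<^sup>2) * indicator (cball 0 s) z \<partial>lborel))"
    proof -
      have [measurable]: "(\<lambda>z. indicator (cball (0::real^'n) s) z :: ennreal) \<in> borel_measurable borel"
        by (rule borel_measurable_indicator) simp
      show ?thesis
        by (subst nn_integral_add, measurable, subst nn_integral_add, measurable) (simp add: nn_integral_cmult nn_integral_cmult_indicator)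
    qed
    also have "\<dots> \<le> 3 * ennreal (c * s ^ CARD('n)) + (ennreal (R\<^sup>2 * ?\<kappa>) * ennreal (?K * s ^ CARD('n)) + ennreal (R\<^sup>2 * L\<^sup>2) * ennreal (Cu * s ^ CARD('n)))"
      using s by (intro add_mono mult_left_mono hM hu) (auto simp: emeasure_cball)
    also have "\<dots> = ennreal ((3 * c + R\<^sup>2 * (?\<kappa> * ?K + L\<^sup>2 * Cu)) * s ^ CARD('n))"
    proof -
      have eq: "3 * ennreal a + (ennreal b * ennreal d + ennreal f * ennreal g) = ennreal (3 * a + (b * d + f * g))"
        if "a \<ge> 0" "b \<ge> 0" "d \<ge> 0" "f \<ge> 0" "g \<ge> 0" for a b d f g
        using that by (simp add: ennreal_mult)
      have "3 * ennreal (c * s ^ CARD('n)) + (ennreal (R\<^sup>2 * ?\<kappa>) * ennreal (?K * s ^ CARD('n)) + ennreal (R\<^sup>2 * L\<^sup>2) * ennreal (Cu * s ^ CARD('n)))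
        = ennreal (3 * (c * s ^ CARD('n)) + ((R\<^sup>2 * ?\<kappa>) * (?K * s ^ CARD('n)) + (R\<^sup>2 * L\<^sup>2) * (Cu * s ^ CARD('n))))"
        by (rule eq) (use c Cu s in auto)
      also have "3 * (c * s ^ CARD('n)) + ((R\<^sup>2 * ?\<kappa>) * (?K * s ^ CARD('n)) + (R\<^sup>2 * L\<^sup>2) * (Cu * s ^ CARD('n)))
        = (3 * c + R\<^sup>2 * (?\<kappa> * ?K + L\<^sup>2 * Cu)) * s ^ CARD('n)" by (simp add: algebra_simps)
      finally show ?thesis .
    qed
    finally show "(\<integral>\<^sup>+z. h z * indicator (cball 0 s) z \<partial>lborel) \<le> ennreal ((3 * c + R\<^sup>2 * (?\<kappa> * ?K + L\<^sup>2 * Cu)) * s ^ CARD('n))" .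
  qed
  finally show ?thesis .
qed

text \<open>On a small ball the error is small because \<open>x\<close> is a Lebesgue point; on the remaining annulus it is
  bounded per unit of mass, and the mass tends to 0. Both parts use \<open>near_error_le\<close>.\<close>

lemma near_error_tendsto_0:
  fixes x :: "real ^ 'n"
  assumes w: "mollifier_weights w CARD('n) C"
    and lin: "AE z in lborel. norm z \<le> 1 \<longrightarrow> ennreal ((cmod (increment x z - real_dot z (M x)))\<^sup>2) \<le> segment_majorant x z"
    and LM: "\<forall>\<epsilon>>0. \<exists>\<delta>>0. \<forall>s. 0 < s \<and> s < \<delta> \<longrightarrow>
       (\<integral>\<^sup>+z. ennreal ((norm (M (x + z) - M x))\<^sup>2) * indicator (cball 0 s) z \<partial>lborel) \<le> ennreal (\<epsilon> * s ^ CARD('n))"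
    and Lu: "\<forall>\<epsilon>>0. \<exists>\<delta>>0. \<forall>s. 0 < s \<and> s < \<delta> \<longrightarrow>
       (\<integral>\<^sup>+z. ennreal ((cmod (u (x + z)))\<^sup>2) * indicator (cball 0 s) z \<partial>lborel) \<le> ennreal (2 ^ CARD('n) * ((cmod (u x))\<^sup>2 + \<epsilon>) * s ^ CARD('n))"
  shows "(\<lambda>n. \<integral>\<^sup>+z. (w n (norm z) * indicator {..1} (norm z)) * ennreal ((cmod (increment x z - real_dot z (M x)))\<^sup>2 / (norm z)\<^sup>2) \<partial>lborel) \<longlonglongrightarrow> 0"
proof -
  interpret mollifier_weights w "CARD('n)" C by (rule w)
  let ?e = "\<lambda>z. ennreal ((cmod (increment x z - real_dot z (M x)))\<^sup>2 / (norm z)\<^sup>2)"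
  have cb[measurable]: "(\<lambda>z. indicator (cball (0::real^'n) s) z :: ennreal) \<in> borel_measurable borel" for s
    by (rule borel_measurable_indicator) simp
  obtain Cu where Cu: "Cu \<ge> 0" "\<And>s. 0 < s \<Longrightarrow> s \<le> 1 \<Longrightarrow> (\<integral>\<^sup>+z. ennreal ((cmod (u (x + z)))\<^sup>2) * indicator (cball 0 s) z \<partial>lborel) \<le> ennreal (Cu * s ^ CARD('n))"
  proof -
    obtain \<delta> where \<delta>: "\<delta> > 0" "\<And>s. 0 < s \<Longrightarrow> s < \<delta> \<Longrightarrow> (\<integral>\<^sup>+z. ennreal ((cmod (u (x + z)))\<^sup>2) * indicator (cball 0 s) z \<partial>lborel) \<le> ennreal (2 ^ CARD('n) * ((cmod (u x))\<^sup>2 + 1) * s ^ CARD('n))"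
      using Lu[rule_format, of 1] by auto
    have "(\<integral>\<^sup>+z. ennreal ((cmod (u (x + z)))\<^sup>2) * indicator (cball 0 1) z \<partial>lborel) \<le> (\<integral>\<^sup>+z. ennreal ((cmod (u (z + x)))\<^sup>2) \<partial>lborel)"
      by (intro nn_integral_mono) (auto simp: indicator_def add.commute)
    also have "\<dots> = u_mass" by (rule nn_integral_lborel_translate[of "\<lambda>y. ennreal ((cmod (u y))\<^sup>2)"]) measurable
    also have "\<dots> < \<infinity>" by (rule u_fin)
    finally have fin: "(\<integral>\<^sup>+z. ennreal ((cmod (u (x + z)))\<^sup>2) * indicator (cball 0 1) z \<partial>lborel) < \<infinity>" .
    have c0: "(0::real) \<le> 2 ^ CARD('n) * ((cmod (u x))\<^sup>2 + 1)" by simp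
    show ?thesis by (rule ball_growth_bound[OF fin \<delta>(1) c0], erule \<delta>(2), assumption, rule that, assumption, blast)
  qed
  obtain CM where CM: "CM \<ge> 0" "\<And>s. 0 < s \<Longrightarrow> s \<le> 1 \<Longrightarrow> (\<integral>\<^sup>+z. ennreal ((norm (M (x + z) - M x))\<^sup>2) * indicator (cball 0 s) z \<partial>lborel) \<le> ennreal (CM * s ^ CARD('n))"
  proof -
    obtain \<delta> where \<delta>: "\<delta> > 0" "\<And>s. 0 < s \<Longrightarrow> s < \<delta> \<Longrightarrow> (\<integral>\<^sup>+z. ennreal ((norm (M (x + z) - M x))\<^sup>2) * indicator (cball 0 s) z \<partial>lborel) \<le> ennreal (1 * s ^ CARD('n))"
      using LM[rule_format, of 1] by auto
    have "(\<integral>\<^sup>+z. ennreal ((norm (M (x + z) - M x))\<^sup>2) * indicator (cball 0 1) z \<partial>lborel)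
      \<le> (\<integral>\<^sup>+z. 2 * ennreal ((norm (M (z + x)))\<^sup>2) + ennreal (2 * (norm (M x))\<^sup>2) * indicator (cball 0 1) z \<partial>lborel)"
    proof (rule nn_integral_mono)
      fix z
      have "(norm (M (x + z) - M x))\<^sup>2 \<le> (norm (M (x + z)) + norm (M x))\<^sup>2"
        by (intro power_mono norm_triangle_ineq4) simp
      also have "\<dots> \<le> 2 * (norm (M (x + z)))\<^sup>2 + 2 * (norm (M x))\<^sup>2"
        using square_sum2_le[of 1 "norm (M (x + z))" "norm (M x)"] by simp
      finally have "ennreal ((norm (M (x + z) - M x))\<^sup>2) \<le> ennreal (2 * (norm (M (x + z)))\<^sup>2 + 2 * (norm (M x))\<^sup>2)"
        by (rule ennreal_leI)
      also have "\<dots> = 2 * ennreal ((norm (M (z + x)))\<^sup>2) + ennreal (2 * (norm (M x))\<^sup>2)"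
        by (simp add: ennreal_mult add.commute)
      finally show "ennreal ((norm (M (x + z) - M x))\<^sup>2) * indicator (cball 0 1) z
        \<le> 2 * ennreal ((norm (M (z + x)))\<^sup>2) + ennreal (2 * (norm (M x))\<^sup>2) * indicator (cball 0 1) z"
        by (auto simp: indicator_def)
    qed
    also have "\<dots> = 2 * (\<integral>\<^sup>+z. ennreal ((norm (M (z + x)))\<^sup>2) \<partial>lborel) + ennreal (2 * (norm (M x))\<^sup>2) * emeasure lborel (cball (0::real^'n) 1)"
      by (subst nn_integral_add) (auto simp: nn_integral_cmult)
    also have "(\<integral>\<^sup>+z. ennreal ((norm (M (z + x)))\<^sup>2) \<partial>lborel) = M_mass"
      by (rule nn_integral_lborel_translate[of "\<lambda>y. ennreal ((norm (M y))\<^sup>2)"]) measurable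
    also have "2 * M_mass + ennreal (2 * (norm (M x))\<^sup>2) * emeasure lborel (cball (0::real^'n) 1) < \<infinity>"
      using M_fin emeasure_lborel_cball_finite[of "0::real^'n" 1] by (auto simp: ennreal_mult_less_top)
    finally have fin: "(\<integral>\<^sup>+z. ennreal ((norm (M (x + z) - M x))\<^sup>2) * indicator (cball 0 1) z \<partial>lborel) < \<infinity>" .
    show ?thesis by (rule ball_growth_bound[OF fin \<delta>(1) zero_le_one], erule \<delta>(2), assumption, rule that, assumption, blast)
  qed
  define B where "B = 3 * ((norm (A x) + L) * norm (M x))\<^sup>2 * unit_ball_vol (real CARD('n)) + L\<^sup>2 * Cu"
  have B: "B \<ge> 0" unfolding B_def using Cu by (intro add_nonneg_nonneg mult_nonneg_nonneg) auto
  define T where "T = (2 ^ CARD('n) :: real)"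
  have T: "T > 0" by (simp add: T_def)
  show ?thesis
  proof (rule ennreal_tendsto_0I)
    fix r :: real assume r: "r > 0"
    \<comment> \<open>\<open>\<epsilon>\<close> and \<open>\<delta>\<close> make each of the two terms of the bound on the small ball at most \<open>r / 4\<close>\<close>
    define \<epsilon> where "\<epsilon> = r / (12 * T)"
    have \<epsilon>: "\<epsilon> > 0" using r T by (simp add: \<epsilon>_def)
    obtain \<delta>0 where \<delta>0: "\<delta>0 > 0" "\<And>s. 0 < s \<Longrightarrow> s < \<delta>0 \<Longrightarrow> (\<integral>\<^sup>+z. ennreal ((norm (M (x + z) - M x))\<^sup>2) * indicator (cball 0 s) z \<partial>lborel) \<le> ennreal (\<epsilon> * s ^ CARD('n))"
      using LM \<epsilon> by blast
    define \<delta> where "\<delta> = min (\<delta>0 / 2) (min 1 (r / (4 * T * (B + 1))))"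
    have \<delta>: "0 < \<delta>" "\<delta> \<le> 1" "\<delta> < \<delta>0" "\<delta> \<le> r / (4 * T * (B + 1))"
      using \<delta>0(1) r T B by (auto simp: \<delta>_def)
    have small: "T * (3 * \<epsilon> + \<delta>\<^sup>2 * B) \<le> r / 2"
    proof -
      have "\<delta>\<^sup>2 * B \<le> \<delta> * (B + 1)"
        unfolding power2_eq_square mult.assoc using \<delta> B by (intro mult_left_mono mult_left_le_one_le[THEN order_trans]) auto
      also have "\<dots> \<le> r / (4 * T * (B + 1)) * (B + 1)" using \<delta> B by (intro mult_right_mono) auto
      also have "\<dots> = r / (4 * T)" using B by simp
      finally have "T * (\<delta>\<^sup>2 * B) \<le> T * (r / (4 * T))" using T by (intro mult_left_mono) auto
      then show ?thesis using T by (simp add: \<epsilon>_def distrib_left)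
    qed
    have near: "(\<integral>\<^sup>+z. (w n (norm z) * indicator {..\<delta>} (norm z)) * ?e z \<partial>lborel) \<le> ennreal (r / 2)" for n
    proof -
      have "(\<integral>\<^sup>+z. (w n (norm z) * indicator {..\<delta>} (norm z)) * ?e z \<partial>lborel)
        \<le> ennreal (2 ^ CARD('n) * (3 * \<epsilon> + \<delta>\<^sup>2 * (3 * ((norm (A x) + L) * norm (M x))\<^sup>2 * unit_ball_vol (real CARD('n)) + L\<^sup>2 * Cu)))
          * (\<integral>\<^sup>+r. w n r * indicator {..\<delta>} r \<partial>radial_measure CARD('n))"
        by (rule near_error_le[OF lin]) (use \<delta> \<epsilon> Cu \<delta>0 in auto)
      also have "\<dots> \<le> ennreal (T * (3 * \<epsilon> + \<delta>\<^sup>2 * B)) * 1"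
        unfolding T_def[symmetric] B_def[symmetric] mass[of n, symmetric]
        by (intro mult_left_mono nn_integral_mono) (auto simp: indicator_def)
      also have "\<dots> \<le> ennreal (r / 2)" using small by (simp add: ennreal_leI)
      finally show ?thesis .
    qed
    have middle: "(\<integral>\<^sup>+z. ((w n (norm z) * indicator {\<delta>..} (norm z)) * indicator {..1} (norm z)) * ?e z \<partial>lborel)
        \<le> ennreal (T * (3 * CM + B)) * (\<integral>\<^sup>+r. w n r * indicator {\<delta>..} r \<partial>radial_measure CARD('n))" for n
    proof -
      have "(\<integral>\<^sup>+z. ((w n (norm z) * indicator {\<delta>..} (norm z)) * indicator {..1} (norm z)) * ?e z \<partial>lborel)
        \<le> ennreal (2 ^ CARD('n) * (3 * CM + 1\<^sup>2 * (3 * ((norm (A x) + L) * norm (M x))\<^sup>2 * unit_ball_vol (real CARD('n)) + L\<^sup>2 * Cu)))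
          * (\<integral>\<^sup>+r. (w n r * indicator {\<delta>..} r) * indicator {..1} r \<partial>radial_measure CARD('n))"
        by (rule near_error_le[OF lin, of "\<lambda>r. w n r * indicator {\<delta>..} r" 1 CM Cu]) (use CM Cu in auto)
      also have "\<dots> \<le> ennreal (T * (3 * CM + B)) * (\<integral>\<^sup>+r. w n r * indicator {\<delta>..} r \<partial>radial_measure CARD('n))"
        unfolding T_def[symmetric] B_def[symmetric] by (simp, intro mult_left_mono nn_integral_mono) (auto simp: indicator_def)
      finally show ?thesis .
    qed
    have "(\<lambda>n. ennreal (T * (3 * CM + B)) * (\<integral>\<^sup>+r. w n r * indicator {\<delta>..} r \<partial>radial_measure CARD('n))) \<longlonglongrightarrow> ennreal (T * (3 * CM + B)) * 0"
      by (rule ennreal_tendsto_cmult[OF _ tail[OF \<delta>(1)]]) simp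
    then have "eventually (\<lambda>n. ennreal (T * (3 * CM + B)) * (\<integral>\<^sup>+r. w n r * indicator {\<delta>..} r \<partial>radial_measure CARD('n)) < ennreal (r / 2)) sequentially"
      using r by (intro order_tendstoD(2)[of _ 0]) auto
    then show "eventually (\<lambda>n. (\<integral>\<^sup>+z. (w n (norm z) * indicator {..1} (norm z)) * ?e z \<partial>lborel) \<le> ennreal r) sequentially"
    proof eventually_elim
      case (elim n)
      have "(\<integral>\<^sup>+z. (w n (norm z) * indicator {..1} (norm z)) * ?e z \<partial>lborel)
        \<le> (\<integral>\<^sup>+z. (w n (norm z) * indicator {..\<delta>} (norm z)) * ?e z + ((w n (norm z) * indicator {\<delta>..} (norm z)) * indicator {..1} (norm z)) * ?e z \<partial>lborel)"
        by (rule nn_integral_mono) (auto simp: indicator_def)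
      also have "\<dots> = (\<integral>\<^sup>+z. (w n (norm z) * indicator {..\<delta>} (norm z)) * ?e z \<partial>lborel) + (\<integral>\<^sup>+z. ((w n (norm z) * indicator {\<delta>..} (norm z)) * indicator {..1} (norm z)) * ?e z \<partial>lborel)"
        by (rule nn_integral_add) measurable
      also have "\<dots> \<le> ennreal (r / 2) + ennreal (r / 2)"
        by (rule add_mono[OF near order_trans[OF middle less_imp_le[OF elim]]])
      also have "\<dots> = ennreal r" using r by (simp add: ennreal_plus[symmetric] del: ennreal_plus)
      finally show ?case .
    qed
  qed
qed

end

context magnetic_function
begin

text \<open>Split \<open>|u|\<^sup>2\<close> at a level \<open>k\<close>. Below it the integrand is bounded and the mass of the weight beyond radius
  1 tends to 0. Above it the growth condition bounds \<open>w(|z|) / |z|\<^sup>2\<close> by \<open>C\<close>, and \<open>|u|\<^sup>2\<close> has small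
  integral over the set where it exceeds \<open>k\<close>.\<close>

lemma far_part_tendsto_0:
  fixes x :: "real ^ 'n"
  assumes w: "mollifier_weights w CARD('n) C"
  shows "(\<lambda>n. \<integral>\<^sup>+z. (w n (norm z) * indicator {1<..} (norm z)) * ennreal ((cmod (increment x z))\<^sup>2 / (norm z)\<^sup>2) \<partial>lborel) \<longlonglongrightarrow> 0"
proof (rule ennreal_tendsto_0I)
  interpret mollifier_weights w "CARD('n)" C by (rule w)
  let ?S = "sphere_area TYPE('n)"
  let ?tail = "\<lambda>k::nat. \<integral>\<^sup>+y. ennreal ((cmod (u y))\<^sup>2) * indicator {y. (cmod (u y))\<^sup>2 > real k} y \<partial>lborel"
  fix r :: real assume r: "r > 0"
  have "(\<lambda>k. ennreal (2 * C) * ?tail k) \<longlonglongrightarrow> ennreal (2 * C) * 0"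
    by (rule ennreal_tendsto_cmult) (use nn_integral_tail_tendsto_0[of "\<lambda>y. (cmod (u y))\<^sup>2" lborel] u_fin in auto)
  then have "eventually (\<lambda>k. ennreal (2 * C) * ?tail k < ennreal (r / 2)) sequentially"
    using r by (intro order_tendstoD(2)[of _ 0]) auto
  then obtain k where k: "ennreal (2 * C) * ?tail k < ennreal (r / 2)"
    by (auto simp: eventually_sequentially)
  let ?c = "2 * (cmod (u x))\<^sup>2 + 2 * real k"
  have bound: "(\<integral>\<^sup>+z. (w n (norm z) * indicator {1<..} (norm z)) * ennreal ((cmod (increment x z))\<^sup>2 / (norm z)\<^sup>2) \<partial>lborel)
     \<le> ennreal ?c * (ennreal ?S * (\<integral>\<^sup>+r. w n r * indicator {1..} r \<partial>radial_measure CARD('n))) + ennreal (2 * C) * ?tail k" for n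
  proof -
    have "(\<integral>\<^sup>+z. (w n (norm z) * indicator {1<..} (norm z)) * ennreal ((cmod (increment x z))\<^sup>2 / (norm z)\<^sup>2) \<partial>lborel)
      \<le> (\<integral>\<^sup>+z. ennreal ?c * (w n (norm z) * indicator {1..} (norm z))
          + ennreal (2 * C) * (ennreal ((cmod (u (z + x)))\<^sup>2) * indicator {y. (cmod (u y))\<^sup>2 > real k} (z + x)) \<partial>lborel)"
    proof (rule nn_integral_mono)
      fix z :: "real ^ 'n"
      show "(w n (norm z) * indicator {1<..} (norm z)) * ennreal ((cmod (increment x z))\<^sup>2 / (norm z)\<^sup>2)
        \<le> ennreal ?c * (w n (norm z) * indicator {1..} (norm z))
          + ennreal (2 * C) * (ennreal ((cmod (u (z + x)))\<^sup>2) * indicator {y. (cmod (u y))\<^sup>2 > real k} (z + x))"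
      proof (cases "norm z > 1")
        case True
        have z2: "(norm z)\<^sup>2 \<ge> 1" using True by (simp add: one_le_power)
        let ?a = "(cmod (u (z + x)))\<^sup>2"
        have inc: "(cmod (increment x z))\<^sup>2 / (norm z)\<^sup>2 \<le> 2 * (cmod (u x))\<^sup>2 + 1 / (norm z)\<^sup>2 * (2 * ?a)"
        proof -
          have "(cmod (increment x z))\<^sup>2 / (norm z)\<^sup>2 \<le> (2 * ?a + 2 * (cmod (u x))\<^sup>2) / (norm z)\<^sup>2"
            using increment_sq_le_sum[of x z] by (intro divide_right_mono) (auto simp: add.commute)
          also have "\<dots> = 2 * (cmod (u x))\<^sup>2 / (norm z)\<^sup>2 + 1 / (norm z)\<^sup>2 * (2 * ?a)"
            by (simp add: add_divide_distrib)
          also have "2 * (cmod (u x))\<^sup>2 / (norm z)\<^sup>2 \<le> 2 * (cmod (u x))\<^sup>2 / 1"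
            using z2 by (intro divide_left_mono) auto
          finally show ?thesis by simp
        qed
        show ?thesis
        proof (cases "?a > real k")
          case False
          have "1 / (norm z)\<^sup>2 * (2 * ?a) \<le> 1 * (2 * real k)"
            using False z2 by (intro mult_mono) (auto simp: divide_le_eq)
          then have "ennreal ((cmod (increment x z))\<^sup>2 / (norm z)\<^sup>2) \<le> ennreal ?c"
            using inc by (intro ennreal_leI) simp
          then have "w n (norm z) * ennreal ((cmod (increment x z))\<^sup>2 / (norm z)\<^sup>2) \<le> w n (norm z) * ennreal ?c"
            by (rule mult_left_mono) simp
          then show ?thesis using True False by (simp add: mult.commute)
        next
          case a: True
          have wz: "w n (norm z) * ennreal (1 / (norm z)\<^sup>2) \<le> ennreal C"
          proof -
            have "w n (norm z) * ennreal (1 / (norm z)\<^sup>2) \<le> ennreal (C * (norm z)\<^sup>2) * ennreal (1 / (norm z)\<^sup>2)"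
              by (rule mult_right_mono[OF growth[OF True]]) simp
            also have "\<dots> = ennreal (C * (norm z)\<^sup>2 * (1 / (norm z)\<^sup>2))"
              using C_nonneg by (intro ennreal_mult[symmetric]) auto
            also have "C * (norm z)\<^sup>2 * (1 / (norm z)\<^sup>2) = C" using True by (cases "z = 0") auto
            finally show ?thesis .
          qed
          have "ennreal ((cmod (increment x z))\<^sup>2 / (norm z)\<^sup>2) \<le> ennreal (2 * (cmod (u x))\<^sup>2 + 1 / (norm z)\<^sup>2 * (2 * ?a))"
            by (rule ennreal_leI[OF inc])
          also have "\<dots> = ennreal (2 * (cmod (u x))\<^sup>2) + ennreal (1 / (norm z)\<^sup>2 * (2 * ?a))"
            by (rule ennreal_plus) auto
          also have "ennreal (1 / (norm z)\<^sup>2 * (2 * ?a)) = ennreal (1 / (norm z)\<^sup>2) * ennreal (2 * ?a)"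
            by (rule ennreal_mult) auto
          finally have "w n (norm z) * ennreal ((cmod (increment x z))\<^sup>2 / (norm z)\<^sup>2)
            \<le> w n (norm z) * (ennreal (2 * (cmod (u x))\<^sup>2) + ennreal (1 / (norm z)\<^sup>2) * ennreal (2 * ?a))"
            by (rule mult_left_mono) simp
          also have "\<dots> = ennreal (2 * (cmod (u x))\<^sup>2) * w n (norm z) + (w n (norm z) * ennreal (1 / (norm z)\<^sup>2)) * ennreal (2 * ?a)"
            by (simp only: distrib_left mult_ac)
          also have "\<dots> \<le> ennreal ?c * w n (norm z) + ennreal C * ennreal (2 * ?a)"
            by (intro add_mono mult_right_mono wz ennreal_leI) auto
          also have "ennreal C * ennreal (2 * ?a) = ennreal (2 * C) * ennreal ?a"
            using C_nonneg by (simp add: ennreal_mult[symmetric] mult_ac)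
          finally show ?thesis using True a by simp
        qed
      qed simp
    qed
    also have "\<dots> = ennreal ?c * (\<integral>\<^sup>+z. w n (norm (z :: real ^ 'n)) * indicator {1..} (norm z) \<partial>lborel)
       + ennreal (2 * C) * (\<integral>\<^sup>+z. ennreal ((cmod (u (z + x)))\<^sup>2) * indicator {y. (cmod (u y))\<^sup>2 > real k} (z + x) \<partial>lborel)"
      by (subst nn_integral_add, measurable) (simp add: nn_integral_cmult)
    also have "(\<integral>\<^sup>+z. w n (norm (z :: real ^ 'n)) * indicator {1..} (norm z) \<partial>lborel) = ennreal ?S * (\<integral>\<^sup>+r. w n r * indicator {1..} r \<partial>radial_measure CARD('n))"
      by (subst nn_integral_radial_mass[of "\<lambda>r. w n r * indicator {1..} r"]) (auto simp: emeasure_sphere_area)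
    also have "(\<integral>\<^sup>+z. ennreal ((cmod (u (z + x)))\<^sup>2) * indicator {y. (cmod (u y))\<^sup>2 > real k} (z + x) \<partial>lborel) = ?tail k"
      by (rule nn_integral_lborel_translate[of "\<lambda>y. ennreal ((cmod (u y))\<^sup>2) * indicator {y. (cmod (u y))\<^sup>2 > real k} y"]) measurable
    finally show ?thesis .
  qed
  have "(\<lambda>n. ennreal ?c * (ennreal ?S * (\<integral>\<^sup>+r. w n r * indicator {1..} r \<partial>radial_measure CARD('n)))) \<longlonglongrightarrow> ennreal ?c * (ennreal ?S * 0)"
    by (intro ennreal_tendsto_cmult tail) auto
  then have "eventually (\<lambda>n. ennreal ?c * (ennreal ?S * (\<integral>\<^sup>+r. w n r * indicator {1..} r \<partial>radial_measure CARD('n))) < ennreal (r / 2)) sequentially"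
    using r by (intro order_tendstoD(2)[of _ 0]) auto
  then show "eventually (\<lambda>n. (\<integral>\<^sup>+z. (w n (norm z) * indicator {1<..} (norm z)) * ennreal ((cmod (increment x z))\<^sup>2 / (norm z)\<^sup>2) \<partial>lborel) \<le> ennreal r) sequentially"
  proof eventually_elim
    case (elim n)
    have "(\<integral>\<^sup>+z. (w n (norm z) * indicator {1<..} (norm z)) * ennreal ((cmod (increment x z))\<^sup>2 / (norm z)\<^sup>2) \<partial>lborel)
      \<le> ennreal (r / 2) + ennreal (r / 2)"
      by (rule order_trans[OF bound add_mono[OF less_imp_le[OF elim] less_imp_le[OF k]]])
    also have "\<dots> = ennreal r" using r by (simp add: ennreal_plus[symmetric] del: ennreal_plus)
    finally show ?case .
  qed
qed

text \<open>In the norm of \<open>L\<^sup>2\<close> with the weight \<open>w(|z|) / |z|\<^sup>2\<close> on the unit ball, the increment differs from the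
  linear function \<open>z \<mapsto> z \<cdot> M(x)\<close> by a null sequence, and the squared norm of that function is \<open>2 Q |M(x)|\<^sup>2\<close>
  times the mass. The part outside the unit ball is a null sequence by \<open>far_part_tendsto_0\<close>.\<close>

theorem AE_nonlocal_energy_tendsto:
  fixes \<omega> :: "real ^ 'n"
  assumes w: "mollifier_weights w CARD('n) C" and \<omega>: "norm \<omega> = 1"
  shows "AE x in lborel. (\<lambda>n. nonlocal_energy (w n) x) \<longlonglongrightarrow> ennreal (2 * Q_const \<omega> * (norm (M x))\<^sup>2)"
proof -
  interpret mollifier_weights w "CARD('n)" C by (rule w)
  have Q: "Q_const \<omega> \<ge> 0" by (rule sphere_second_moment_unit(2)[OF \<omega>])
  have ufin: "(\<integral>\<^sup>+x. ennreal ((cmod (u x))\<^sup>2) * indicator (cball 0 r) x \<partial>lborel) < \<infinity>" for r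
  proof -
    have "(\<integral>\<^sup>+x. ennreal ((cmod (u x))\<^sup>2) * indicator (cball 0 r) x \<partial>lborel) \<le> u_mass"
      by (intro nn_integral_mono) (auto simp: indicator_def)
    then show ?thesis using u_fin by (rule le_less_trans)
  qed
  have Lu: "AE x in lborel. \<forall>\<epsilon>>0. \<exists>\<delta>>0. \<forall>s. 0 < s \<and> s < \<delta> \<longrightarrow>
       (\<integral>\<^sup>+z. ennreal ((cmod (u (x + z)))\<^sup>2) * indicator (cball 0 s) z \<partial>lborel) \<le> ennreal (2 ^ CARD('n) * ((cmod (u x))\<^sup>2 + \<epsilon>) * s ^ CARD('n))"
  proof (rule AE_ball_average_le[where g = "\<lambda>x. (cmod (u x))\<^sup>2"])
    show "(\<integral>\<^sup>+x. ennreal ((cmod (u x))\<^sup>2) * indicator (cball 0 r) x \<partial>lborel) < \<infinity>" for r by (rule ufin)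
  qed auto
  show ?thesis
    using AE_increment_minus_linear AE_L2_Lebesgue_point[OF M_meas M_fin] Lu
  proof eventually_elim
    case (elim x)
    let ?l = "2 * Q_const \<omega> * (norm (M x))\<^sup>2"
    let ?v = "\<lambda>n z. w n (norm z) * indicator {..1} (norm (z :: real ^ 'n))"
    define X where "X n = (\<integral>\<^sup>+z. ?v n z * ennreal ((cmod (increment x z))\<^sup>2 / (norm z)\<^sup>2) \<partial>lborel)" for n
    define Y where "Y n = (\<integral>\<^sup>+z. ?v n z * ennreal ((cmod (real_dot z (M x)))\<^sup>2 / (norm z)\<^sup>2) \<partial>lborel)" for n
    define E where "E n = (\<integral>\<^sup>+z. ?v n z * ennreal ((cmod (increment x z - real_dot z (M x)))\<^sup>2 / (norm z)\<^sup>2) \<partial>lborel)" for n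
    have E0: "E \<longlonglongrightarrow> 0"
      unfolding E_def by (rule near_error_tendsto_0[OF w elim])
    have Yl: "Y \<longlonglongrightarrow> ennreal ?l"
    proof -
      let ?a = "\<lambda>n. \<integral>\<^sup>+r. w n r * indicator {..1} r \<partial>radial_measure CARD('n)"
      let ?b = "\<lambda>n. \<integral>\<^sup>+r. w n r * indicator {1<..} r \<partial>radial_measure CARD('n)"
      have b0: "?b \<longlonglongrightarrow> 0"
      proof (rule tendsto_sandwich[OF _ _ tendsto_const tail[of 1]])
        show "eventually (\<lambda>n. ?b n \<le> (\<integral>\<^sup>+r. w n r * indicator {1..} r \<partial>radial_measure CARD('n))) sequentially"
          by (intro always_eventually allI nn_integral_mono) (auto simp: indicator_def)
      qed auto
      have ab: "?a n + ?b n = 1" for n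
      proof -
        have "?a n + ?b n = (\<integral>\<^sup>+r. w n r * indicator {..1} r + w n r * indicator {1<..} r \<partial>radial_measure CARD('n))"
          by (rule nn_integral_add[symmetric]) measurable
        also have "\<dots> = (\<integral>\<^sup>+r. w n r \<partial>radial_measure CARD('n))"
          by (intro nn_integral_cong) (auto simp: indicator_def)
        finally show ?thesis by (simp add: mass)
      qed
      have "?a n = 1 - ?b n" for n
      proof -
        have "?b n \<le> ?a n + ?b n" by simp
        then have "?b n < top" unfolding ab by (rule le_less_trans) simp
        then have "?a n + ?b n - ?b n = ?a n" by (intro ennreal_add_diff_cancel_right) simp
        then show ?thesis unfolding ab by (rule sym)
      qed
      moreover have "(\<lambda>n. 1 - ?b n) \<longlonglongrightarrow> 1 - 0"
        by (rule tendsto_diff_ennreal[OF tendsto_const b0]) auto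
      ultimately have "?a \<longlonglongrightarrow> 1" by simp
      then have "(\<lambda>n. ennreal ?l * ?a n) \<longlonglongrightarrow> ennreal ?l * 1"
        by (intro ennreal_tendsto_cmult) auto
      moreover have "Y = (\<lambda>n. ennreal ?l * ?a n)"
      proof (rule ext)
        fix n
        show "Y n = ennreal ?l * ?a n"
          unfolding Y_def by (rule nn_integral_radial_quadratic[OF _ \<omega>, of "\<lambda>r. w n r * indicator {..1} r"]) measurable
      qed
      ultimately show ?thesis by simp
    qed
    have young: "(\<integral>\<^sup>+z. ?v n z * ennreal (f z / (norm z)\<^sup>2) \<partial>lborel) \<le>
        ennreal (1 + \<eta>) * (\<integral>\<^sup>+z. ?v n z * ennreal (g z / (norm z)\<^sup>2) \<partial>lborel) + ennreal (1 + 1 / \<eta>) * (\<integral>\<^sup>+z. ?v n z * ennreal (h z / (norm z)\<^sup>2) \<partial>lborel)"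
      if \<eta>: "\<eta> > 0" and [measurable]: "g \<in> borel_measurable borel" "h \<in> borel_measurable borel"
        and fgh: "\<And>z. f z \<le> (1 + \<eta>) * g z + (1 + 1 / \<eta>) * h z" "\<And>z. g z \<ge> 0" "\<And>z. h z \<ge> 0" for f g h :: "real ^ 'n \<Rightarrow> real" and \<eta> n
    proof -
      have "(\<integral>\<^sup>+z. ?v n z * ennreal (f z / (norm z)\<^sup>2) \<partial>lborel) \<le>
        (\<integral>\<^sup>+z. ennreal (1 + \<eta>) * (?v n z * ennreal (g z / (norm z)\<^sup>2)) + ennreal (1 + 1 / \<eta>) * (?v n z * ennreal (h z / (norm z)\<^sup>2)) \<partial>lborel)"
      proof (rule nn_integral_mono)
        fix z :: "real ^ 'n"
        have "f z / (norm z)\<^sup>2 \<le> ((1 + \<eta>) * g z + (1 + 1 / \<eta>) * h z) / (norm z)\<^sup>2"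
          by (rule divide_right_mono[OF fgh(1)]) simp
        also have "\<dots> = (1 + \<eta>) * (g z / (norm z)\<^sup>2) + (1 + 1 / \<eta>) * (h z / (norm z)\<^sup>2)"
          by (simp add: add_divide_distrib)
        finally have "ennreal (f z / (norm z)\<^sup>2) \<le> ennreal ((1 + \<eta>) * (g z / (norm z)\<^sup>2) + (1 + 1 / \<eta>) * (h z / (norm z)\<^sup>2))"
          by (rule ennreal_leI)
        also have "\<dots> = ennreal ((1 + \<eta>) * (g z / (norm z)\<^sup>2)) + ennreal ((1 + 1 / \<eta>) * (h z / (norm z)\<^sup>2))"
          using \<eta> fgh(2,3)[of z] by (intro ennreal_plus) auto
        also have "ennreal ((1 + \<eta>) * (g z / (norm z)\<^sup>2)) = ennreal (1 + \<eta>) * ennreal (g z / (norm z)\<^sup>2)"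
          using \<eta> fgh(2)[of z] by (intro ennreal_mult) auto
        also have "ennreal ((1 + 1 / \<eta>) * (h z / (norm z)\<^sup>2)) = ennreal (1 + 1 / \<eta>) * ennreal (h z / (norm z)\<^sup>2)"
          using \<eta> fgh(3)[of z] by (intro ennreal_mult) auto
        finally have "?v n z * ennreal (f z / (norm z)\<^sup>2) \<le> ?v n z * (ennreal (1 + \<eta>) * ennreal (g z / (norm z)\<^sup>2) + ennreal (1 + 1 / \<eta>) * ennreal (h z / (norm z)\<^sup>2))"
          by (rule mult_left_mono) simp
        then show "?v n z * ennreal (f z / (norm z)\<^sup>2) \<le> ennreal (1 + \<eta>) * (?v n z * ennreal (g z / (norm z)\<^sup>2)) + ennreal (1 + 1 / \<eta>) * (?v n z * ennreal (h z / (norm z)\<^sup>2))"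
          by (simp only: distrib_left mult_ac)
      qed
      also have "\<dots> = ennreal (1 + \<eta>) * (\<integral>\<^sup>+z. ?v n z * ennreal (g z / (norm z)\<^sup>2) \<partial>lborel) + ennreal (1 + 1 / \<eta>) * (\<integral>\<^sup>+z. ?v n z * ennreal (h z / (norm z)\<^sup>2) \<partial>lborel)"
        by (subst nn_integral_add, measurable) (simp add: nn_integral_cmult del: ennreal_plus)
      finally show ?thesis .
    qed
    have sq: "(cmod a)\<^sup>2 \<le> (1 + \<eta>) * (cmod b)\<^sup>2 + (1 + 1 / \<eta>) * (cmod (a - b))\<^sup>2" if "\<eta> > 0" for a b \<eta>
    proof -
      have "(cmod a)\<^sup>2 \<le> (cmod b + cmod (a - b))\<^sup>2"
        using norm_triangle_ineq[of b "a - b"] by (intro power_mono) auto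
      also have "\<dots> \<le> (1 + \<eta>) * (cmod b)\<^sup>2 + (1 + 1 / \<eta>) * (cmod (a - b))\<^sup>2" by (rule square_sum2_le[OF that])
      finally show ?thesis .
    qed
    have Xl: "X \<longlonglongrightarrow> ennreal ?l"
    proof (rule tendsto_of_young_sandwich[OF Yl _ E0])
      show "?l \<ge> 0" using Q by simp
      fix n and \<eta> :: real assume \<eta>: "\<eta> > 0"
      show "X n \<le> ennreal (1 + \<eta>) * Y n + ennreal (1 + 1 / \<eta>) * E n"
        unfolding X_def Y_def E_def by (rule young[OF \<eta>]) (auto intro: sq[OF \<eta>])
      show "Y n \<le> ennreal (1 + \<eta>) * X n + ennreal (1 + 1 / \<eta>) * E n"
        unfolding X_def Y_def E_def
        by (rule young[OF \<eta>]) (use sq[OF \<eta>, of "real_dot z (M x)" "increment x z" for z] in \<open>auto simp: norm_minus_commute\<close>)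
    qed
    have split: "nonlocal_energy (w n) x = X n + (\<integral>\<^sup>+z. (w n (norm z) * indicator {1<..} (norm z)) * ennreal ((cmod (increment x z))\<^sup>2 / (norm z)\<^sup>2) \<partial>lborel)" for n
    proof -
      have "nonlocal_energy (w n) x = (\<integral>\<^sup>+z. ?v n z * ennreal ((cmod (increment x z))\<^sup>2 / (norm z)\<^sup>2)
          + (w n (norm z) * indicator {1<..} (norm z)) * ennreal ((cmod (increment x z))\<^sup>2 / (norm z)\<^sup>2) \<partial>lborel)"
        unfolding nonlocal_energy_def by (intro nn_integral_cong) (auto simp: indicator_def)
      also have "\<dots> = X n + (\<integral>\<^sup>+z. (w n (norm z) * indicator {1<..} (norm z)) * ennreal ((cmod (increment x z))\<^sup>2 / (norm z)\<^sup>2) \<partial>lborel)"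
        unfolding X_def by (rule nn_integral_add) measurable
      finally show ?thesis .
    qed
    show ?case
      unfolding split using tendsto_add[OF Xl far_part_tendsto_0[OF w, of x]] by simp
  qed
qed

section \<open>The total energy in the limit\<close>

text \<open>In \<open>integral_nonlocal_energy_le\<close> one chooses first \<open>\<eta>\<close>, then \<open>\<delta>\<close> depending on \<open>\<eta>\<close>, and then lets \<open>n\<close>
  tend to infinity.\<close>

theorem limsup_integral_nonlocal_energy:
  fixes \<omega> :: "real ^ 'n"
  assumes w: "mollifier_weights w CARD('n) C" and \<omega>: "norm \<omega> = 1"
  shows "(\<integral>\<^sup>+x. nonlocal_energy (w n) x \<partial>lborel) < \<infinity>"
    and "limsup (\<lambda>n. \<integral>\<^sup>+x. nonlocal_energy (w n) x \<partial>lborel) \<le> (\<integral>\<^sup>+x. ennreal (2 * Q_const \<omega> * (norm (M x))\<^sup>2) \<partial>lborel)"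
proof -
  interpret mollifier_weights w "CARD('n)" C by (rule w)
  let ?S = "sphere_area TYPE('n)" and ?q = "2 * Q_const \<omega>"
  let ?\<tau> = "\<lambda>\<delta> n. \<integral>\<^sup>+r. w n r * indicator {\<delta>..} r \<partial>radial_measure CARD('n)"
  have Q: "Q_const \<omega> \<ge> 0" by (rule sphere_second_moment_unit(2)[OF \<omega>])
  define U V where "U = enn2real u_mass" and "V = enn2real M_mass"
  have UV: "u_mass = ennreal U" "M_mass = ennreal V" "U \<ge> 0" "V \<ge> 0"
    using u_fin M_fin by (simp_all add: U_def V_def)
  have S: "?S \<ge> 0" by (rule sphere_area_nonneg)
  have le: "(\<integral>\<^sup>+x. nonlocal_energy (w n) x \<partial>lborel) \<le> ennreal ((1 + \<eta>) * ?q) * ennreal V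
     + ennreal ((1 + 1 / \<eta>) * (L\<^sup>2 / 4 * \<delta>\<^sup>2) * ?S) * ennreal U + ennreal (4 / \<delta>\<^sup>2 * ?S) * ennreal U * ?\<tau> \<delta> n"
    if "\<eta> > 0" "\<delta> > 0" for \<eta> \<delta> n
    using integral_nonlocal_energy_le[OF w_meas mass \<omega> that, of n] unfolding UV .
  have \<tau>1: "?\<tau> \<delta> n \<le> 1" for \<delta> n
  proof -
    have "?\<tau> \<delta> n \<le> (\<integral>\<^sup>+r. w n r \<partial>radial_measure CARD('n))"
      by (intro nn_integral_mono) (auto simp: indicator_def)
    then show ?thesis by (simp add: mass)
  qed
  show "(\<integral>\<^sup>+x. nonlocal_energy (w n) x \<partial>lborel) < \<infinity>"
  proof -
    have "(\<integral>\<^sup>+x. nonlocal_energy (w n) x \<partial>lborel) \<le> ennreal ((1 + 1) * ?q) * ennreal V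
     + ennreal ((1 + 1 / 1) * (L\<^sup>2 / 4 * 1\<^sup>2) * ?S) * ennreal U + ennreal (4 / 1\<^sup>2 * ?S) * ennreal U * ?\<tau> 1 n"
      by (rule le) auto
    also have "\<dots> < \<infinity>" using le_less_trans[OF \<tau>1[where \<delta> = 1 and n = n], of top] by (simp add: ennreal_mult_less_top)
    finally show ?thesis .
  qed
  have total: "(\<integral>\<^sup>+x. ennreal (?q * (norm (M x))\<^sup>2) \<partial>lborel) = ennreal (?q * V)"
  proof -
    have "(\<integral>\<^sup>+x. ennreal (?q * (norm (M x))\<^sup>2) \<partial>lborel) = (\<integral>\<^sup>+x. ennreal ?q * ennreal ((norm (M x))\<^sup>2) \<partial>lborel)"
      using Q by (intro nn_integral_cong ennreal_mult) auto
    also have "\<dots> = ennreal ?q * M_mass" by (rule nn_integral_cmult) measurable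
    finally show ?thesis using Q UV by (simp add: ennreal_mult[symmetric])
  qed
  show "limsup (\<lambda>n. \<integral>\<^sup>+x. nonlocal_energy (w n) x \<partial>lborel) \<le> (\<integral>\<^sup>+x. ennreal (?q * (norm (M x))\<^sup>2) \<partial>lborel)"
    unfolding total
  proof (rule ennreal_le_epsilon)
    fix e :: real assume e: "e > 0"
    define \<eta> where "\<eta> = e / (3 * (?q * V + 1))"
    have qV: "?q * V \<ge> 0" using Q UV by simp
    have third: "e / (3 * a) * a = e / 3" if "a > 0" for a
      using that by simp
    have qp: "0 < ?q * V + 1" using qV by (rule add_nonneg_pos) simp
    then have \<eta>: "\<eta> > 0" unfolding \<eta>_def using e by (intro divide_pos_pos mult_pos_pos) simp_all
    define K where "K = (1 + 1 / \<eta>) * (L\<^sup>2 / 4) * ?S * U"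
    have K: "K \<ge> 0" unfolding K_def using \<eta> S UV by simp
    define \<delta> where "\<delta> = min 1 (e / (3 * (K + 1)))"
    have \<delta>: "\<delta> > 0" "\<delta> \<le> 1" "\<delta> \<le> e / (3 * (K + 1))" using e K by (auto simp: \<delta>_def)
    have 1: "(1 + \<eta>) * ?q * V \<le> ?q * V + e / 3"
    proof -
      have "\<eta> * (?q * V) \<le> \<eta> * (?q * V + 1)" using \<eta> by (intro mult_left_mono) auto
      also have "\<dots> = e / 3" unfolding \<eta>_def by (rule third[OF qp])
      finally show ?thesis by (simp add: algebra_simps)
    qed
    have 2: "(1 + 1 / \<eta>) * (L\<^sup>2 / 4 * \<delta>\<^sup>2) * ?S * U \<le> e / 3"
    proof -
      have "(1 + 1 / \<eta>) * (L\<^sup>2 / 4 * \<delta>\<^sup>2) * ?S * U = \<delta> * (\<delta> * K)" by (simp add: K_def power2_eq_square)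
      also have "\<dots> \<le> 1 * (\<delta> * (K + 1))" using \<delta> K by (intro mult_mono) auto
      also have "\<dots> \<le> e / (3 * (K + 1)) * (K + 1)" unfolding mult_1 by (rule mult_right_mono[OF \<delta>(3)]) (use K in simp)
      also have "\<dots> = e / 3" by (rule third) (use K in simp)
      finally show ?thesis .
    qed
    have "(\<lambda>n. (ennreal (4 / \<delta>\<^sup>2 * ?S) * ennreal U) * ?\<tau> \<delta> n) \<longlonglongrightarrow> (ennreal (4 / \<delta>\<^sup>2 * ?S) * ennreal U) * 0"
      by (rule ennreal_tendsto_cmult[OF _ tail[OF \<delta>(1)]]) (simp add: ennreal_mult_less_top)
    then have "eventually (\<lambda>n. ennreal (4 / \<delta>\<^sup>2 * ?S) * ennreal U * ?\<tau> \<delta> n < ennreal (e / 3)) sequentially"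
      using e by (intro order_tendstoD(2)[of _ 0]) auto
    then have "eventually (\<lambda>n. (\<integral>\<^sup>+x. nonlocal_energy (w n) x \<partial>lborel) \<le> ennreal (?q * V) + ennreal e) sequentially"
    proof eventually_elim
      case (elim n)
      have "ennreal ((1 + \<eta>) * ?q) * ennreal V = ennreal ((1 + \<eta>) * ?q * V)"
        using \<eta> Q UV by (intro ennreal_mult[symmetric]) auto
      moreover have "ennreal ((1 + 1 / \<eta>) * (L\<^sup>2 / 4 * \<delta>\<^sup>2) * ?S) * ennreal U = ennreal ((1 + 1 / \<eta>) * (L\<^sup>2 / 4 * \<delta>\<^sup>2) * ?S * U)"
        using \<eta> S UV by (intro ennreal_mult[symmetric]) auto
      ultimately have "(\<integral>\<^sup>+x. nonlocal_energy (w n) x \<partial>lborel) \<le> ennreal ((1 + \<eta>) * ?q * V)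
         + ennreal ((1 + 1 / \<eta>) * (L\<^sup>2 / 4 * \<delta>\<^sup>2) * ?S * U) + ennreal (4 / \<delta>\<^sup>2 * ?S) * ennreal U * ?\<tau> \<delta> n"
        using le[OF \<eta> \<delta>(1), of n] by simp
      also have "\<dots> \<le> ennreal (?q * V + e / 3) + ennreal (e / 3) + ennreal (e / 3)"
        by (intro add_mono ennreal_leI 1 2 less_imp_le[OF elim])
      also have "\<dots> = ennreal (?q * V) + ennreal e"
        using qV e by (simp add: ennreal_plus[symmetric] del: ennreal_plus)
      finally show ?case .
    qed
    then show "limsup (\<lambda>n. \<integral>\<^sup>+x. nonlocal_energy (w n) x \<partial>lborel) \<le> ennreal (?q * V) + ennreal e"
      by (rule Limsup_bounded)
  qed
qed

end

section \<open>Borel representatives and uniqueness of the weak gradient\<close>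

lemma lebesgue_borel_representative:
  fixes f :: "'a::euclidean_space \<Rightarrow> 'b::euclidean_space"
  assumes f: "f \<in> borel_measurable lebesgue"
  shows "\<exists>f' \<in> borel_measurable borel. AE x in lborel. f x = f' x"
proof -
  have "\<forall>b. \<exists>g. g \<in> borel_measurable lborel \<and> (AE x in lborel. f x \<bullet> b = g x)"
  proof
    fix b
    have "(\<lambda>x. f x \<bullet> b) \<in> borel_measurable lebesgue" using f by measurable
    then show "\<exists>g. g \<in> borel_measurable lborel \<and> (AE x in lborel. f x \<bullet> b = g x)"
      using completion_ex_borel_measurable_real[of "\<lambda>x. f x \<bullet> b" lborel] by blast
  qed
  from choice[OF this] obtain g where gm: "\<And>b. g b \<in> borel_measurable lborel" and g: "\<And>b. AE x in lborel. f x \<bullet> b = g b x"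
    by blast
  have "AE x in lborel. \<forall>b\<in>Basis. f x \<bullet> b = g b x"
    by (intro AE_finite_allI g) simp
  then have "AE x in lborel. f x = (\<Sum>b\<in>Basis. g b x *\<^sub>R b)"
  proof eventually_elim
    case (elim x)
    have "f x = (\<Sum>b\<in>Basis. (f x \<bullet> b) *\<^sub>R b)" by (simp add: euclidean_representation)
    then show ?case using elim by simp
  qed
  moreover have "(\<lambda>x. \<Sum>b\<in>Basis. g b x *\<^sub>R b) \<in> borel_measurable borel"
  proof -
    have [measurable]: "g b \<in> borel_measurable borel" for b using gm[of b] by simp
    show ?thesis by (intro borel_measurable_sum borel_measurable_scaleR borel_measurable_const) measurable
  qed
  ultimately show ?thesis by (rule rev_bexI[rotated])
qed

lemma locally_integrable_lebesgue_measurable: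
  fixes f :: "'a::euclidean_space \<Rightarrow> 'b::euclidean_space"
  assumes "locally_integrable f"
  shows "f \<in> borel_measurable lebesgue"
proof (rule borel_measurable_LIMSEQ_metric)
  fix k :: nat
  have "f absolutely_integrable_on cball 0 (real k)" using assms by (simp add: locally_integrable_def)
  then show "(\<lambda>x. indicator (cball 0 (real k)) x *\<^sub>R f x) \<in> borel_measurable lebesgue"
    unfolding set_integrable_def by (rule borel_measurable_integrable)
next
  fix x :: 'a
  obtain K :: nat where "norm x \<le> real K" using real_arch_simple by blast
  then have "eventually (\<lambda>k. indicator (cball 0 (real k)) x *\<^sub>R f x = f x) sequentially"
    unfolding eventually_sequentially by (intro exI[of _ K]) (auto simp: indicator_def)
  then show "(\<lambda>k. indicator (cball 0 (real k)) x *\<^sub>R f x) \<longlonglongrightarrow> f x" by (rule tendsto_eventually)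
qed

lemma locally_integrable_cong_AE:
  fixes f g :: "'a::euclidean_space \<Rightarrow> 'b::euclidean_space"
  assumes f: "locally_integrable f" and g: "g \<in> borel_measurable lebesgue" and eq: "AE x in lebesgue. f x = g x"
  shows "locally_integrable g"
  unfolding locally_integrable_def set_integrable_def
proof (intro allI impI)
  fix K :: "'a set" assume K: "compact K"
  have i: "integrable lebesgue (\<lambda>x. indicator K x *\<^sub>R f x)"
    using f K unfolding locally_integrable_def set_integrable_def by blast
  show "integrable lebesgue (\<lambda>x. indicator K x *\<^sub>R g x)"
  proof (rule integrable_cong_AE_imp[OF i])
    have "K \<in> sets lebesgue" using K by (auto intro: lmeasurable_compact fmeasurableD)
    then show "(\<lambda>x. indicator K x *\<^sub>R g x) \<in> borel_measurable lebesgue"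
      using g by (intro borel_measurable_scaleR borel_measurable_indicator)
    show "AE x in lebesgue. indicator K x *\<^sub>R f x = indicator K x *\<^sub>R g x"
      using eq by eventually_elim simp
  qed
qed

lemma has_weak_gradient_cong_AE:
  fixes u u' :: "real ^ 'n \<Rightarrow> complex"
  assumes wg: "has_weak_gradient u G" and m: "u' \<in> borel_measurable borel" "G' \<in> borel_measurable borel"
    and eq: "AE x in lborel. u x = u' x" "AE x in lborel. G x = G' x"
  shows "has_weak_gradient u' G'"
proof -
  have m': "u' \<in> borel_measurable lebesgue" "G' \<in> borel_measurable lebesgue"
    using m by (simp_all add: measurable_completion)
  have eq': "AE x in lebesgue. u x = u' x" "AE x in lebesgue. G x = G' x"
    using eq by (auto intro: AE_completion)
  have l: "locally_integrable u" "locally_integrable G" using wg by (auto simp: has_weak_gradient_def)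
  have lm: "u \<in> borel_measurable lebesgue" "G \<in> borel_measurable lebesgue"
    by (auto intro: locally_integrable_lebesgue_measurable l)
  have "(LINT x|lebesgue. partial_deriv j \<phi> x *\<^sub>R u' x) = - (LINT x|lebesgue. \<phi> x *\<^sub>R (G' x $ j))"
    if \<phi>: "test_function \<phi>" for \<phi> j
  proof -
    have [measurable]: "\<phi> \<in> borel_measurable lebesgue" "partial_deriv j \<phi> \<in> borel_measurable lebesgue"
      using test_function_continuous[OF \<phi>] by (auto intro!: measurable_completion borel_measurable_continuous_onI)
    note [measurable] = m' lm
    have "(LINT x|lebesgue. partial_deriv j \<phi> x *\<^sub>R u' x) = (LINT x|lebesgue. partial_deriv j \<phi> x *\<^sub>R u x)"
      by (rule integral_cong_AE) (use eq'(1) in \<open>measurable, auto\<close>)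
    also have "\<dots> = - (LINT x|lebesgue. \<phi> x *\<^sub>R (G x $ j))"
      using wg \<phi> by (simp add: has_weak_gradient_def)
    also have "(LINT x|lebesgue. \<phi> x *\<^sub>R (G x $ j)) = (LINT x|lebesgue. \<phi> x *\<^sub>R (G' x $ j))"
      by (rule integral_cong_AE) (use eq'(2) in \<open>measurable, auto\<close>)
    finally show ?thesis .
  qed
  then show ?thesis
    using locally_integrable_cong_AE[OF l(1) m'(1) eq'(1)] locally_integrable_cong_AE[OF l(2) m'(2) eq'(2)]
    by (simp add: has_weak_gradient_def)
qed

text \<open>The difference of two weak gradients is orthogonal to all test functions.\<close>

lemma weak_gradient_unique:
  fixes u :: "real ^ 'n \<Rightarrow> complex"
  assumes G: "has_weak_gradient u G" and H: "has_weak_gradient u H"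
  shows "AE x in lebesgue. G x = H x"
proof -
  have l: "locally_integrable G" "locally_integrable H" using G H by (auto simp: has_weak_gradient_def)
  have comp: "locally_integrable (\<lambda>x. F x $ j)" if "locally_integrable F" for F :: "real ^ 'n \<Rightarrow> complex ^ 'n" and j
    unfolding locally_integrable_def set_integrable_def
  proof (intro allI impI)
    fix K :: "(real ^ 'n) set" assume "compact K"
    then have "integrable lebesgue (\<lambda>x. indicator K x *\<^sub>R F x)"
      using that unfolding locally_integrable_def set_integrable_def by blast
    from integrable_bounded_linear[OF bounded_linear_vec_nth[of j] this]
    show "integrable lebesgue (\<lambda>x. indicator K x *\<^sub>R (F x $ j))" by simp
  qed
  have "AE x in lebesgue. G x $ j - H x $ j = 0" for j
  proof (rule fundamental_lemma_variations)
    show "locally_integrable (\<lambda>x. G x $ j - H x $ j)"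
      using comp[OF l(1), of j] comp[OF l(2), of j] unfolding locally_integrable_def by (auto intro: set_integral_diff(1))
    fix \<phi> :: "real ^ 'n \<Rightarrow> real" assume \<phi>: "test_function \<phi>"
    obtain R where R: "\<And>x. norm x > R \<Longrightarrow> \<phi> x = 0" using test_function_vanishes[OF \<phi>] by metis
    obtain B where B: "B > 0" "\<And>x. \<bar>\<phi> x\<bar> \<le> B" using bounded_vanishing[OF test_function_continuous(1)[OF \<phi>] R] by metis
    have \<phi>m[measurable]: "\<phi> \<in> borel_measurable lebesgue"
      using test_function_continuous(1)[OF \<phi>] by (auto intro!: measurable_completion borel_measurable_continuous_onI)
    have int: "integrable lebesgue (\<lambda>x. \<phi> x *\<^sub>R (F x $ j))" if F: "locally_integrable F" for F :: "real ^ 'n \<Rightarrow> complex ^ 'n"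
    proof -
      have i: "integrable lebesgue (\<lambda>x. B *\<^sub>R (indicator (cball 0 R) x *\<^sub>R (F x $ j)))"
        using comp[OF F, of j] unfolding locally_integrable_def set_integrable_def by (intro integrable_scaleR_right) auto
      then show ?thesis
      proof (rule Bochner_Integration.integrable_bound)
        show "(\<lambda>x. \<phi> x *\<^sub>R (F x $ j)) \<in> borel_measurable lebesgue"
          by (intro borel_measurable_scaleR \<phi>m locally_integrable_lebesgue_measurable comp F)
        show "AE x in lebesgue. norm (\<phi> x *\<^sub>R (F x $ j)) \<le> norm (B *\<^sub>R (indicator (cball 0 R) x *\<^sub>R (F x $ j)))"
        proof (rule AE_I2)
          fix x
          show "norm (\<phi> x *\<^sub>R (F x $ j)) \<le> norm (B *\<^sub>R (indicator (cball 0 R) x *\<^sub>R (F x $ j)))"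
            using B(1) B(2)[of x] R[of x] by (cases "norm x > R") (auto intro: mult_right_mono)
        qed
      qed
    qed
    have "(LINT x|lebesgue. \<phi> x *\<^sub>R (G x $ j - H x $ j)) = (LINT x|lebesgue. \<phi> x *\<^sub>R (G x $ j)) - (LINT x|lebesgue. \<phi> x *\<^sub>R (H x $ j))"
      unfolding scaleR_diff_right by (rule Bochner_Integration.integral_diff[OF int[OF l(1)] int[OF l(2)]])
    also have "\<dots> = 0"
    proof -
      have "(LINT x|lebesgue. partial_deriv j \<phi> x *\<^sub>R u x) = - (LINT x|lebesgue. \<phi> x *\<^sub>R (F x $ j))"
        if "has_weak_gradient u F" for F
        using that \<phi> by (simp add: has_weak_gradient_def)
      from this[OF G] this[OF H] show ?thesis by simp
    qed
    finally show "(LINT x|lebesgue. \<phi> x *\<^sub>R (G x $ j - H x $ j)) = 0" .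
  qed
  then have "AE x in lebesgue. \<forall>j. G x $ j - H x $ j = 0" by (simp add: AE_all_countable)
  then show ?thesis by eventually_elim (simp add: vec_eq_iff)
qed

lemma borel_measurable_lebesgue_cong_AE:
  fixes f g :: "'a::euclidean_space \<Rightarrow> ennreal"
  assumes f: "f \<in> borel_measurable borel" and eq: "AE x in lborel. f x = g x"
  shows "g \<in> borel_measurable lebesgue"
proof (rule borel_measurableI_greater)
  fix y
  have s: "{x \<in> space lebesgue. y < f x} \<in> sets lebesgue"
    using f by (intro borel_measurable_less borel_measurable_const) (simp add: measurable_completion)
  have ae: "AE x in lebesgue. (x \<in> {x \<in> space lebesgue. y < f x}) = (x \<in> {x \<in> space lebesgue. y < g x})"
    using AE_completion[OF eq] by eventually_elim simp
  show "{x \<in> space lebesgue. y < g x} \<in> sets lebesgue"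
    by (rule completion.in_sets_AE[OF ae s]) auto
qed

lemma borel_measurable_vec_lambda:
  fixes f :: "'n::finite \<Rightarrow> 'a \<Rightarrow> 'b::euclidean_space"
  assumes "\<And>j. f j \<in> borel_measurable M"
  shows "(\<lambda>x. \<chi> j. f j x) \<in> borel_measurable M"
  using assms by (subst borel_measurable_euclidean_space) (auto simp: Basis_vec_def inner_axis)

text \<open>By polar coordinates the points with norm in a null set of radii form a null set.\<close>

lemma AE_lborel_norm:
  fixes P :: "real \<Rightarrow> bool"
  assumes "AE r in lborel. r > 0 \<longrightarrow> P r"
  shows "AE z in (lborel :: (real ^ 'n) measure). z \<noteq> 0 \<longrightarrow> P (norm z)"
proof -
  obtain N where N: "N \<in> null_sets lborel" "{r. \<not> (r > 0 \<longrightarrow> P r)} \<subseteq> N"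
    using assms by (auto simp: eventually_ae_filter)
  have Nm[measurable]: "N \<in> sets borel" using N(1) by auto
  have "(\<integral>\<^sup>+z. indicator N (norm (z :: real ^ 'n)) \<partial>lborel)
      = emeasure (sphere_measure :: (real ^ 'n) measure) (sphere 0 1) * (\<integral>\<^sup>+r. indicator N r \<partial>radial_measure CARD('n))"
    by (rule nn_integral_radial_mass) measurable
  also have "(\<integral>\<^sup>+r. indicator N r \<partial>radial_measure CARD('n)) = 0"
  proof -
    have "AE r in lborel. r \<notin> N" using N(1) by (rule AE_not_in)
    then have "AE r in radial_measure CARD('n). indicator N r = (0::ennreal)"
      unfolding radial_measure_def by (subst AE_density) auto
    then show ?thesis by (subst nn_integral_0_iff_AE) auto
  qed
  finally have "(\<integral>\<^sup>+z. indicator N (norm (z :: real ^ 'n)) \<partial>lborel) = 0" by simp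
  then have "AE z in (lborel :: (real ^ 'n) measure). indicator N (norm z) = (0::ennreal)"
    by (subst (asm) nn_integral_0_iff_AE) auto
  then show ?thesis
  proof (rule eventually_mono, intro impI)
    fix z :: "real ^ 'n" assume "indicator N (norm z) = (0::ennreal)" "z \<noteq> 0"
    then have "norm z \<notin> N" "norm z > 0" by (auto simp: indicator_def split: if_splits)
    then show "P (norm z)" using N(2) by blast
  qed
qed

lemma AE_lborel_translate:
  fixes P :: "'a::euclidean_space \<Rightarrow> bool"
  assumes "AE z in lborel. P z"
  shows "AE y in lborel. P (y + c)"
proof -
  obtain N where N: "N \<in> null_sets lborel" "{z. \<not> P z} \<subseteq> N"
    using assms by (auto simp: eventually_ae_filter)
  have "AE y in distr lborel borel ((+) c). y \<notin> N"
    unfolding lborel_distr_plus using N(1) by (rule AE_not_in)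
  then have "AE y in lborel. c + y \<notin> N"
    using N(1) by (subst (asm) AE_distr_iff) auto
  then show ?thesis by (rule eventually_mono) (use N(2) in \<open>auto simp: add.commute\<close>)
qed

section \<open>Borel profiles for mollifiers\<close>

text \<open>A Borel version of the profile agrees with it only almost everywhere. Capping it by \<open>C r\<^sup>2\<close> changes it on
  a null set and restores the growth bound at every \<open>r > 1\<close>. Integrability follows from the
  normalization, because the integral of a non-integrable function is 0, not 1.\<close>

lemma radial_mollifiers_weights:
  assumes \<rho>: "radial_mollifiers N \<rho>"
    and bound: "(SUP t\<in>{1<..}. SUP n. ereal (\<rho> n t / t\<^sup>2)) < \<infinity>"
  obtains w C where "mollifier_weights w N C"
    "\<And>n. AE r in lborel. r > 0 \<longrightarrow> ennreal (\<rho> n r) = w n r"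
proof -
  have nn: "\<And>n r. r \<ge> 0 \<Longrightarrow> \<rho> n r \<ge> 0" using \<rho> by (auto simp: radial_mollifiers_def)
  obtain C where C: "C \<ge> 0" "\<And>n t. t > 1 \<Longrightarrow> \<rho> n t \<le> C * t\<^sup>2"
  proof -
    let ?s = "SUP t\<in>{1<..}. SUP n. ereal (\<rho> n t / t\<^sup>2)"
    have le: "ereal (\<rho> n t / t\<^sup>2) \<le> ?s" if "t > 1" for n t
    proof -
      have "ereal (\<rho> n t / t\<^sup>2) \<le> (SUP n. ereal (\<rho> n t / t\<^sup>2))" by (rule SUP_upper) simp
      also have "\<dots> \<le> ?s" by (rule SUP_upper[of t "{1<..}" "\<lambda>t. SUP n. ereal (\<rho> n t / t\<^sup>2)"]) (use that in simp)
      finally show ?thesis .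
    qed
    have "0 \<le> ereal (\<rho> 0 2 / 2\<^sup>2)" using nn[of 2 0] by simp
    also have "\<dots> \<le> ?s" by (rule le) simp
    finally have "0 \<le> ?s" .
    then obtain c where c: "?s = ereal c" "c \<ge> 0" using bound by (cases ?s) auto
    have "\<rho> n t \<le> c * t\<^sup>2" if "t > 1" for n t
      using le[OF that, of n] that unfolding c by (simp add: divide_le_eq)
    then show ?thesis using that c by blast
  qed
  have "\<forall>n. \<exists>g. g \<in> borel_measurable borel \<and> (AE r in lborel. indicator {0..} r *\<^sub>R \<rho> n r = g r)"
  proof
    fix n
    have "(\<lambda>r. indicator {0..} r *\<^sub>R \<rho> n r) \<in> borel_measurable lebesgue"
      using \<rho> by (simp add: radial_mollifiers_def set_borel_measurable_def)
    from lebesgue_borel_representative[OF this]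
    show "\<exists>g. g \<in> borel_measurable borel \<and> (AE r in lborel. indicator {0..} r *\<^sub>R \<rho> n r = g r)" by blast
  qed
  from choice[OF this] obtain g where gm[measurable]: "\<And>n. g n \<in> borel_measurable borel"
    and g: "\<And>n. AE r in lborel. indicator {0..} r *\<^sub>R \<rho> n r = g n r" by blast
  define w where "w n r = ennreal (if r > 1 then min (g n r) (C * r\<^sup>2) else g n r)" for n r
  have [measurable]: "w n \<in> borel_measurable borel" for n unfolding w_def by measurable
  have w: "AE r in lborel. r > 0 \<longrightarrow> ennreal (\<rho> n r) = w n r" for n
    using g[of n]
  proof eventually_elim
    case (elim r)
    then show ?case using C(2)[of r n] by (auto simp: w_def min_def)
  qed
  have int: "(\<integral>\<^sup>+r. w n r * indicator {\<delta>..} r \<partial>radial_measure N) = ennreal (LINT r:{\<delta>..}|lebesgue. \<rho> n r * r ^ (N - 1))"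
    if "\<delta> \<ge> 0" for n \<delta>
  proof -
    have full: "(LINT r:{0..}|lebesgue. \<rho> n r * r ^ (N - 1)) = 1"
      using \<rho> by (simp add: radial_mollifiers_def)
    have "integrable lebesgue (\<lambda>r. indicator {0..} r *\<^sub>R (\<rho> n r * r ^ (N - 1)))"
    proof (rule ccontr)
      assume "\<not> ?thesis"
      then have "(LINT r:{0..}|lebesgue. \<rho> n r * r ^ (N - 1)) = 0"
        unfolding set_lebesgue_integral_def by (rule not_integrable_integral_eq)
      then show False using full by simp
    qed
    then have "set_integrable lebesgue {0..} (\<lambda>r. \<rho> n r * r ^ (N - 1))" by (simp add: set_integrable_def)
    then have i: "set_integrable lebesgue {\<delta>..} (\<lambda>r. \<rho> n r * r ^ (N - 1))"
      by (rule set_integrable_subset) (use that in auto)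
    have "(\<integral>\<^sup>+r. w n r * indicator {\<delta>..} r \<partial>radial_measure N)
       = (\<integral>\<^sup>+r. ennreal (indicator {0<..} r * r ^ (N - 1)) * (w n r * indicator {\<delta>..} r) \<partial>lborel)"
      unfolding radial_measure_def by (rule nn_integral_density) auto
    also have "\<dots> = (\<integral>\<^sup>+r. ennreal (indicator {\<delta>..} r *\<^sub>R (\<rho> n r * r ^ (N - 1))) \<partial>lborel)"
    proof (rule nn_integral_cong_AE)
      show "AE r in lborel. ennreal (indicator {0<..} r * r ^ (N - 1)) * (w n r * indicator {\<delta>..} r)
          = ennreal (indicator {\<delta>..} r *\<^sub>R (\<rho> n r * r ^ (N - 1)))"
        using w[of n] AE_lborel_singleton[of 0]
      proof eventually_elim
        case (elim r)
        show ?case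
        proof (cases "r > 0")
          case True
          then have "w n r = ennreal (\<rho> n r)" using elim by simp
          then show ?thesis using True nn[of r n]
            by (auto simp: indicator_def ennreal_mult[symmetric] mult.commute)
        next
          case False
          then show ?thesis using that elim by (auto simp: indicator_def)
        qed
      qed
    qed
    also have "\<dots> = (\<integral>\<^sup>+r. ennreal (indicator {\<delta>..} r *\<^sub>R (\<rho> n r * r ^ (N - 1))) \<partial>lebesgue)"
      by (rule nn_integral_completion[symmetric])
    also have "\<dots> = ennreal (LINT r:{\<delta>..}|lebesgue. \<rho> n r * r ^ (N - 1))"
      unfolding set_lebesgue_integral_def
    proof (rule nn_integral_eq_integral)
      show "integrable lebesgue (\<lambda>r. indicator {\<delta>..} r *\<^sub>R (\<rho> n r * r ^ (N - 1)))" using i by (simp add: set_integrable_def)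
      show "AE r in lebesgue. 0 \<le> indicator {\<delta>..} r *\<^sub>R (\<rho> n r * r ^ (N - 1))"
        using nn that by (intro AE_I2) (auto simp: indicator_def)
    qed
    finally show ?thesis .
  qed
  have "mollifier_weights w N C"
  proof
    show "w n \<in> borel_measurable borel" for n by measurable
    show "(\<integral>\<^sup>+r. w n r \<partial>radial_measure N) = 1" for n
    proof -
      have "(\<integral>\<^sup>+r. w n r \<partial>radial_measure N) = (\<integral>\<^sup>+r. w n r * indicator {0..} r \<partial>radial_measure N)"
      proof (rule nn_integral_cong_AE)
        show "AE r in radial_measure N. w n r = w n r * indicator {0..} r"
          using AE_radial_measure_pos by eventually_elim auto
      qed
      also have "\<dots> = 1" using \<rho> by (simp add: int radial_mollifiers_def)
      finally show ?thesis .
    qed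
    show "(\<lambda>n. \<integral>\<^sup>+r. w n r * indicator {\<delta>..} r \<partial>radial_measure N) \<longlonglongrightarrow> 0" if "\<delta> > 0" for \<delta>
    proof -
      have "(\<lambda>n. LINT r:{\<delta>..}|lebesgue. \<rho> n r * r ^ (N - 1)) \<longlonglongrightarrow> 0"
        using \<rho> that by (simp add: radial_mollifiers_def)
      from tendsto_ennrealI[OF this] show ?thesis using that by (simp add: int)
    qed
    show "C \<ge> 0" by (rule C)
    show "w n t \<le> ennreal (C * t\<^sup>2)" if "t > 1" for n t
      using that by (auto simp: w_def intro: ennreal_leI)
  qed
  then show ?thesis using that w by blast
qed

section \<open>Convergence of the magnetic functional\<close>

theorem proposition4p1:
  fixes A :: "real ^ 'n \<Rightarrow> real ^ 'n"
    and u :: "real ^ 'n \<Rightarrow> complex"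
    and G :: "real ^ 'n \<Rightarrow> complex ^ 'n"
    and \<rho> :: "nat \<Rightarrow> real \<Rightarrow> real"
    and \<omega> :: "real ^ 'n"
  assumes "\<exists>L. L-lipschitz_on UNIV A"
    and "u \<in> H1_mag A"
    and "has_weak_gradient u G"
    and "radial_mollifiers CARD('n) \<rho>"
    and "(SUP t\<in>{1<..}. SUP n. ereal (\<rho> n t / t\<^sup>2)) < \<infinity>"
    and "norm \<omega> = 1"
  shows "(AE x in lebesgue. (\<lambda>n. D_mag A (\<rho> n) u x) \<longlonglongrightarrow>
            ennreal (2 * Q_const \<omega> * (norm (magnetic_gradient A u G x))\<^sup>2)) \<and>
         tendsto_L1 (\<lambda>n. D_mag A (\<rho> n) u)
            (\<lambda>x. 2 * Q_const \<omega> * (norm (magnetic_gradient A u G x))\<^sup>2)"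
proof -
  obtain L where L: "L-lipschitz_on UNIV A" using assms(1) by blast
  obtain G0 where u2: "square_integrable u" and wg0: "has_weak_gradient u G0" and M2: "square_integrable (magnetic_gradient A u G0)"
    using assms(2) by (auto simp: H1_mag_def)
  have um: "u \<in> borel_measurable lebesgue" using u2 by (simp add: square_integrable_def)
  have Gm: "G \<in> borel_measurable lebesgue"
    using assms(3) by (auto simp: has_weak_gradient_def intro: locally_integrable_lebesgue_measurable)
  obtain u' where u'm[measurable]: "u' \<in> borel_measurable borel" and u': "AE x in lborel. u x = u' x"
    using lebesgue_borel_representative[OF um] by blast
  obtain G' where G'm[measurable]: "G' \<in> borel_measurable borel" and G': "AE x in lborel. G x = G' x"
    using lebesgue_borel_representative[OF Gm] by blast
  define M where "M = magnetic_gradient A u' G'"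
  have Am[measurable]: "A \<in> borel_measurable borel"
    using L by (intro borel_measurable_continuous_onI lipschitz_on_continuous_on)
  have Mm: "M \<in> borel_measurable borel"
  proof -
    have "(\<lambda>x. \<chi> j. \<i> * complex_of_real (A x $ j) * u' x) \<in> borel_measurable borel"
      by (rule borel_measurable_vec_lambda) measurable
    then show ?thesis unfolding M_def magnetic_gradient_def by measurable
  qed
  have wg': "has_weak_gradient u' G'"
    by (rule has_weak_gradient_cong_AE[OF assms(3) u'm G'm u' G'])
  have MG: "AE x in lborel. M x = magnetic_gradient A u G x"
    using u' G' by eventually_elim (simp add: M_def magnetic_gradient_def)
  have MG0: "AE x in lborel. magnetic_gradient A u G0 x = M x"
  proof -
    have "AE x in lborel. G x = G0 x" using weak_gradient_unique[OF assms(3) wg0] by (simp add: AE_completion_iff)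
    then show ?thesis using MG by eventually_elim (simp add: magnetic_gradient_def)
  qed
  have sq_fin: "(\<integral>\<^sup>+x. ennreal ((norm (g x))\<^sup>2) \<partial>lborel) < \<infinity>"
    if "square_integrable f" and eq: "AE x in lborel. f x = g x" for f g :: "real ^ 'n \<Rightarrow> 'b::euclidean_space"
  proof -
    have "integrable lebesgue (\<lambda>x. (norm (f x))\<^sup>2)" using that by (simp add: square_integrable_def)
    then have "(\<integral>\<^sup>+x. ennreal (norm ((norm (f x))\<^sup>2)) \<partial>lebesgue) < \<infinity>" by (simp add: integrable_iff_bounded)
    moreover have "(\<integral>\<^sup>+x. ennreal ((norm (g x))\<^sup>2) \<partial>lborel) = (\<integral>\<^sup>+x. ennreal (norm ((norm (f x))\<^sup>2)) \<partial>lborel)"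
      by (rule nn_integral_cong_AE) (use eq in \<open>eventually_elim, simp\<close>)
    ultimately show ?thesis by (simp add: nn_integral_completion)
  qed
  \<comment> \<open>the hypothesis on \<open>u\<close> supplies some weak gradient \<open>G0\<close> with square-integrable magnetic gradient; by
    uniqueness it is a version of \<open>G\<close>\<close>
  interpret magnetic_function A u' M L
  proof
    show "(\<integral>\<^sup>+x. ennreal ((cmod (u' x))\<^sup>2) \<partial>lborel) < \<infinity>" by (rule sq_fin[OF u2 u'])
    show "(\<integral>\<^sup>+x. ennreal ((norm (M x))\<^sup>2) \<partial>lborel) < \<infinity>" by (rule sq_fin[OF M2 MG0])
    show "AE x in lborel. integrable lborel (\<lambda>t. indicator {0..1::real} t *\<^sub>R magnetic_increment A u' M x z t) \<and>
      Psi A u' x (x + z) - u' x = (LINT t|lborel. indicator {0..1::real} t *\<^sub>R magnetic_increment A u' M x z t)" for z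
      unfolding M_def by (rule Psi_eq_line_integral[OF wg' u'm G'm])
  qed (use u'm Mm L in auto)
  obtain w C where w: "mollifier_weights w CARD('n) C" and \<rho>w: "\<And>n. AE r in lborel. r > 0 \<longrightarrow> ennreal (\<rho> n r) = w n r"
    using radial_mollifiers_weights[OF assms(4,5)] by blast
  interpret W: mollifier_weights w "CARD('n)" C by (rule w)
  note [measurable] = W.w_meas
  have D: "AE x in lborel. D_mag A (\<rho> n) u x = nonlocal_energy (w n) x" for n
    using u'
  proof eventually_elim
    case (elim x)
    \<comment> \<open>the profiles and \<open>u\<close> are replaced by their Borel versions under the integral, and \<open>y = x + z\<close>\<close>
    have "AE z in (lborel :: (real ^ 'n) measure). z \<noteq> 0 \<longrightarrow> ennreal (\<rho> n (norm z)) = w n (norm z)"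
      by (rule AE_lborel_norm[OF \<rho>w])
    from AE_lborel_translate[OF this, of "- x"]
    have ae: "AE y in lborel. y - x \<noteq> 0 \<longrightarrow> ennreal (\<rho> n (norm (y - x))) = w n (norm (y - x))" by simp
    have "D_mag A (\<rho> n) u x = (\<integral>\<^sup>+y. ennreal ((cmod (Psi A u x y - Psi A u x x))\<^sup>2 / (norm (x - y))\<^sup>2 * \<rho> n (norm (x - y))) \<partial>lborel)"
      unfolding D_mag_def by (rule nn_integral_completion)
    also have "\<dots> = (\<integral>\<^sup>+y. w n (norm (y + - x)) * ennreal ((cmod (increment x (y + - x)))\<^sup>2 / (norm (y + - x))\<^sup>2) \<partial>lborel)"
    proof (rule nn_integral_cong_AE)
      show "AE y in lborel. ennreal ((cmod (Psi A u x y - Psi A u x x))\<^sup>2 / (norm (x - y))\<^sup>2 * \<rho> n (norm (x - y)))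
        = w n (norm (y + - x)) * ennreal ((cmod (increment x (y + - x)))\<^sup>2 / (norm (y + - x))\<^sup>2)"
        using ae u'
      proof eventually_elim
        case y: (elim y)
        show ?case
        proof (cases "y = x")
          case False
          have inc: "Psi A u x y - Psi A u x x = increment x (y - x)"
            using y elim by (simp add: Psi_def increment_def)
          have wn: "w n (norm (y - x)) = ennreal (\<rho> n (norm (y - x)))" using y(1) False by simp
          have mul: "ennreal (a * \<rho> n (norm (y - x))) = ennreal (\<rho> n (norm (y - x))) * ennreal a" if "a \<ge> 0" for a
            using that assms(4) by (subst ennreal_mult[symmetric]) (auto simp: radial_mollifiers_def mult.commute)
          show ?thesis
            unfolding add_uminus_conv_diff inc norm_minus_commute[of x y] wn by (rule mul) simp
        qed simp
      qed
    qed
    also have "\<dots> = nonlocal_energy (w n) x"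
      unfolding nonlocal_energy_def
      by (rule nn_integral_lborel_translate[of "\<lambda>z. w n (norm z) * ennreal ((cmod (increment x z))\<^sup>2 / (norm z)\<^sup>2)"]) measurable
    finally show ?case .
  qed
  let ?q = "2 * Q_const \<omega>"
  let ?g = "\<lambda>x. ?q * (norm (magnetic_gradient A u G x))\<^sup>2"
  have Q: "Q_const \<omega> \<ge> 0" by (rule sphere_second_moment_unit(2)[OF assms(6)])
  have Dall: "AE x in lborel. \<forall>n. D_mag A (\<rho> n) u x = nonlocal_energy (w n) x"
    using D by (simp add: AE_all_countable)
  have ptw: "AE x in lborel. (\<lambda>n. D_mag A (\<rho> n) u x) \<longlonglongrightarrow> ennreal (?g x)"
    using AE_nonlocal_energy_tendsto[OF w assms(6)] Dall MG by eventually_elim simp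
  have Dint: "(\<integral>\<^sup>+x. D_mag A (\<rho> n) u x \<partial>lebesgue) = (\<integral>\<^sup>+x. nonlocal_energy (w n) x \<partial>lborel)" for n
    unfolding nn_integral_completion by (rule nn_integral_cong_AE[OF D])
  have Dm: "D_mag A (\<rho> n) u \<in> borel_measurable lebesgue" for n
  proof (rule borel_measurable_lebesgue_cong_AE)
    show "nonlocal_energy (w n) \<in> borel_measurable borel" by (rule nonlocal_energy_meas) measurable
    show "AE x in lborel. nonlocal_energy (w n) x = D_mag A (\<rho> n) u x" using D[of n] by eventually_elim simp
  qed
  have Dfin: "(\<integral>\<^sup>+x. D_mag A (\<rho> n) u x \<partial>lebesgue) < \<infinity>" for n
    unfolding Dint by (rule limsup_integral_nonlocal_energy(1)[OF w assms(6)])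
  have gint: "integrable lebesgue ?g"
  proof (rule integrable_mult_right)
    have "integrable lebesgue (\<lambda>x. (norm (magnetic_gradient A u G0 x))\<^sup>2)" using M2 by (simp add: square_integrable_def)
    then show "integrable lebesgue (\<lambda>x. (norm (magnetic_gradient A u G x))\<^sup>2)"
    proof (rule integrable_cong_AE_imp)
      have "(\<lambda>x. (norm (M x))\<^sup>2) \<in> borel_measurable lebesgue" using Mm by (simp add: measurable_completion)
      then show "(\<lambda>x. (norm (magnetic_gradient A u G x))\<^sup>2) \<in> borel_measurable lebesgue"
        by (rule borel_measurable_AE) (use MG in \<open>auto simp: AE_completion_iff elim: eventually_mono\<close>)
      show "AE x in lebesgue. (norm (magnetic_gradient A u G0 x))\<^sup>2 = (norm (magnetic_gradient A u G x))\<^sup>2"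
        using weak_gradient_unique[OF assms(3) wg0] by eventually_elim (simp add: magnetic_gradient_def)
    qed
  qed
  have Fint: "integrable lebesgue (\<lambda>x. enn2real (D_mag A (\<rho> n) u x))" for n
  proof (rule integrableI_nonneg)
    show "(\<lambda>x. enn2real (D_mag A (\<rho> n) u x)) \<in> borel_measurable lebesgue" using Dm[of n] by measurable
    have "(\<integral>\<^sup>+x. ennreal (enn2real (D_mag A (\<rho> n) u x)) \<partial>lebesgue) \<le> (\<integral>\<^sup>+x. D_mag A (\<rho> n) u x \<partial>lebesgue)"
      by (intro nn_integral_mono) (simp add: ennreal_enn2real_if)
    then show "(\<integral>\<^sup>+x. ennreal (enn2real (D_mag A (\<rho> n) u x)) \<partial>lebesgue) < \<infinity>"
      using Dfin[of n] by (rule le_less_trans)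
  qed simp
  have Fptw: "AE x in lebesgue. (\<lambda>n. enn2real (D_mag A (\<rho> n) u x)) \<longlonglongrightarrow> ?g x"
    using AE_completion[OF ptw]
  proof eventually_elim
    case (elim x)
    then show ?case by (rule tendsto_enn2real) (use Q in simp)
  qed
  have "limsup (\<lambda>n. \<integral>\<^sup>+x. norm (enn2real (D_mag A (\<rho> n) u x)) \<partial>lebesgue) \<le> limsup (\<lambda>n. \<integral>\<^sup>+x. nonlocal_energy (w n) x \<partial>lborel)"
    unfolding Dint[symmetric]
    by (intro Limsup_mono always_eventually allI nn_integral_mono) (simp add: ennreal_enn2real_if)
  also have "\<dots> \<le> (\<integral>\<^sup>+x. ennreal (?q * (norm (M x))\<^sup>2) \<partial>lborel)"
    by (rule limsup_integral_nonlocal_energy(2)[OF w assms(6)])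
  also have "\<dots> = (\<integral>\<^sup>+x. norm (?g x) \<partial>lebesgue)"
    unfolding nn_integral_completion
  proof (rule nn_integral_cong_AE)
    show "AE x in lborel. ennreal (?q * (norm (M x))\<^sup>2) = ennreal (norm (?g x))"
      using MG by eventually_elim (use Q in simp)
  qed
  finally have ls: "limsup (\<lambda>n. \<integral>\<^sup>+x. norm (enn2real (D_mag A (\<rho> n) u x)) \<partial>lebesgue) \<le> (\<integral>\<^sup>+x. norm (?g x) \<partial>lebesgue)" .
  have sch: "(\<lambda>n. \<integral>\<^sup>+x. norm (enn2real (D_mag A (\<rho> n) u x) - ?g x) \<partial>lebesgue) \<longlonglongrightarrow> 0"
    by (rule Scheffe_lemma1[OF Fint gint Fptw ls])
  have "(\<lambda>n. LINT x|lebesgue. \<bar>enn2real (D_mag A (\<rho> n) u x) - ?g x\<bar>) \<longlonglongrightarrow> 0"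
  proof -
    have eq: "(\<integral>\<^sup>+x. norm (enn2real (D_mag A (\<rho> n) u x) - ?g x) \<partial>lebesgue) = ennreal (LINT x|lebesgue. \<bar>enn2real (D_mag A (\<rho> n) u x) - ?g x\<bar>)" for n
      using Fint[of n] gint by (subst nn_integral_eq_integral) (auto intro!: Bochner_Integration.integrable_abs Bochner_Integration.integrable_diff)
    have "(\<lambda>n. ennreal (LINT x|lebesgue. \<bar>enn2real (D_mag A (\<rho> n) u x) - ?g x\<bar>)) \<longlonglongrightarrow> ennreal 0"
      using sch unfolding eq by simp
    then have "(\<lambda>n. enn2real (ennreal (LINT x|lebesgue. \<bar>enn2real (D_mag A (\<rho> n) u x) - ?g x\<bar>))) \<longlonglongrightarrow> 0"
      by (rule tendsto_enn2real) simp
    then show ?thesis by simp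
  qed
  then have "tendsto_L1 (\<lambda>n. D_mag A (\<rho> n) u) ?g"
    unfolding tendsto_L1_def using Dm Dfin gint by blast
  then show ?thesis using AE_completion[OF ptw] by blast
qed

end
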